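(* Let $\rho>0$ and let $f=(f_1,\ldots,f_m)$ be a contractive free holomorphic function with $\|f(0)\|<1$ such that the boundary functions $\widetilde f_1,\ldots,\widetilde f_m$ are in the noncommutative disc algebra $\mathcal A_n$. If $(T_1,\ldots,T_n)\in B(\mathcal H)^n$ and $\omega_\rho(T_1,\ldots,T_n)<1$, then $$\omega_{\rho_f}(f(T_1,\ldots,T_n))<1,$$ where $$\rho_f:=\begin{cases}1+(\rho-1)\dfrac{1-\|f(0)\|}{1+\|f(0)\|}&\text{if }\rho<1,\\[2mm]1+(\rho-1)\dfrac{1+\|f(0)\|}{1-\|f(0)\|}&\text{if }\rho\ge1.\end{cases}$$ In particular, if $f(0)=0$, then $\omega_\rho(f(T_1,\ldots,T_n))<1$.
   Context: Let $n,m\ge1$, $\mathcal H$ a complex Hilbert space, $\mathcal K$ a separable infinite-dimensional Hilbert space. $\mathbb F_n^+$ is the unital free semigroup on generators $g_1,\ldots,g_n$ with identity $g_0$; $|\alpha|$ is the length of $\alpha$. $T_\alpha:=T_{i_1}\cdots T_{i_k}$ if $\alpha=g_{i_1}\cdots g_{i_k}$, $T_{g_0}:=I$. For any number $n$ of operators and $\rho>0$, $T\in B(\mathcal H)^n$ is of class $\mathcal C_\rho$ if there exist a Hilbert space $\mathcal G\supseteq\mathcal H$ and isometries $V_1,\ldots,V_n\in B(\mathcal G)$ with mutually orthogonal ranges such that $T_\alpha=\rho P_{\mathcal H}V_\alpha|_{\mathcal H}$ for all $\alpha\in\mathbb F_n^+\setminus\{g_0\}$. The joint operator radius is $\omega_\rho(T):=\inf\{t>0:\frac1tT\in\mathcal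 C_\rho\}$. $[B(\mathcal K)^n]_1:=\{X\in B(\mathcal K)^n:\|\sum_iX_iX_i^*\|<1\}$. Each $f_j(X)=\sum_{k=0}^\infty\sum_{|\alpha|=k}a_\alpha^{(j)}X_\alpha$ ($a^{(j)}_\alpha\in\mathbb C$, $\limsup_k(\sum_{|\alpha|=k}|a_\alpha^{(j)}|^2)^{1/2k}\le1$) is a free holomorphic function on $[B(\mathcal K)^n]_1$; $f$ is contractive if the row operator $[f_1(X)\ \cdots\ f_m(X)]$ has norm at most $1$ for all $X\in[B(\mathcal K)^n]_1$. $f(0)=(f_1(0),\ldots,f_m(0))$ has norm the Euclidean norm in $\mathbb C^m$. $S_i\varphi:=e_i\otimes\varphi$ are the left creation operators on the full Fock space $F^2(H_n)=\mathbb C1\oplus\bigoplus_{k\ge1}H_n^{\otimes k}$ ($e_1,\ldots,e_n$ an orthonormal basis of the $n$-dimensional Hilbert space $H_n$), and $\mathcal A_n$ is the norm closed algebra generated by $S_1,\ldots,S_n,I$. The boundary function of $f_j$ is $\widetilde f_j=\lim_{r\to1}f_j(rS_1,\ldots,rS_n)$; $\widetilde f_j\in\mathcal A_n$ means that this limit exists in operator norm. For $T$ of class $\mathcal C_\rho$, $f(T)=(f_1(T),\ldots,f_m(T))\in B(\mathcal H)^m$ with $f_j(T):=\lim_{r\to1}f_j(rT_1,\ldots,rT_n)$ in operator norm (the limit exists). *)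

theory Defs
  imports "HOL-Analysis.Analysis"
begin

section \<open>Complex Hilbert spaces\<close>

text \<open>
  HOL-Analysis has only real inner products. The inner product below is conjugate-linear in
  its first argument. Definiteness of the inner product follows from \<open>norm_sq_cinner\<close>, and
  completeness is part of the class \<open>banach\<close>.
\<close>

class complex_hilbert = banach +
  fixes scaleC :: "complex \<Rightarrow> 'a \<Rightarrow> 'a" (infixr "*\<^sub>C" 75)
    and cinner :: "'a \<Rightarrow> 'a \<Rightarrow> complex"
  assumes scaleC_add_right: "c *\<^sub>C (x + y) = c *\<^sub>C x + c *\<^sub>C y"
    and scaleC_add_left: "(c + d) *\<^sub>C x = c *\<^sub>C x + d *\<^sub>C x"
    and scaleC_scaleC: "c *\<^sub>C d *\<^sub>C x = (c * d) *\<^sub>C x"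
    and scaleC_of_real: "complex_of_real r *\<^sub>C x = r *\<^sub>R x"
    and cinner_commute: "cinner x y = cnj (cinner y x)"
    and cinner_add_left: "cinner (x + y) z = cinner x z + cinner y z"
    and cinner_scaleC_left: "cinner (c *\<^sub>C x) y = cnj c * cinner x y"
    and norm_sq_cinner: "cinner x x = complex_of_real ((norm x)\<^sup>2)"

lemma cinner_add_right: "cinner x (y + z) = cinner x y + cinner x z"
  by (metis cinner_add_left cinner_commute complex_cnj_add)

lemma cinner_scaleC_right: "cinner x (c *\<^sub>C y) = c * cinner x y"
  by (metis cinner_scaleC_left cinner_commute complex_cnj_cnj complex_cnj_mult)

lemma norm_scaleC: "norm (c *\<^sub>C (x::'a::complex_hilbert)) = cmod c * norm x"
proof -
  have "complex_of_real ((norm (c *\<^sub>C x))\<^sup>2) = cnj c * (c * complex_of_real ((norm x)\<^sup>2))"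
    by (simp add: norm_sq_cinner[symmetric] cinner_scaleC_left cinner_scaleC_right
        del: of_real_power)
  also have "\<dots> = complex_of_real ((cmod c * norm x)\<^sup>2)"
    by (simp add: power_mult_distrib complex_norm_square[unfolded of_real_power] mult_ac)
  finally have "(norm (c *\<^sub>C x))\<^sup>2 = (cmod c * norm x)\<^sup>2"
    using of_real_eq_iff by blast
  then show ?thesis
    by (simp add: power2_eq_iff_nonneg)
qed

lemma cmod_cinner_le: "cmod (cinner x (y::'a::complex_hilbert)) \<le> norm x * norm y"
proof (cases "x = 0")
  case True
  have "cinner (0 *\<^sub>C x) y = 0"
    by (simp only: cinner_scaleC_left) simp
  moreover have "0 *\<^sub>C x = 0"
    using scaleC_of_real[of 0 x] by simp
  ultimately show ?thesis
    using True by simp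
next
  case False
  define N where "N = (norm x)\<^sup>2"
  define c where "c = cinner x y"
  define d where "d = - (c / complex_of_real N)"
  have N: "N > 0"
    using False by (simp add: N_def)
  have yx: "cinner y x = cnj c"
    unfolding c_def by (rule cinner_commute)
  have "complex_of_real ((norm (y + d *\<^sub>C x))\<^sup>2)
      = complex_of_real ((norm y)\<^sup>2) + d * cnj c + cnj d * c + cnj d * d * complex_of_real N"
    unfolding N_def norm_sq_cinner[symmetric] cinner_add_left cinner_add_right
      cinner_scaleC_left cinner_scaleC_right yx c_def[symmetric] by (simp add: algebra_simps)
  also have "\<dots> = complex_of_real ((norm y)\<^sup>2) - (c * cnj c) / complex_of_real N"
    using N by (simp add: d_def field_simps)
  also have "\<dots> = complex_of_real ((norm y)\<^sup>2 - (cmod c)\<^sup>2 / N)"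
    by (simp add: complex_norm_square[unfolded of_real_power])
  finally have "(norm (y + d *\<^sub>C x))\<^sup>2 = (norm y)\<^sup>2 - (cmod c)\<^sup>2 / N"
    using of_real_eq_iff by blast
  then have "(cmod c)\<^sup>2 / N \<le> (norm y)\<^sup>2"
    by (smt (verit) zero_le_power2)
  then have "(cmod c)\<^sup>2 \<le> (norm x * norm y)\<^sup>2"
    using N by (simp add: N_def field_simps power_mult_distrib)
  then show ?thesis
    unfolding c_def by (simp add: power2_le_iff_abs_le)
qed

instantiation complex :: complex_hilbert
begin

definition scaleC_complex :: "complex \<Rightarrow> complex \<Rightarrow> complex" where
  "scaleC_complex c x = c * x"

definition cinner_complex :: "complex \<Rightarrow> complex \<Rightarrow> complex" where
  "cinner_complex x y = cnj x * y"

instance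
proof
  show "cinner x x = complex_of_real ((norm x)\<^sup>2)" for x :: complex
    by (simp only: cinner_complex_def complex_norm_square mult.commute)
qed (simp_all add: scaleC_complex_def cinner_complex_def ring_distribs scaleR_conv_of_real
    mult.assoc mult.commute)

end

section \<open>Hilbert direct sums\<close>

text \<open>\<open>('i, 'h) ell2\<close> is the Hilbert direct sum of copies of \<open>'h\<close> indexed by \<open>'i\<close>.\<close>

typedef (overloaded) ('i, 'h) ell2 =
  "{f :: 'i \<Rightarrow> 'h::real_normed_vector. (\<lambda>i. (norm (f i))\<^sup>2) summable_on UNIV}"
  morphisms ell2_nth Abs_ell2
  by (rule exI[of _ "\<lambda>_. 0"]) simp

setup_lifting type_definition_ell2

lemma sq_summableI:
  assumes "\<And>F. finite F \<Longrightarrow> L2_set (\<lambda>i. norm (f i)) F \<le> B"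
  shows "(\<lambda>i. (norm (f i))\<^sup>2) summable_on UNIV"
    and "sqrt (\<Sum>\<^sub>\<infinity>i. (norm (f i))\<^sup>2) \<le> B"
proof -
  have B: "B \<ge> 0"
    using assms[of "{}"] by simp
  have le: "(\<Sum>i\<in>F. (norm (f i))\<^sup>2) \<le> B\<^sup>2" if "finite F" for F
    using assms[OF that] by (simp add: L2_set_def sqrt_le_D)
  show s: "(\<lambda>i. (norm (f i))\<^sup>2) summable_on UNIV"
    by (rule nonneg_bdd_above_summable_on) (auto intro!: bdd_aboveI2 le)
  show "sqrt (\<Sum>\<^sub>\<infinity>i. (norm (f i))\<^sup>2) \<le> B"
    by (rule real_le_lsqrt) (auto intro!: infsum_le_finite_sums s le B infsum_nonneg)
qed

lemma L2_set_le_infsum: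
  assumes "(\<lambda>i. (norm (f i))\<^sup>2) summable_on UNIV" "finite F"
  shows "L2_set (\<lambda>i. norm (f i)) F \<le> sqrt (\<Sum>\<^sub>\<infinity>i. (norm (f i))\<^sup>2)"
  unfolding L2_set_def using assms by (auto intro!: finite_sum_le_infsum)

lemma L2_set_norm_add:
  "L2_set (\<lambda>i. norm (f i + g i :: 'a::real_normed_vector)) F
    \<le> L2_set (\<lambda>i. norm (f i)) F + L2_set (\<lambda>i. norm (g i)) F"
  by (rule order_trans[OF L2_set_mono L2_set_triangle_ineq]) (auto intro: norm_triangle_ineq)

lemma sq_summable_add:
  fixes f g :: "'i \<Rightarrow> 'a::real_normed_vector"
  assumes "(\<lambda>i. (norm (f i))\<^sup>2) summable_on UNIV" "(\<lambda>i. (norm (g i))\<^sup>2) summable_on UNIV"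
  shows "(\<lambda>i. (norm (f i + g i))\<^sup>2) summable_on UNIV"
    and "sqrt (\<Sum>\<^sub>\<infinity>i. (norm (f i + g i))\<^sup>2)
      \<le> sqrt (\<Sum>\<^sub>\<infinity>i. (norm (f i))\<^sup>2) + sqrt (\<Sum>\<^sub>\<infinity>i. (norm (g i))\<^sup>2)"
  by (rule sq_summableI, rule order_trans[OF L2_set_norm_add],
      auto intro!: add_mono L2_set_le_infsum assms)+

instantiation ell2 :: (type, real_normed_vector) real_normed_vector
begin

lift_definition zero_ell2 :: "('a, 'b) ell2" is "\<lambda>_. 0" by simp

lift_definition plus_ell2 :: "('a, 'b) ell2 \<Rightarrow> ('a, 'b) ell2 \<Rightarrow> ('a, 'b) ell2"
  is "\<lambda>f g i. f i + g i" by (rule sq_summable_add)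

lift_definition uminus_ell2 :: "('a, 'b) ell2 \<Rightarrow> ('a, 'b) ell2" is "\<lambda>f i. - f i" by simp

lift_definition minus_ell2 :: "('a, 'b) ell2 \<Rightarrow> ('a, 'b) ell2 \<Rightarrow> ('a, 'b) ell2"
  is "\<lambda>f g i. f i - g i"
  subgoal for f g
    using sq_summable_add(1)[of f "\<lambda>i. - g i"] by simp
  done

lift_definition scaleR_ell2 :: "real \<Rightarrow> ('a, 'b) ell2 \<Rightarrow> ('a, 'b) ell2"
  is "\<lambda>r f i. r *\<^sub>R f i"
  by (auto simp: power_mult_distrib intro: summable_on_cmult_right)

lift_definition norm_ell2 :: "('a, 'b) ell2 \<Rightarrow> real"
  is "\<lambda>f. sqrt (\<Sum>\<^sub>\<infinity>i. (norm (f i))\<^sup>2)" .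

definition "sgn (x :: ('a, 'b) ell2) = inverse (norm x) *\<^sub>R x"
definition "dist (x :: ('a, 'b) ell2) y = norm (x - y)"
definition [code del]: "(uniformity :: (('a, 'b) ell2 \<times> ('a, 'b) ell2) filter) =
  (INF e\<in>{0<..}. principal {(x, y). dist x y < e})"
definition [code del]: "open (U :: ('a, 'b) ell2 set) \<longleftrightarrow>
  (\<forall>x\<in>U. eventually (\<lambda>(x', y). x' = x \<longrightarrow> y \<in> U) uniformity)"

instance
proof
  fix x y z :: "('a, 'b) ell2" and r s :: real
  show "x + y + z = x + (y + z)" by transfer (simp add: add.assoc)
  show "x + y = y + x" by transfer (simp add: add.commute)
  show "0 + x = x" by transfer simp
  show "- x + x = 0" by transfer simp
  show "x - y = x + - y" by transfer simp
  show "r *\<^sub>R (x + y) = r *\<^sub>R x + r *\<^sub>R y" by transfer (simp add: scaleR_add_right)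
  show "(r + s) *\<^sub>R x = r *\<^sub>R x + s *\<^sub>R x" by transfer (simp add: scaleR_add_left)
  show "r *\<^sub>R s *\<^sub>R x = (r * s) *\<^sub>R x" by transfer simp
  show "1 *\<^sub>R x = x" by transfer simp
  show "sgn x = inverse (norm x) *\<^sub>R x" by (rule sgn_ell2_def)
  show "dist x y = norm (x - y)" by (rule dist_ell2_def)
  show "(uniformity :: (('a, 'b) ell2 \<times> ('a, 'b) ell2) filter) =
    (INF e\<in>{0<..}. principal {(x, y). dist x y < e})" by (rule uniformity_ell2_def)
  show "open U \<longleftrightarrow> (\<forall>x\<in>U. eventually (\<lambda>(x', y). x' = x \<longrightarrow> y \<in> U) uniformity)"
    for U :: "('a, 'b) ell2 set" by (rule open_ell2_def)
  show "norm (x + y) \<le> norm x + norm y" by transfer (rule sq_summable_add)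
  show "norm (r *\<^sub>R x) = \<bar>r\<bar> * norm x"
    by transfer (simp add: power_mult_distrib infsum_cmult_right' real_sqrt_mult)
  show "(norm x = 0) = (x = 0)"
  proof transfer
    fix f :: "'a \<Rightarrow> 'b"
    assume s: "(\<lambda>i. (norm (f i))\<^sup>2) summable_on UNIV"
    have "f i = 0" if "sqrt (\<Sum>\<^sub>\<infinity>i. (norm (f i))\<^sup>2) = 0" for i
      using L2_set_le_infsum[OF s, of "{i}"] that by simp
    then show "(sqrt (\<Sum>\<^sub>\<infinity>i. (norm (f i))\<^sup>2) = 0) = (f = (\<lambda>_. 0))"
      by auto
  qed
qed

end

lemma norm_ell2_nth_le: "norm (ell2_nth x i) \<le> norm x"
  using L2_set_le_infsum[of "ell2_nth x" "{i}"] ell2_nth[of x] by (simp add: norm_ell2.rep_eq)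

instance ell2 :: (type, banach) banach
proof
  fix X :: "nat \<Rightarrow> ('a, 'b) ell2"
  assume X: "Cauchy X"
  have "Cauchy (\<lambda>n. ell2_nth (X n) i)" for i
  proof (rule CauchyI)
    fix e :: real assume "0 < e"
    then obtain M where M: "\<forall>m\<ge>M. \<forall>n\<ge>M. norm (X m - X n) < e"
      using CauchyD[OF X] by blast
    have "norm (ell2_nth (X m) i - ell2_nth (X n) i) < e" if "m \<ge> M" "n \<ge> M" for m n
      using M that norm_ell2_nth_le[of "X m - X n" i]
      by (metis le_less_trans minus_ell2.rep_eq)
    then show "\<exists>M. \<forall>m\<ge>M. \<forall>n\<ge>M. norm (ell2_nth (X m) i - ell2_nth (X n) i) < e"
      by blast
  qed
  then have "\<exists>l. (\<lambda>n. ell2_nth (X n) i) \<longlonglongrightarrow> l" for i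
    using Cauchy_convergent convergent_def by blast
  then obtain l where l: "\<And>i. (\<lambda>n. ell2_nth (X n) i) \<longlonglongrightarrow> l i"
    by metis
  have tail: "\<exists>M. \<forall>n\<ge>M. \<forall>F. finite F \<longrightarrow> L2_set (\<lambda>i. norm (l i - ell2_nth (X n) i)) F \<le> e"
    if "0 < e" for e
  proof -
    obtain M where M: "\<forall>m\<ge>M. \<forall>n\<ge>M. norm (X m - X n) < e"
      using CauchyD[OF X \<open>0 < e\<close>] by blast
    have "L2_set (\<lambda>i. norm (l i - ell2_nth (X n) i)) F \<le> e" if "n \<ge> M" "finite F" for n F
    proof (rule tendsto_upperbound)
      show "(\<lambda>m. L2_set (\<lambda>i. norm (ell2_nth (X m) i - ell2_nth (X n) i)) F)
          \<longlonglongrightarrow> L2_set (\<lambda>i. norm (l i - ell2_nth (X n) i)) F"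
        unfolding L2_set_def by (intro tendsto_intros l)
      show "\<forall>\<^sub>F m in sequentially.
          L2_set (\<lambda>i. norm (ell2_nth (X m) i - ell2_nth (X n) i)) F \<le> e"
      proof (rule eventually_sequentiallyI[of M])
        fix m assume "M \<le> m"
        then have "norm (X m - X n) < e"
          using M \<open>n \<ge> M\<close> by blast
        moreover have "L2_set (\<lambda>i. norm (ell2_nth (X m - X n) i)) F \<le> norm (X m - X n)"
          using L2_set_le_infsum[of "ell2_nth (X m - X n)" F] ell2_nth[of "X m - X n"] \<open>finite F\<close>
          by (simp add: norm_ell2.rep_eq)
        ultimately show "L2_set (\<lambda>i. norm (ell2_nth (X m) i - ell2_nth (X n) i)) F \<le> e"
          by (simp add: minus_ell2.rep_eq)
      qed
    qed simp
    then show ?thesis by blast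
  qed
  have "(\<lambda>i. (norm (l i))\<^sup>2) summable_on UNIV"
  proof -
    obtain M where M: "\<And>F. finite F \<Longrightarrow> L2_set (\<lambda>i. norm (l i - ell2_nth (X M) i)) F \<le> 1"
      using tail[of 1] by auto
    have "(\<lambda>i. (norm (l i - ell2_nth (X M) i))\<^sup>2) summable_on UNIV"
      by (rule sq_summableI) (rule M)
    from sq_summable_add(1)[OF this, of "ell2_nth (X M)"] show ?thesis
      using ell2_nth[of "X M"] by simp
  qed
  then have nth: "ell2_nth (Abs_ell2 l) = l"
    by (simp add: Abs_ell2_inverse)
  have "X \<longlonglongrightarrow> Abs_ell2 l"
  proof (rule LIMSEQ_I)
    fix e :: real assume "0 < e"
    then obtain M where
      M: "\<forall>n\<ge>M. \<forall>F. finite F \<longrightarrow> L2_set (\<lambda>i. norm (l i - ell2_nth (X n) i)) F \<le> e / 2"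
      using tail[of "e / 2"] by auto
    have "norm (X n - Abs_ell2 l) < e" if "n \<ge> M" for n
    proof -
      have "norm (Abs_ell2 l - X n) \<le> e / 2"
        unfolding norm_ell2.rep_eq minus_ell2.rep_eq nth
        by (rule sq_summableI) (use M that in blast)
      then show ?thesis
        using \<open>0 < e\<close> by (simp add: norm_minus_commute)
    qed
    then show "\<exists>M. \<forall>n\<ge>M. norm (X n - Abs_ell2 l) < e"
      by blast
  qed
  then show "convergent X"
    by (rule convergentI)
qed

lemma cinner_summable:
  fixes f g :: "'i \<Rightarrow> 'a::complex_hilbert"
  assumes "(\<lambda>i. (norm (f i))\<^sup>2) summable_on UNIV" "(\<lambda>i. (norm (g i))\<^sup>2) summable_on UNIV"
  shows "(\<lambda>i. cinner (f i) (g i)) summable_on UNIV"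
proof -
  have s: "(\<lambda>i. (norm (f i))\<^sup>2 + (norm (g i))\<^sup>2) summable_on UNIV"
    by (intro summable_on_add assms)
  have le: "cmod (cinner (f i) (g i)) \<le> (norm (f i))\<^sup>2 + (norm (g i))\<^sup>2" for i
  proof -
    have "2 * norm (f i) * norm (g i) \<le> (norm (f i))\<^sup>2 + (norm (g i))\<^sup>2"
      by (rule sum_squares_bound)
    moreover have "0 \<le> norm (f i) * norm (g i)"
      by simp
    ultimately show ?thesis
      using cmod_cinner_le[of "f i" "g i"] by linarith
  qed
  have "(\<lambda>i. cmod (cinner (f i) (g i))) summable_on UNIV"
    using s le by (rule Infinite_Sum.abs_summable_on_comparison_test')
  then show ?thesis
    by (rule abs_summable_summable)
qed

instantiation ell2 :: (type, complex_hilbert) complex_hilbert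
begin

lift_definition scaleC_ell2 :: "complex \<Rightarrow> ('a, 'b) ell2 \<Rightarrow> ('a, 'b) ell2"
  is "\<lambda>c f i. c *\<^sub>C f i"
  by (auto simp: norm_scaleC power_mult_distrib intro: summable_on_cmult_right)

lift_definition cinner_ell2 :: "('a, 'b) ell2 \<Rightarrow> ('a, 'b) ell2 \<Rightarrow> complex"
  is "\<lambda>f g. \<Sum>\<^sub>\<infinity>i. cinner (f i) (g i)" .

instance
proof
  fix x y z :: "('a, 'b) ell2" and c d :: complex and r :: real
  show "c *\<^sub>C (x + y) = c *\<^sub>C x + c *\<^sub>C y" by transfer (simp add: scaleC_add_right)
  show "(c + d) *\<^sub>C x = c *\<^sub>C x + d *\<^sub>C x" by transfer (simp add: scaleC_add_left)
  show "c *\<^sub>C d *\<^sub>C x = (c * d) *\<^sub>C x" by transfer (simp add: scaleC_scaleC)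
  show "complex_of_real r *\<^sub>C x = r *\<^sub>R x" by transfer (simp add: scaleC_of_real)
  show "cinner x y = cnj (cinner y x)"
    by transfer (simp add: infsum_cnj[symmetric] cinner_commute[symmetric] del: infsum_cnj)
  show "cinner (x + y) z = cinner x z + cinner y z"
    by transfer (simp add: cinner_add_left infsum_add cinner_summable)
  show "cinner (c *\<^sub>C x) y = cnj c * cinner x y"
    by transfer (simp add: cinner_scaleC_left infsum_cmult_right')
  show "cinner x x = complex_of_real ((norm x)\<^sup>2)"
  proof transfer
    fix f :: "'a \<Rightarrow> 'b"
    assume "(\<lambda>i. (norm (f i))\<^sup>2) summable_on UNIV"
    then have "(\<Sum>\<^sub>\<infinity>i. complex_of_real ((norm (f i))\<^sup>2))
        = complex_of_real (\<Sum>\<^sub>\<infinity>i. (norm (f i))\<^sup>2)"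
      by (intro infsumI has_sum_of_real has_sum_infsum)
    then show "(\<Sum>\<^sub>\<infinity>i. cinner (f i) (f i))
        = complex_of_real ((sqrt (\<Sum>\<^sub>\<infinity>i. (norm (f i))\<^sup>2))\<^sup>2)"
      unfolding norm_sq_cinner by (simp add: infsum_nonneg del: of_real_power)
  qed
qed

end

section \<open>Operators\<close>

text \<open>
  Bounded operators are elements of the library type \<open>\<Rightarrow>\<^sub>L\<close> of bounded real-linear maps, whose
  norm is the operator norm, restricted where necessary by complex linearity.
\<close>

definition clin :: "('a::complex_hilbert \<Rightarrow>\<^sub>L 'b::complex_hilbert) \<Rightarrow> bool" where
  "clin A \<longleftrightarrow> (\<forall>c x. blinfun_apply A (c *\<^sub>C x) = c *\<^sub>C blinfun_apply A x)"

definition isometric :: "('a::complex_hilbert \<Rightarrow>\<^sub>L 'b::complex_hilbert) \<Rightarrow> bool" where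
  "isometric A \<longleftrightarrow> (\<forall>x. norm (blinfun_apply A x) = norm x)"

text \<open>The Hilbert space adjoint; it exists and is unique for complex-linear \<open>A\<close> (Riesz).\<close>

definition adj :: "('a::complex_hilbert \<Rightarrow>\<^sub>L 'b::complex_hilbert) \<Rightarrow> ('b \<Rightarrow>\<^sub>L 'a)" where
  "adj A = (THE B. \<forall>x y. cinner (blinfun_apply A x) y = cinner x (blinfun_apply B y))"

lift_definition scalar_op :: "complex \<Rightarrow> 'a::complex_hilbert \<Rightarrow>\<^sub>L 'a" is "scaleC"
proof -
  fix c :: complex
  show "bounded_linear (scaleC c :: 'a \<Rightarrow> 'a)"
  proof (rule bounded_linear_intro[where K = "cmod c"])
    fix x y :: 'a and r :: real
    show "c *\<^sub>C (x + y) = c *\<^sub>C x + c *\<^sub>C y"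
      by (rule scaleC_add_right)
    show "c *\<^sub>C (r *\<^sub>R x) = r *\<^sub>R (c *\<^sub>C x)"
      by (simp add: scaleC_of_real[symmetric] scaleC_scaleC mult.commute)
    show "norm (c *\<^sub>C x) \<le> norm x * cmod c"
      by (simp add: norm_scaleC mult.commute)
  qed
qed

text \<open>
  A word \<open>\<alpha>\<close> in the free semigroup is a list over the finite type \<open>'n\<close> of generators, the
  empty list being the identity \<open>g\<^sub>0\<close>.
\<close>

fun word :: "('n \<Rightarrow> 'a::real_normed_vector \<Rightarrow>\<^sub>L 'a) \<Rightarrow> 'n list \<Rightarrow> 'a \<Rightarrow>\<^sub>L 'a" where
  "word T [] = id_blinfun"
| "word T (i # \<alpha>) = T i o\<^sub>L word T \<alpha>"

section \<open>The classes \<open>C\<^sub>\<rho>\<close> and the joint operator radius\<close>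

text \<open>
  The inclusion of \<open>\<H>\<close> in the dilation space \<open>\<G>\<close> is given by a complex-linear isometry \<open>J\<close>,
  so that the compression of \<open>V\<^sub>\<alpha>\<close> to \<open>\<H>\<close> is \<open>J\<^sup>* V\<^sub>\<alpha> J\<close>.

  HOL cannot quantify over types inside a formula, so the type \<open>'g\<close> of the dilation space is a
  parameter. A hypothesis about \<open>'g\<close> in a theorem that is polymorphic in \<open>'g\<close> means that some
  dilation space exists; a conclusion about one specific type exhibits the dilation space.
  For \<open>m\<close> operators on \<open>\<H>\<close> the type \<open>('m list, 'h) ell2\<close>, which is \<open>F\<^sup>2(H\<^sub>m) \<otimes> \<H>\<close>, loses no
  dilations: the closed span of the \<open>V\<^sub>\<alpha> J \<H>\<close> has dimension at most \<open>max \<aleph>\<^sub>0 (dim \<H>)\<close>.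
\<close>

definition class_C ::
  "'g::complex_hilbert itself \<Rightarrow> real \<Rightarrow> ('n \<Rightarrow> 'h::complex_hilbert \<Rightarrow>\<^sub>L 'h) \<Rightarrow> bool" where
  "class_C (_ :: 'g itself) \<rho> T \<longleftrightarrow>
    (\<exists>(J :: 'h \<Rightarrow>\<^sub>L 'g) (V :: 'n \<Rightarrow> 'g \<Rightarrow>\<^sub>L 'g).
      clin J \<and> isometric J \<and>
      (\<forall>i. clin (V i) \<and> isometric (V i)) \<and>
      (\<forall>i j x y. i \<noteq> j \<longrightarrow> cinner (blinfun_apply (V i) x) (blinfun_apply (V j) y) = 0) \<and>
      (\<forall>\<alpha>. \<alpha> \<noteq> [] \<longrightarrow> word T \<alpha> = \<rho> *\<^sub>R (adj J o\<^sub>L word V \<alpha> o\<^sub>L J)))"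

text \<open>Extended real values make the infimum over an empty set \<open>\<infinity>\<close>, not an arbitrary real.\<close>

definition joint_radius ::
  "'g::complex_hilbert itself \<Rightarrow> real \<Rightarrow> ('n \<Rightarrow> 'h::complex_hilbert \<Rightarrow>\<^sub>L 'h) \<Rightarrow> ereal" where
  "joint_radius G \<rho> T = Inf {ereal t |t. t > 0 \<and> class_C G \<rho> (\<lambda>i. (1 / t) *\<^sub>R T i)}"

section \<open>Free holomorphic functions\<close>

text \<open>A scalar free holomorphic function is represented by its coefficient family \<open>a\<close>.\<close>

definition free_holomorphic :: "('n::finite list \<Rightarrow> complex) \<Rightarrow> bool" where
  "free_holomorphic a \<longleftrightarrow>
    limsup (\<lambda>k. ereal (root (2 * k) (\<Sum>\<alpha> | length \<alpha> = k. (cmod (a \<alpha>))\<^sup>2))) \<le> 1"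

text \<open>The series is a limit in operator norm of partial sums over homogeneous parts.\<close>

definition free_eval ::
  "('n::finite list \<Rightarrow> complex) \<Rightarrow> ('n \<Rightarrow> 'a::complex_hilbert \<Rightarrow>\<^sub>L 'a) \<Rightarrow> 'a \<Rightarrow>\<^sub>L 'a" where
  "free_eval a X = (\<Sum>k. \<Sum>\<alpha> | length \<alpha> = k. scalar_op (a \<alpha>) o\<^sub>L word X \<alpha>)"

definition free_eval_lim ::
  "('n::finite list \<Rightarrow> complex) \<Rightarrow> ('n \<Rightarrow> 'a::complex_hilbert \<Rightarrow>\<^sub>L 'a) \<Rightarrow> 'a \<Rightarrow>\<^sub>L 'a" where
  "free_eval_lim a T = Lim (at_left 1) (\<lambda>r. free_eval a (\<lambda>i. r *\<^sub>R T i))"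

definition op_ball :: "('n::finite \<Rightarrow> 'k::complex_hilbert \<Rightarrow>\<^sub>L 'k) set" where
  "op_ball = {X. (\<forall>i. clin (X i)) \<and> norm (\<Sum>i\<in>UNIV. X i o\<^sub>L adj (X i)) < 1}"

text \<open>The library norm on \<open>'k ^ 'm\<close> is the Hilbert norm of the direct sum of copies of \<open>'k\<close>.\<close>

definition row_norm :: "('m::finite \<Rightarrow> 'k::complex_hilbert \<Rightarrow>\<^sub>L 'k) \<Rightarrow> real" where
  "row_norm A = onorm (\<lambda>v :: 'k ^ 'm. \<Sum>j\<in>UNIV. blinfun_apply (A j) (v $ j))"

definition contractive ::
  "'k::complex_hilbert itself \<Rightarrow> ('m::finite \<Rightarrow> 'n::finite list \<Rightarrow> complex) \<Rightarrow> bool" where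
  "contractive (_ :: 'k itself) f \<longleftrightarrow>
    (\<forall>X :: 'n \<Rightarrow> 'k \<Rightarrow>\<^sub>L 'k. X \<in> op_ball \<longrightarrow> row_norm (\<lambda>j. free_eval (f j) X) \<le> 1)"

text \<open>\<open>f\<^sub>j(0)\<close> is the scalar operator given by the coefficient of \<open>g\<^sub>0\<close>.\<close>

definition value_at_0 :: "('m::finite \<Rightarrow> 'n list \<Rightarrow> complex) \<Rightarrow> complex ^ 'm" where
  "value_at_0 f = (\<chi> j. f j [])"

section \<open>The noncommutative disc algebra\<close>

text \<open>
  The full Fock space on \<open>\<complex>\<^sup>n\<close>, with respect to the orthonormal basis of the elementary
  tensors \<open>e\<^sub>\<alpha>\<close>, where \<open>\<alpha>\<close> ranges over all words.
\<close>

type_synonym 'n fock = "('n list, complex) ell2"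

definition prepend :: "'n \<Rightarrow> ('n list \<Rightarrow> complex) \<Rightarrow> 'n list \<Rightarrow> complex" where
  "prepend i \<phi> \<alpha> = (case \<alpha> of [] \<Rightarrow> 0 | j # \<beta> \<Rightarrow> if j = i then \<phi> \<beta> else 0)"

lemma prepend_has_sum:
  "((\<lambda>\<alpha>. (cmod (prepend i \<phi> \<alpha>))\<^sup>2) has_sum s) UNIV \<longleftrightarrow>
    ((\<lambda>\<alpha>. (cmod (\<phi> \<alpha>))\<^sup>2) has_sum s) UNIV"
proof -
  have "((\<lambda>\<alpha>. (cmod (prepend i \<phi> \<alpha>))\<^sup>2) has_sum s) UNIV \<longleftrightarrow>
      ((\<lambda>\<alpha>. (cmod (prepend i \<phi> \<alpha>))\<^sup>2) has_sum s) (range ((#) i))"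
    by (rule has_sum_cong_neutral) (auto simp: prepend_def split: list.splits)
  also have "\<dots> \<longleftrightarrow> ((\<lambda>\<alpha>. (cmod (prepend i \<phi> \<alpha>))\<^sup>2) \<circ> (#) i has_sum s) UNIV"
    by (rule has_sum_reindex) simp
  finally show ?thesis
    by (simp add: o_def prepend_def)
qed

lift_definition creation_fun :: "'n \<Rightarrow> 'n fock \<Rightarrow> 'n fock" is prepend
  using prepend_has_sum by (metis summable_on_def)

lemma norm_creation_fun: "norm (creation_fun i \<phi>) = norm \<phi>"
  by transfer (metis infsumI has_sum_infsum prepend_has_sum)

lift_definition creation :: "'n \<Rightarrow> 'n fock \<Rightarrow>\<^sub>L 'n fock" is creation_fun
proof (rule bounded_linear_intro[where K = 1])
  fix i :: 'n and x y :: "'n fock" and r :: real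
  show "creation_fun i (x + y) = creation_fun i x + creation_fun i y"
    by transfer (auto simp: prepend_def fun_eq_iff split: list.splits)
  show "creation_fun i (r *\<^sub>R x) = r *\<^sub>R creation_fun i x"
    by transfer (auto simp: prepend_def fun_eq_iff split: list.splits)
  show "norm (creation_fun i x) \<le> norm x * 1"
    by (simp add: norm_creation_fun)
qed

definition disc_algebra :: "('n fock \<Rightarrow>\<^sub>L 'n fock) set" where
  "disc_algebra = \<Inter>{A. closed A \<and> id_blinfun \<in> A \<and> (\<forall>i. creation i \<in> A) \<and>
    (\<forall>X\<in>A. \<forall>Y\<in>A. X + Y \<in> A \<and> X o\<^sub>L Y \<in> A) \<and>
    (\<forall>c. \<forall>X\<in>A. scalar_op c o\<^sub>L X \<in> A)}"

definition boundary_in_disc_algebra :: "('n::finite list \<Rightarrow> complex) \<Rightarrow> bool" where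
  "boundary_in_disc_algebra a \<longleftrightarrow>
    (\<exists>B\<in>disc_algebra. ((\<lambda>r. free_eval a (\<lambda>i. r *\<^sub>R creation i)) \<longlongrightarrow> B) (at_left 1))"

definition rho_f :: "real \<Rightarrow> ('m::finite \<Rightarrow> 'n list \<Rightarrow> complex) \<Rightarrow> real" where
  "rho_f \<rho> f =
    (if \<rho> < 1 then 1 + (\<rho> - 1) * ((1 - norm (value_at_0 f)) / (1 + norm (value_at_0 f)))
     else 1 + (\<rho> - 1) * ((1 + norm (value_at_0 f)) / (1 - norm (value_at_0 f))))"

end

theory Submission
  imports Defs
begin

text \<open>
  Let \<open>T = t T'\<close> with \<open>t < 1\<close> and \<open>T'\<close> of class \<open>C\<^sub>\<rho>\<close>, dilated by isometries \<open>V\<close>. Tensoring \<open>V\<close> with a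
  unilateral shift turns a little of the slack in \<open>t\<close> into a parameter \<open>\<rho>\<^sub>1 < \<rho>\<close>. Put \<open>W = t V\<close>,
  \<open>Y = f(W)\<close> and \<open>A = f(T)\<close>; then \<open>A\<^sub>\<alpha> = \<rho>\<^sub>1 J\<^sup>* Y\<^sub>\<alpha> J + (1 - \<rho>\<^sub>1) f(0)\<^sub>\<alpha>\<close> for all words, and a Schwarz--Pick
  argument shows that the row \<open>Y\<close> is a strict contraction. For \<open>s < 1\<close> close to \<open>1\<close>, the kernel
  of \<open>A/s\<close> is therefore a sum of the Poisson kernel of \<open>Y/s\<close>, a multiple of \<open>C - P\<close> or
  \<open>P - c\<close>, where \<open>P\<close> is the scalar Poisson kernel at the point \<open>f(0)/s\<close> and \<open>c \<le> P \<le> C\<close> are the Harnack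
  bounds, and a nonnegative constant. Each summand is realised by an explicit vector in a Fock
  space; the Harnack constants are those in \<open>\<rho>\<^sub>f\<close>.
\<close>

section \<open>Adjoints and square roots\<close>

text \<open>The slack \<open>t0 < 1\<close> has to pay twice. Dividing \<open>A\<close> by
  \<open>s < 1\<close> moves the scalar point from \<open>f(0)\<close> to \<open>f(0)/s\<close>,
  where the Harnack constants are worse. With \<open>\<rho>1 = \<rho>\<close> the diagonal masses of
  the summands would add up to exactly \<open>\<rho>\<^sub>f\<close> already at
  \<open>s = 1\<close>, so one part of the slack must first lower \<open>\<rho>\<close>; the other
  part keeps \<open>Y/s\<close> a strict row contraction, whose Poisson vectors then carry the full
  norm.

  Two mismatches of spaces shape the rest. Contractivity of \<open>f\<close> is given on the single
  space \<open>'k\<close> but is needed on the dilation space: it is converted into an inequality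
  between coefficients, which no longer mentions \<open>'k\<close>. The dilation space of
  \<open>T\<close> is arbitrary, but that of \<open>f(T)\<close> is prescribed: the kernel is first
  realised by vectors over the old space, and since only their Gram matrix matters, they are then
  replaced by vectors over \<open>'h\<close>.\<close>

lemma cinner_zero_left [simp]: "cinner 0 (x::'a::complex_hilbert) = 0"
  using cinner_add_left[of 0 0 x] by simp

lemma cinner_zero_right [simp]: "cinner (x::'a::complex_hilbert) 0 = 0"
  using cinner_add_right[of x 0 0] by simp

lemma scaleC_zero_right [simp]: "c *\<^sub>C (0::'a::complex_hilbert) = 0"
  using scaleC_add_right[of c 0 0] by simp

lemma scaleC_zero_left [simp]: "0 *\<^sub>C (x::'a::complex_hilbert) = 0"
  using scaleC_add_left[of 0 0 x] by simp

lemma scaleC_one [simp]: "1 *\<^sub>C (x::'a::complex_hilbert) = x"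
  using scaleC_of_real[of 1 x] by simp

lemma scaleC_minus1: "(-1) *\<^sub>C (x::'a::complex_hilbert) = - x"
  using scaleC_of_real[of "-1" x] by simp

lemma scaleC_minus_right [simp]: "c *\<^sub>C (- x) = - (c *\<^sub>C (x::'a::complex_hilbert))"
  using scaleC_add_right[of c x "-x"] by (simp add: eq_neg_iff_add_eq_0 add.commute)

lemma scaleC_diff_right: "c *\<^sub>C (x - y) = c *\<^sub>C x - c *\<^sub>C (y::'a::complex_hilbert)"
  using scaleC_add_right[of c x "-y"] by simp

lemma scaleC_sum_right: "c *\<^sub>C (\<Sum>i\<in>I. f i) = (\<Sum>i\<in>I. c *\<^sub>C (f i :: 'a::complex_hilbert))"
  by (induction I rule: infinite_finite_induct) (simp_all add: scaleC_add_right)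

lemma scaleC_scaleR_commute: "c *\<^sub>C (r *\<^sub>R x) = r *\<^sub>R (c *\<^sub>C (x::'a::complex_hilbert))"
  by (simp add: scaleC_of_real[symmetric] scaleC_scaleC mult.commute)

lemma cinner_minus_left [simp]: "cinner (- x) (y::'a::complex_hilbert) = - cinner x y"
  using cinner_add_left[of x "-x" y] by (simp add: eq_neg_iff_add_eq_0 add.commute)

lemma cinner_minus_right [simp]: "cinner (x::'a::complex_hilbert) (- y) = - cinner x y"
  using cinner_add_right[of x y "-y"] by (simp add: eq_neg_iff_add_eq_0 add.commute)

lemma cinner_diff_left: "cinner (x - y) (z::'a::complex_hilbert) = cinner x z - cinner y z"
  using cinner_add_left[of x "-y" z] by simp

lemma cinner_diff_right: "cinner x (y - z::'a::complex_hilbert) = cinner x y - cinner x z"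
  using cinner_add_right[of x y "-z"] by simp

lemma cinner_scaleR_left [simp]: "cinner (r *\<^sub>R x) (y::'a::complex_hilbert) = of_real r * cinner x y"
  by (simp add: scaleC_of_real[symmetric] cinner_scaleC_left)

lemma cinner_scaleR_right [simp]: "cinner (x::'a::complex_hilbert) (r *\<^sub>R y) = of_real r * cinner x y"
  by (simp add: scaleC_of_real[symmetric] cinner_scaleC_right)

lemma cinner_sum_left: "cinner (\<Sum>i\<in>I. f i) (y::'a::complex_hilbert) = (\<Sum>i\<in>I. cinner (f i) y)"
  by (induction I rule: infinite_finite_induct) (simp_all add: cinner_add_left)

lemma cinner_sum_right: "cinner (x::'a::complex_hilbert) (\<Sum>i\<in>I. f i) = (\<Sum>i\<in>I. cinner x (f i))"
  by (induction I rule: infinite_finite_induct) (simp_all add: cinner_add_right)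

lemma Re_cinner_self [simp]: "Re (cinner x (x::'a::complex_hilbert)) = (norm x)\<^sup>2"
  by (simp add: norm_sq_cinner del: of_real_power)

lemma Re_cinner_commute: "Re (cinner y (x::'a::complex_hilbert)) = Re (cinner x y)"
  by (subst cinner_commute) simp

lemma norm_add_sq:
  "(norm (x + y::'a::complex_hilbert))\<^sup>2 = (norm x)\<^sup>2 + 2 * Re (cinner x y) + (norm y)\<^sup>2"
proof -
  have "Re (cinner (x + y) (x + y)) = (norm x)\<^sup>2 + 2 * Re (cinner x y) + (norm y)\<^sup>2"
    unfolding cinner_add_left cinner_add_right plus_complex.simps Re_cinner_self
      Re_cinner_commute[of y x] by simp
  then show ?thesis by simp
qed

lemma norm_diff_sq:
  "(norm (x - y::'a::complex_hilbert))\<^sup>2 = (norm x)\<^sup>2 - 2 * Re (cinner x y) + (norm y)\<^sup>2"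
  using norm_add_sq[of x "-y"] by simp

lemma cinner_ext:
  assumes "\<And>x. cinner x y = cinner x (z::'a::complex_hilbert)"
  shows "y = z"
proof -
  have "cinner (y - z) (y - z) = 0"
    using assms[of "y - z"] by (simp add: cinner_diff_right)
  then show ?thesis by (simp add: norm_sq_cinner)
qed

lemma Re_cinner_le: "Re (cinner x (y::'a::complex_hilbert)) \<le> norm x * norm y"
  using cmod_cinner_le complex_Re_le_cmod order_trans by blast

lemma bounded_bilinear_cinner: "bounded_bilinear (cinner :: 'a::complex_hilbert \<Rightarrow> 'a \<Rightarrow> complex)"
proof
  show "\<exists>K. \<forall>a b::'a. norm (cinner a b) \<le> norm a * norm b * K"
    by (rule exI[of _ 1]) (simp add: cmod_cinner_le)
qed (simp_all add: cinner_add_left cinner_add_right scaleR_conv_of_real)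

lemmas tendsto_cinner = bounded_bilinear.tendsto[OF bounded_bilinear_cinner]

text \<open>The representing vector is the minimiser of the functional \<open>q\<close>: the
  parallelogram law makes a minimising sequence Cauchy, and stationarity of \<open>q\<close> in
  every direction is the representation of the real part.\<close>

lemma riesz_representation:
  fixes \<phi> :: "'a::complex_hilbert \<Rightarrow> complex"
  assumes lin: "bounded_linear \<phi>" and C: "\<And>c x. \<phi> (c *\<^sub>C x) = c * \<phi> x"
  shows "\<exists>y. \<forall>x. \<phi> x = cinner y x"
proof -
  interpret bounded_linear \<phi> by (rule lin)
  obtain M where M: "\<And>x. norm (\<phi> x) \<le> norm x * M"
    using bounded by blast
  define q where "q x = (norm x)\<^sup>2 - 2 * Re (\<phi> x)" for x
  have lower: "q x \<ge> - M\<^sup>2" for x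
  proof -
    have "Re (\<phi> x) \<le> norm x * M"
      using M[of x] complex_Re_le_cmod[of "\<phi> x"] by simp
    moreover have "(norm x - M)\<^sup>2 \<ge> 0" by simp
    ultimately show ?thesis
      unfolding q_def by (simp add: power2_diff)
  qed
  define m where "m = Inf (range q)"
  have bdd: "bdd_below (range q)"
    using lower by (auto intro!: bdd_belowI)
  have m_le: "m \<le> q x" for x
    unfolding m_def by (rule cInf_lower[OF _ bdd]) simp
  have "\<exists>x. q x < m + 1 / Suc n" for n
  proof -
    have "m < m + 1 / Suc n" by simp
    then show ?thesis
      unfolding m_def by (subst (asm) cInf_less_iff) (use bdd in auto)
  qed
  then obtain X where X: "\<And>n. q (X n) < m + 1 / Suc n" by metis
  have par: "(norm (x - y))\<^sup>2 \<le> 2 * (q x - m) + 2 * (q y - m)" for x y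
  proof -
    have "(norm (x + y))\<^sup>2 + (norm (x - y))\<^sup>2 = 2 * (norm x)\<^sup>2 + 2 * (norm y)\<^sup>2"
      by (simp add: norm_add_sq norm_diff_sq)
    moreover have "4 * m \<le> (norm (x + y))\<^sup>2 - 4 * (Re (\<phi> x) + Re (\<phi> y))"
    proof -
      have "(norm ((1/2) *\<^sub>R (x + y)))\<^sup>2 = (norm (x + y))\<^sup>2 / 4"
        by (simp add: power_divide del: scaleR_add_right)
      then show ?thesis
        using m_le[of "(1/2) *\<^sub>R (x + y)"] by (simp add: q_def scaleR add field_simps del: scaleR_add_right)
    qed
    ultimately show ?thesis
      unfolding q_def by (simp add: algebra_simps)
  qed
  have "Cauchy X"
  proof (rule CauchyI)
    fix e :: real assume e: "0 < e"
    obtain N where N: "1 / real (Suc N) < e\<^sup>2 / 4"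
      using reals_Archimedean[of "e\<^sup>2 / 4"] e by (auto simp: inverse_eq_divide)
    have "norm (X i - X j) < e" if "i \<ge> N" "j \<ge> N" for i j
    proof -
      have "1 / real (Suc i) \<le> 1 / real (Suc N)" "1 / real (Suc j) \<le> 1 / real (Suc N)"
        using that by (auto intro!: divide_left_mono)
      then have "(norm (X i - X j))\<^sup>2 < e\<^sup>2"
        using par[of "X i" "X j"] X[of i] X[of j] N by argo
      then show ?thesis
        using e by (simp add: power2_less_imp_less)
    qed
    then show "\<exists>M. \<forall>m\<ge>M. \<forall>n\<ge>M. norm (X m - X n) < e" by blast
  qed
  then obtain y where y: "X \<longlonglongrightarrow> y"
    using Cauchy_convergent convergent_def by blast
  have "(\<lambda>n. q (X n)) \<longlonglongrightarrow> q y"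
    unfolding q_def by (intro tendsto_intros y tendsto)
  moreover have "(\<lambda>n. m + 1 / Suc n) \<longlonglongrightarrow> m + 0"
    by (intro tendsto_intros LIMSEQ_Suc[OF lim_1_over_n])
  ultimately have "q y \<le> m + 0"
    by (rule LIMSEQ_le) (use X in \<open>auto intro: less_imp_le\<close>)
  then have min: "q y \<le> q x" for x
    using m_le[of x] by simp
  have Re_eq: "Re (\<phi> z) = Re (cinner y z)" for z
  proof (rule ccontr)
    define d where "d = Re (cinner y z) - Re (\<phi> z)"
    assume "Re (\<phi> z) \<noteq> Re (cinner y z)"
    then have d: "d \<noteq> 0" by (simp add: d_def)
    \<comment> \<open>The increment of \<open>q\<close> along \<open>z\<close> is
      \<open>2 * s * d + s\<^sup>2 * (norm z)\<^sup>2\<close>. Its minimiser is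
      \<open>- d / (norm z)\<^sup>2\<close>; the added 1 avoids the case \<open>z = 0\<close> and
      still leaves the increment negative.\<close>
    define s where "s = - d / ((norm z)\<^sup>2 + 1)"
    have pos: "(norm z)\<^sup>2 + 1 > 0" by (simp add: add_nonneg_pos)
    have "0 \<le> q (y + s *\<^sub>R z) - q y" using min by simp
    also have "\<dots> = 2 * s * d + s\<^sup>2 * (norm z)\<^sup>2"
      by (simp add: q_def norm_add_sq add scaleR d_def power_mult_distrib algebra_simps)
    also have "\<dots> \<le> 2 * s * d + s\<^sup>2 * ((norm z)\<^sup>2 + 1)"
      by (simp add: mult_left_mono)
    also have "\<dots> = s * (2 * d + s * ((norm z)\<^sup>2 + 1))"
      by (simp add: algebra_simps power2_eq_square)
    also have "\<dots> = - d\<^sup>2 / ((norm z)\<^sup>2 + 1)"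
      using pos by (simp add: s_def power2_eq_square)
    also have "\<dots> < 0"
      using pos d by (simp add: divide_neg_pos)
    finally show False by simp
  qed
  have "\<phi> x = cinner y x" for x
  proof (rule complex_eqI)
    show "Re (\<phi> x) = Re (cinner y x)" by (rule Re_eq)
    \<comment> \<open>A complex-linear functional is determined by its real part: the imaginary part
      is read off at \<open>\<i> *\<^sub>C x\<close>.\<close>
    show "Im (\<phi> x) = Im (cinner y x)"
      using Re_eq[of "\<i> *\<^sub>C x"] by (simp add: C cinner_scaleC_right)
  qed
  then show ?thesis by blast
qed

lemma adj_exists:
  fixes A :: "'a::complex_hilbert \<Rightarrow>\<^sub>L 'b::complex_hilbert"
  assumes "clin A"
  shows "\<exists>B. \<forall>x y. cinner (blinfun_apply A x) y = cinner x (blinfun_apply B y)"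
proof -
  have "\<exists>z. \<forall>x. cinner y (blinfun_apply A x) = cinner z x" for y
  proof (rule riesz_representation)
    show "bounded_linear (\<lambda>x. cinner y (blinfun_apply A x))"
      by (intro bounded_linear_compose[OF bounded_bilinear.bounded_linear_right[OF bounded_bilinear_cinner]]
          blinfun.bounded_linear_right)
    show "cinner y (blinfun_apply A (c *\<^sub>C x)) = c * cinner y (blinfun_apply A x)" for c x
      using assms by (simp add: clin_def cinner_scaleC_right)
  qed
  then obtain B where B: "\<And>x y. cinner y (blinfun_apply A x) = cinner (B y) x" by metis
  have B': "cinner (blinfun_apply A x) y = cinner x (B y)" for x y
    using arg_cong[OF B[of y x], of cnj] by (simp only: cinner_commute[symmetric])
  have "bounded_linear B"
  proof (rule bounded_linear_intro[where K = "norm A"])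
    show "B (x + y) = B x + B y" for x y
      by (rule cinner_ext) (simp add: B'[symmetric] cinner_add_right)
    show "B (r *\<^sub>R x) = r *\<^sub>R B x" for r x
      by (rule cinner_ext) (simp add: B'[symmetric])
    show "norm (B y) \<le> norm y * norm A" for y
    proof (cases "B y = 0")
      case False
      have "(norm (B y))\<^sup>2 = Re (cinner (blinfun_apply A (B y)) y)"
        by (simp add: B')
      also have "\<dots> \<le> norm (blinfun_apply A (B y)) * norm y" by (rule Re_cinner_le)
      also have "\<dots> \<le> (norm A * norm (B y)) * norm y"
        by (intro mult_right_mono norm_blinfun) simp
      finally show ?thesis using False
        by (simp add: power2_eq_square mult.commute mult.left_commute)
    qed simp
  qed
  then show ?thesis
    using B' by (intro exI[of _ "Blinfun B"]) (simp add: bounded_linear_Blinfun_apply)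
qed

lemma cinner_unique_adj:
  assumes "\<And>x y. cinner (blinfun_apply A x) y = cinner x (blinfun_apply B y)"
  shows "adj A = B"
  unfolding adj_def
proof (rule the_equality)
  show "\<forall>x y. cinner (blinfun_apply A x) y = cinner x (blinfun_apply B y)"
    using assms by blast
  show "B' = B" if "\<forall>x y. cinner (blinfun_apply A x) y = cinner x (blinfun_apply B' y)" for B'
    by (rule blinfun_eqI, rule cinner_ext) (rule trans[OF that[rule_format, symmetric] assms])
qed

lemma cinner_adj_right:
  assumes "clin A"
  shows "cinner x (blinfun_apply (adj A) y) = cinner (blinfun_apply A x) y"
proof -
  obtain B where B: "\<And>x y. cinner (blinfun_apply A x) y = cinner x (blinfun_apply B y)"
    using adj_exists[OF assms] by blast
  then show ?thesis
    using cinner_unique_adj[of A B] by simp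
qed

lemma cinner_adj_left:
  assumes "clin A"
  shows "cinner (blinfun_apply (adj A) y) x = cinner y (blinfun_apply A x)"
proof -
  have "cinner (blinfun_apply (adj A) y) x = cnj (cinner x (blinfun_apply (adj A) y))"
    by (rule cinner_commute)
  also have "\<dots> = cnj (cinner (blinfun_apply A x) y)"
    by (simp only: cinner_adj_right[OF assms])
  also have "\<dots> = cinner y (blinfun_apply A x)"
    by (rule cinner_commute[symmetric])
  finally show ?thesis .
qed

lemma clin_scaleC: "clin A \<Longrightarrow> blinfun_apply A (c *\<^sub>C x) = c *\<^sub>C blinfun_apply A x"
  by (simp add: clin_def)

lemma clin_adj:
  assumes "clin A"
  shows "clin (adj A)"
  unfolding clin_def
  by (intro allI, rule cinner_ext) (simp only: cinner_adj_right[OF assms] cinner_scaleC_right)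

lemma norm_adj_le:
  assumes "clin A"
  shows "norm (blinfun_apply (adj A) y) \<le> norm A * norm y"
proof (cases "blinfun_apply (adj A) y = 0")
  case False
  let ?z = "blinfun_apply (adj A) y"
  have "(norm ?z)\<^sup>2 = Re (cinner (blinfun_apply A ?z) y)"
    by (simp add: cinner_adj_right[OF assms, symmetric])
  also have "\<dots> \<le> norm (blinfun_apply A ?z) * norm y" by (rule Re_cinner_le)
  also have "\<dots> \<le> (norm A * norm ?z) * norm y"
    by (intro mult_right_mono norm_blinfun) simp
  finally show ?thesis using False
    by (simp add: power2_eq_square mult.commute mult.left_commute)
qed simp

lemma clin_compose [intro]: "clin A \<Longrightarrow> clin B \<Longrightarrow> clin (A o\<^sub>L B)"
  by (simp add: clin_def)

lemma clin_id [intro]: "clin id_blinfun"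
  by (simp add: clin_def)

lemma clin_add [intro]: "clin A \<Longrightarrow> clin B \<Longrightarrow> clin (A + B)"
  by (simp add: clin_def blinfun.add_left scaleC_add_right)

lemma clin_diff [intro]: "clin A \<Longrightarrow> clin B \<Longrightarrow> clin (A - B)"
  by (simp add: clin_def blinfun.diff_left scaleC_diff_right)

lemma clin_scaleR [intro]: "clin A \<Longrightarrow> clin (r *\<^sub>R A)"
  by (simp add: clin_def blinfun.scaleR_left scaleC_scaleR_commute)

lemma clin_zero [intro]: "clin 0"
  by (simp add: clin_def)

lemma clin_sum [intro]: "(\<And>i. i \<in> I \<Longrightarrow> clin (A i)) \<Longrightarrow> clin (\<Sum>i\<in>I. A i)"
  by (induction I rule: infinite_finite_induct) auto

lemma blinfun_apply_scalar_op [simp]: "blinfun_apply (scalar_op c) x = c *\<^sub>C x"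
  by (simp add: scalar_op.rep_eq)

lemma clin_scalar_op [intro]: "clin (scalar_op c)"
  by (simp add: clin_def scaleC_scaleC mult.commute)

lemma clin_word [intro]: "(\<And>i. clin (X i)) \<Longrightarrow> clin (word X \<alpha>)"
  by (induction \<alpha>) auto

lemma tendsto_scaleC_right:
  assumes "(f \<longlongrightarrow> l) F" shows "((\<lambda>x. c *\<^sub>C f x) \<longlongrightarrow> c *\<^sub>C (l::'a::complex_hilbert)) F"
  using blinfun.tendsto[OF tendsto_const assms, of "scalar_op c"] by simp

lemma clin_tendsto:
  assumes "(A \<longlongrightarrow> B) F" "F \<noteq> bot" "\<And>n. clin (A n)"
  shows "clin B"
  unfolding clin_def
proof (intro allI)
  fix c x
  have 1: "((\<lambda>n. blinfun_apply (A n) (c *\<^sub>C x)) \<longlongrightarrow> blinfun_apply B (c *\<^sub>C x)) F"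
    by (intro tendsto_intros assms)
  have 2: "((\<lambda>n. blinfun_apply (A n) (c *\<^sub>C x)) \<longlongrightarrow> c *\<^sub>C blinfun_apply B x) F"
    unfolding clin_scaleC[OF assms(3)] by (intro tendsto_scaleC_right tendsto_intros assms)
  show "blinfun_apply B (c *\<^sub>C x) = c *\<^sub>C blinfun_apply B x"
    using tendsto_unique[OF assms(2) 1 2] .
qed

lemma adj_diff_apply:
  assumes "clin A" "clin B"
  shows "blinfun_apply (adj A) x - blinfun_apply (adj B) x = blinfun_apply (adj (A - B)) x"
  by (rule cinner_ext)
    (simp add: cinner_diff_right cinner_adj_right assms clin_diff blinfun.diff_left cinner_diff_left)

lemma tendsto_adj:
  assumes "(A \<longlongrightarrow> B) F" "F \<noteq> bot" "\<And>n. clin (A n)"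
  shows "((\<lambda>n. blinfun_apply (adj (A n)) x) \<longlongrightarrow> blinfun_apply (adj B) x) F"
proof (rule Lim_null[THEN iffD2], rule tendsto_0_le)
  have B: "clin B" by (rule clin_tendsto[OF assms])
  show "((\<lambda>n. norm (A n - B)) \<longlongrightarrow> 0) F"
    using assms(1) by (simp add: LIM_zero tendsto_norm_zero)
  show "\<forall>\<^sub>F n in F. norm (blinfun_apply (adj (A n)) x - blinfun_apply (adj B) x) \<le> norm (norm (A n - B)) * norm x"
    using norm_adj_le[OF clin_diff[OF assms(3) B]] by (simp add: adj_diff_apply assms(3) B)
qed

lemma adj_word_append:
  assumes "\<And>i. clin (X i)"
  shows "blinfun_apply (adj (word X (\<gamma> @ \<beta>))) h
    = blinfun_apply (adj (word X \<beta>)) (blinfun_apply (adj (word X \<gamma>)) h)"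
proof (rule cinner_ext)
  have "word X (\<gamma> @ \<beta>) = word X \<gamma> o\<^sub>L word X \<beta>"
    by (induction \<gamma>) (auto intro: blinfun_eqI)
  then show "cinner x (blinfun_apply (adj (word X (\<gamma> @ \<beta>))) h) = cinner x
      (blinfun_apply (adj (word X \<beta>)) (blinfun_apply (adj (word X \<gamma>)) h))" for x
    by (simp add: cinner_adj_right clin_word clin_compose assms)
qed

text \<open>A solution of \<open>S = (B + S\<^sup>2) / 2\<close> satisfies
  \<open>(I - S)\<^sup>2 = I - B\<close>. The fixed point iteration from 0 is dominated, in its
  values and in its increments, by the same iteration for the scalar 1; that one is increasing and
  bounded by 1, so its increments are summable.\<close>

lemma blinfun_sqrt:
  fixes B :: "'a::complex_hilbert \<Rightarrow>\<^sub>L 'a"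
  assumes B: "clin B" "norm B \<le> 1"
    and selfadj: "\<And>x y. cinner (blinfun_apply B x) y = cinner x (blinfun_apply B y)"
  shows "\<exists>R. clin R \<and> (\<forall>x y. cinner (blinfun_apply R x) y = cinner x (blinfun_apply R y))
    \<and> R o\<^sub>L R = id_blinfun - B"
proof -
  define Y where "Y = rec_nat (0 :: 'a \<Rightarrow>\<^sub>L 'a) (\<lambda>_ Y. (1/2) *\<^sub>R (B + (Y o\<^sub>L Y)))"
  define y where "y = rec_nat (0::real) (\<lambda>_ y. (1/2) * (1 + y * y))"
  have Y: "Y 0 = 0" "\<And>n. Y (Suc n) = (1/2) *\<^sub>R (B + (Y n o\<^sub>L Y n))"
    and y: "y 0 = 0" "\<And>n. y (Suc n) = (1/2) * (1 + y n * y n)"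
    by (simp_all add: Y_def y_def)
  have y01: "0 \<le> y n \<and> y n \<le> 1" for n
  proof (induction n)
    case (Suc n)
    then have "y n * y n \<le> 1 * 1" by (intro mult_mono) auto
    then show ?case by (simp add: y)
  qed (simp add: y)
  have nY: "norm (Y n) \<le> y n" for n
  proof (induction n)
    case (Suc n)
    have "norm (Y n o\<^sub>L Y n) \<le> y n * y n"
      by (rule order_trans[OF norm_blinfun_compose]) (use Suc y01 in \<open>auto intro: mult_mono\<close>)
    then show ?case
      using norm_triangle_ineq[of B "Y n o\<^sub>L Y n"] B(2) by (simp add: Y y)
  qed (simp add: Y y)
  have d: "norm (Y (Suc n) - Y n) \<le> y (Suc n) - y n" for n
  proof (induction n)
    case 0
    then show ?case using B(2) by (simp add: Y y)
  next
    case (Suc n)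
    define D where "D = Y (Suc n) - Y n"
    \<comment> \<open>The difference of squares is split as
      \<open>P\<^sup>2 - Q\<^sup>2 = P (P - Q) + (P - Q) Q\<close>, which requires no
      commutation.\<close>
    have "Y (Suc (Suc n)) - Y (Suc n)
        = (1/2) *\<^sub>R ((Y (Suc n) o\<^sub>L D) + (D o\<^sub>L Y n))"
      unfolding Y(2)[of "Suc n"] Y(2)[of n, folded] D_def
      by (rule blinfun_eqI)
        (simp add: Y(2)[of n, symmetric] blinfun.add_left blinfun.diff_left blinfun.diff_right
          blinfun.scaleR_left algebra_simps)
    then have "norm (Y (Suc (Suc n)) - Y (Suc n)) \<le> (1/2) * (norm (Y (Suc n) o\<^sub>L D) + norm (D o\<^sub>L Y n))"
      using norm_triangle_ineq[of "Y (Suc n) o\<^sub>L D" "D o\<^sub>L Y n"] by simp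
    also have "\<dots> \<le> (1/2) * (y (Suc n) * (y (Suc n) - y n) + (y (Suc n) - y n) * y n)"
      using Suc y01 nY order_trans[OF norm_ge_zero Suc] unfolding D_def
      by (intro mult_left_mono add_mono order_trans[OF norm_blinfun_compose] mult_mono) auto
    also have "\<dots> = y (Suc (Suc n)) - y (Suc n)"
      unfolding y(2)[of "Suc n"] by (subst (5) y(2)) (simp add: algebra_simps)
    finally show ?case .
  qed
  have "incseq y"
    by (rule incseq_SucI) (use d in \<open>metis norm_ge_zero order_trans diff_ge_0_iff_ge\<close>)
  then obtain L where "y \<longlonglongrightarrow> L"
    using incseq_convergent[of y 1] y01 by blast
  then have "summable (\<lambda>n. y (Suc n) - y n)"
    by (rule telescope_summable)
  then have "summable (\<lambda>n. Y (Suc n) - Y n)"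
    using d by (rule summable_comparison_test'[where N = 0])
  then obtain S where "(\<lambda>n. Y (Suc n) - Y n) sums S"
    by (auto simp: summable_def)
  then have lim: "Y \<longlonglongrightarrow> S"
    unfolding sums_def sum_lessThan_telescope by (simp add: Y(1))
  have clinY: "clin (Y n)" for n
    by (induction n) (simp_all add: Y B clin_scaleR clin_add clin_compose clin_zero)
  have saY: "cinner (blinfun_apply (Y n) u) v = cinner u (blinfun_apply (Y n) v)" for n u v
    by (induction n arbitrary: u v)
      (simp_all add: Y blinfun.scaleR_left blinfun.add_left cinner_add_left cinner_add_right selfadj)
  have S: "clin S"
    by (rule clin_tendsto[OF lim _ clinY]) simp
  have saS: "cinner (blinfun_apply S u) v = cinner u (blinfun_apply S v)" for u v
  proof (rule LIMSEQ_unique)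
    show "(\<lambda>n. cinner (blinfun_apply (Y n) u) v) \<longlonglongrightarrow> cinner (blinfun_apply S u) v"
      by (intro tendsto_cinner tendsto_intros lim)
    show "(\<lambda>n. cinner (blinfun_apply (Y n) u) v) \<longlonglongrightarrow> cinner u (blinfun_apply S v)"
      unfolding saY by (intro tendsto_cinner tendsto_intros lim)
  qed
  have eq: "S = (1/2) *\<^sub>R (B + (S o\<^sub>L S))"
  proof (rule LIMSEQ_unique[OF LIMSEQ_Suc[OF lim]])
    show "(\<lambda>n. Y (Suc n)) \<longlonglongrightarrow> (1/2) *\<^sub>R (B + (S o\<^sub>L S))"
      unfolding Y by (intro tendsto_intros bounded_bilinear.tendsto[OF bounded_bilinear_blinfun_compose] lim)
  qed
  have "(id_blinfun - S) o\<^sub>L (id_blinfun - S) = id_blinfun - B"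
  proof (rule blinfun_eqI)
    fix x
    have "2 *\<^sub>R blinfun_apply S x = blinfun_apply B x + blinfun_apply S (blinfun_apply S x)"
      by (subst eq) (simp add: blinfun.scaleR_left blinfun.add_left)
    then show "blinfun_apply ((id_blinfun - S) o\<^sub>L (id_blinfun - S)) x = blinfun_apply (id_blinfun - B) x"
      by (simp add: blinfun.diff_left blinfun.diff_right scaleR_2 algebra_simps)
  qed
  then show ?thesis
    using S saS
    by (intro exI[of _ "id_blinfun - S"])
      (auto simp: blinfun.diff_left cinner_diff_left cinner_diff_right)
qed

section \<open>Poisson kernels\<close>

lemma finite_words_eq [simp]: "finite {\<alpha> :: 'n::finite list. length \<alpha> = k}"
  using finite_lists_length_eq[of "UNIV :: 'n set" k] by simp

lemma finite_words_less [simp]: "finite {\<alpha> :: 'n::finite list. length \<alpha> < k}"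
  by (rule finite_subset[OF _ finite_lists_length_le[of "UNIV :: 'n set" k]]) auto

lemma sum_words_less:
  "(\<Sum>\<alpha> | length (\<alpha> :: 'n::finite list) < N. g \<alpha>) = (\<Sum>k<N. \<Sum>\<alpha> | length \<alpha> = k. g \<alpha>)"
proof -
  have "{\<alpha> :: 'n list. length \<alpha> < N} = (\<Union>k\<in>{..<N}. {\<alpha>. length \<alpha> = k})" by auto
  then show ?thesis
    by (simp add: sum.UNION_disjoint disjoint_iff)
qed

lemma sum_words_snoc:
  "(\<Sum>\<alpha> | length (\<alpha> :: 'n::finite list) = Suc k. g \<alpha>)
    = (\<Sum>\<alpha> | length \<alpha> = k. \<Sum>i\<in>UNIV. g (\<alpha> @ [i]))"
proof -
  have "bij_betw (\<lambda>(\<alpha>, i). \<alpha> @ [i]) ({\<alpha>. length \<alpha> = k} \<times> UNIV) {\<alpha> :: 'n list. length \<alpha> = Suc k}"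
    by (rule bij_betwI[where g = "\<lambda>\<alpha>. (butlast \<alpha>, last \<alpha>)"])
      (auto simp: length_Suc_conv_rev)
  then show ?thesis
    by (simp add: sum.cartesian_product sum.reindex_bij_betw[symmetric] case_prod_unfold)
qed

lemma filterlim_words_less:
  "filterlim (\<lambda>N. {\<alpha> :: 'n::finite list. length \<alpha> < N}) (finite_subsets_at_top UNIV) sequentially"
  unfolding filterlim_finite_subsets_at_top
proof (intro allI impI)
  fix F :: "'n list set" assume "finite F \<and> F \<subseteq> UNIV"
  then have "bdd_above (length ` F)" by simp
  then obtain M where "\<And>\<alpha>. \<alpha> \<in> F \<Longrightarrow> length \<alpha> \<le> M"
    by (auto simp: bdd_above_def)
  then show "\<forall>\<^sub>F N in sequentially. finite {\<alpha> :: 'n list. length \<alpha> < N} \<and>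
      F \<subseteq> {\<alpha>. length \<alpha> < N} \<and> {\<alpha> :: 'n list. length \<alpha> < N} \<subseteq> UNIV"
    by (intro eventually_sequentiallyI[of "Suc M"]) fastforce
qed

lemma has_sum_words_lim:
  assumes "(g has_sum S) (UNIV :: 'n::finite list set)"
  shows "(\<lambda>N. \<Sum>\<alpha> | length \<alpha> < N. g \<alpha>) \<longlonglongrightarrow> S"
  using assms filterlim_compose[OF _ filterlim_words_less] unfolding has_sum_def by blast

text \<open>For nonnegative terms the exhaustion by word length already decides unconditional
  summability, so telescoping in the length can be used to compute sums over all words.\<close>

lemma has_sum_wordsI:
  fixes g :: "'n::finite list \<Rightarrow> real"
  assumes nonneg: "\<And>\<alpha>. 0 \<le> g \<alpha>"
    and lim: "(\<lambda>N. \<Sum>\<alpha> | length \<alpha> < N. g \<alpha>) \<longlonglongrightarrow> S"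
  shows "(g has_sum S) UNIV"
proof -
  have inc: "incseq (\<lambda>N. \<Sum>\<alpha> | length \<alpha> < N. g \<alpha>)"
    by (intro monoI sum_mono2 nonneg) auto
  have "sum g F \<le> S" if F: "finite F" for F
  proof -
    have "bdd_above (length ` F)" using F by simp
    then obtain M where "\<And>\<alpha>. \<alpha> \<in> F \<Longrightarrow> length \<alpha> \<le> M"
      by (auto simp: bdd_above_def)
    then have "sum g F \<le> (\<Sum>\<alpha> | length \<alpha> < Suc M. g \<alpha>)"
      by (intro sum_mono2 nonneg) (auto simp: le_imp_less_Suc)
    also have "\<dots> \<le> S" by (rule incseq_le[OF inc lim])
    finally show ?thesis .
  qed
  then have "g summable_on UNIV"
    by (intro nonneg_bdd_above_summable_on) (auto intro!: bdd_aboveI2 nonneg)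
  then have s: "(g has_sum infsum g UNIV) UNIV" by (rule has_sum_infsum)
  then show ?thesis
    using LIMSEQ_unique[OF has_sum_words_lim[OF s] lim] by simp
qed

text \<open>\<open>D\<close> is the defect operator of the row, the square root of the identity
  minus the sum of all \<open>X i o\<^sub>L adj (X i)\<close>, and the last conclusion says that the
  Poisson transform is isometric. The words of length \<open>k\<close> contribute
  \<open>R k - R (Suc k)\<close>, so the total telescopes, and strictness of the row makes
  \<open>R k\<close> decay like \<open>c ^ k\<close>.\<close>

lemma poisson_defect:
  fixes X :: "'i::finite \<Rightarrow> 'a::complex_hilbert \<Rightarrow>\<^sub>L 'a"
  assumes X: "\<And>i. clin (X i)" and c: "0 \<le> c" "c < 1"
    and row: "\<And>h. (\<Sum>i\<in>UNIV. (norm (blinfun_apply (adj (X i)) h))\<^sup>2) \<le> c * (norm h)\<^sup>2"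
  obtains D :: "'a \<Rightarrow>\<^sub>L 'a" where "clin D"
    and "\<And>h. (norm (blinfun_apply D h))\<^sup>2 = (norm h)\<^sup>2 - (\<Sum>i\<in>UNIV. (norm (blinfun_apply (adj (X i)) h))\<^sup>2)"
    and "\<And>h. ((\<lambda>\<alpha>. (norm (blinfun_apply D (blinfun_apply (adj (word X \<alpha>)) h)))\<^sup>2) has_sum (norm h)\<^sup>2) UNIV"
proof -
  define P where "P = (\<Sum>i\<in>UNIV. X i o\<^sub>L adj (X i))"
  have P_apply: "blinfun_apply P x = (\<Sum>i\<in>UNIV. blinfun_apply (X i) (blinfun_apply (adj (X i)) x))" for x
    by (simp add: P_def blinfun.sum_left)
  have P_left: "cinner (blinfun_apply P x) y = (\<Sum>i\<in>UNIV. cinner (blinfun_apply (adj (X i)) x) (blinfun_apply (adj (X i)) y))" for x y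
    by (simp add: P_apply cinner_sum_left cinner_adj_right[OF X])
  have P_right: "cinner x (blinfun_apply P y) = (\<Sum>i\<in>UNIV. cinner (blinfun_apply (adj (X i)) x) (blinfun_apply (adj (X i)) y))" for x y
    by (simp add: P_apply cinner_sum_right cinner_adj_left[OF X])
  have clinP: "clin P"
    unfolding P_def by (intro clin_sum clin_compose X clin_adj)
  have "norm (blinfun_apply P x) \<le> 1 * norm x" for x
  proof -
    let ?y = "blinfun_apply P x"
    have "(norm ?y)\<^sup>2 = (\<Sum>i\<in>UNIV. Re (cinner (blinfun_apply (adj (X i)) x) (blinfun_apply (adj (X i)) ?y)))"
      by (simp only: Re_cinner_self[symmetric] P_left Re_sum)
    also have "\<dots> \<le> (\<Sum>i\<in>UNIV. ((norm (blinfun_apply (adj (X i)) x))\<^sup>2 + (norm (blinfun_apply (adj (X i)) ?y))\<^sup>2) / 2)"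
    proof (rule sum_mono)
      fix i
      let ?a = "blinfun_apply (adj (X i)) x" and ?b = "blinfun_apply (adj (X i)) ?y"
      have "0 \<le> (norm (?a - ?b))\<^sup>2" by simp
      then show "Re (cinner ?a ?b) \<le> ((norm ?a)\<^sup>2 + (norm ?b)\<^sup>2) / 2"
        unfolding norm_diff_sq by simp
    qed
    also have "\<dots> \<le> (c * (norm x)\<^sup>2 + c * (norm ?y)\<^sup>2) / 2"
      using row[of x] row[of ?y] by (simp add: sum_divide_distrib[symmetric] sum.distrib)
    also have "\<dots> \<le> ((norm x)\<^sup>2 + (norm ?y)\<^sup>2) / 2"
      using c mult_right_mono[of c 1 "(norm x)\<^sup>2"] mult_right_mono[of c 1 "(norm ?y)\<^sup>2"] by simp
    finally have "(norm ?y)\<^sup>2 \<le> (norm x)\<^sup>2" by simp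
    then show ?thesis by (simp add: power2_le_iff_abs_le)
  qed
  then have "norm P \<le> 1" by (intro norm_blinfun_bound) auto
  then obtain D where D: "clin D" "\<And>x y. cinner (blinfun_apply D x) y = cinner x (blinfun_apply D y)"
    "D o\<^sub>L D = id_blinfun - P"
    using blinfun_sqrt[OF clinP] P_left P_right by metis
  have DD: "blinfun_apply D (blinfun_apply D x) = x - blinfun_apply P x" for x
    using arg_cong[OF D(3), of "\<lambda>A. blinfun_apply A x"] by (simp add: blinfun.diff_left)
  have nD: "(norm (blinfun_apply D h))\<^sup>2 = (norm h)\<^sup>2 - (\<Sum>i\<in>UNIV. (norm (blinfun_apply (adj (X i)) h))\<^sup>2)" for h
  proof -
    have "(norm (blinfun_apply D h))\<^sup>2 = Re (cinner h (h - blinfun_apply P h))"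
      by (simp only: Re_cinner_self[symmetric] D(2) DD)
    then show ?thesis by (simp add: cinner_diff_right P_right)
  qed
  have "((\<lambda>\<alpha>. (norm (blinfun_apply D (blinfun_apply (adj (word X \<alpha>)) h)))\<^sup>2) has_sum (norm h)\<^sup>2) UNIV" for h
  proof (rule has_sum_wordsI)
    define u where "u \<alpha> = blinfun_apply (adj (word X \<alpha>)) h" for \<alpha>
    define R where "R k = (\<Sum>\<alpha> | length \<alpha> = k. (norm (u \<alpha>))\<^sup>2)" for k
    have "word X [i] = X i" for i by (auto intro: blinfun_eqI)
    then have u_snoc: "u (\<alpha> @ [i]) = blinfun_apply (adj (X i)) (u \<alpha>)" for \<alpha> i
      by (simp add: u_def adj_word_append[OF X] del: word.simps)
    have R_Suc: "R (Suc k) = (\<Sum>\<alpha> | length \<alpha> = k. \<Sum>i\<in>UNIV. (norm (blinfun_apply (adj (X i)) (u \<alpha>)))\<^sup>2)" for k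
      by (simp add: R_def sum_words_snoc u_snoc)
    have R_c: "R (Suc k) \<le> c * R k" for k
      unfolding R_Suc unfolding R_def sum_distrib_left by (intro sum_mono row)
    have R_nonneg: "0 \<le> R k" for k
      by (simp add: R_def sum_nonneg)
    have "R k \<le> c ^ k * R 0" for k
    proof (induction k)
      case (Suc k)
      then show ?case
        using order_trans[OF R_c mult_left_mono[OF Suc c(1)]] by (simp add: mult.assoc)
    qed simp
    then have "R \<longlonglongrightarrow> 0"
      by (intro real_tendsto_sandwich[of "\<lambda>_. 0" R _ "\<lambda>k. c ^ k * R 0"])
        (use c R_nonneg in \<open>auto intro!: tendsto_mult_left_zero LIMSEQ_realpow_zero\<close>)
    then have "(\<lambda>N. R 0 - R N) \<longlonglongrightarrow> R 0 - 0" by (intro tendsto_intros)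
    moreover have "(\<Sum>\<alpha> | length \<alpha> < N. (norm (blinfun_apply D (u \<alpha>)))\<^sup>2) = R 0 - R N" for N
    proof -
      have "(\<Sum>\<alpha> | length \<alpha> < N. (norm (blinfun_apply D (u \<alpha>)))\<^sup>2) = (\<Sum>k<N. R k - R (Suc k))"
        unfolding sum_words_less R_Suc unfolding R_def nD by (simp add: sum_subtractf)
      then show ?thesis by (simp add: sum_lessThan_telescope')
    qed
    moreover have "R 0 = (norm h)\<^sup>2"
    proof -
      have "adj (id_blinfun :: 'a \<Rightarrow>\<^sub>L 'a) = id_blinfun"
        by (rule cinner_unique_adj) simp
      then show ?thesis by (simp add: R_def u_def)
    qed
    ultimately show "(\<lambda>N. \<Sum>\<alpha> | length \<alpha> < N. (norm (blinfun_apply D (blinfun_apply (adj (word X \<alpha>)) h)))\<^sup>2) \<longlonglongrightarrow> (norm h)\<^sup>2"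
      by (simp add: u_def)
  qed simp
  with D(1) nD show ?thesis by (rule that)
qed

section \<open>Polarization and finite orthonormal systems\<close>

lemma cinner_polarization:
  "cinner x (y::'a::complex_hilbert) = (of_real ((norm (x + y))\<^sup>2) - of_real ((norm (x - y))\<^sup>2)
    - \<i> * of_real ((norm (x + \<i> *\<^sub>C y))\<^sup>2) + \<i> * of_real ((norm (x - \<i> *\<^sub>C y))\<^sup>2)) * (1 / 4)"
  by (simp add: norm_sq_cinner[symmetric] cinner_add_left cinner_add_right cinner_diff_left
      cinner_diff_right cinner_scaleC_left cinner_scaleC_right algebra_simps del: of_real_power)

lemma has_sum_diff:
  fixes f g :: "'i \<Rightarrow> 'a::real_normed_vector"
  assumes "(f has_sum a) A" "(g has_sum b) A"
  shows "((\<lambda>i. f i - g i) has_sum a - b) A"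
  using has_sum_add[OF assms(1), of "\<lambda>i. - g i" "- b"] assms(2) by (simp add: has_sum_uminus)

text \<open>Polarization is applied term by term, so an isometry identity for a family yields the
  sesquilinear one with no separate summability argument.\<close>

lemma has_sum_cinner_polarize:
  fixes C :: "'i \<Rightarrow> 'a::complex_hilbert \<Rightarrow> 'e::complex_hilbert"
  assumes add: "\<And>i x y. C i (x + y) = C i x + C i y"
    and scale: "\<And>i c x. C i (c *\<^sub>C x) = c *\<^sub>C C i x"
    and sum: "\<And>x. ((\<lambda>i. (norm (C i x))\<^sup>2) has_sum (norm x)\<^sup>2) UNIV"
  shows "((\<lambda>i. cinner (C i x) (C i y)) has_sum cinner x y) UNIV"
proof -
  have diff: "C i (x - y) = C i x - C i y" for i x y
    using add[of i x "- y"] scale[of i "-1" y] by (simp add: scaleC_minus1)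
  have q: "((\<lambda>i. complex_of_real ((norm (C i z))\<^sup>2)) has_sum of_real ((norm z)\<^sup>2)) UNIV" for z
    by (rule has_sum_of_real[OF sum])
  let ?q = "\<lambda>z. complex_of_real ((norm z)\<^sup>2)"
  have 1: "((\<lambda>i. (?q (C i (x + y)) - ?q (C i (x - y)) - \<i> * ?q (C i (x + \<i> *\<^sub>C y))
      + \<i> * ?q (C i (x - \<i> *\<^sub>C y))) * (1 / 4)) has_sum (?q (x + y) - ?q (x - y)
      - \<i> * ?q (x + \<i> *\<^sub>C y) + \<i> * ?q (x - \<i> *\<^sub>C y)) * (1 / 4)) UNIV"
    by (rule has_sum_cmult_left has_sum_add has_sum_diff has_sum_cmult_right q)+
  have 2: "(?q (C i (x + y)) - ?q (C i (x - y)) - \<i> * ?q (C i (x + \<i> *\<^sub>C y))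
      + \<i> * ?q (C i (x - \<i> *\<^sub>C y))) * (1 / 4) = cinner (C i x) (C i y)" for i
    unfolding add diff scale by (rule cinner_polarization[symmetric])
  have 3: "(?q (x + y) - ?q (x - y) - \<i> * ?q (x + \<i> *\<^sub>C y)
      + \<i> * ?q (x - \<i> *\<^sub>C y)) * (1 / 4) = cinner x y"
    by (rule cinner_polarization[symmetric])
  show ?thesis
    using 1 unfolding 2 3 .
qed

text \<open>Some of the vectors may be 0, namely those where \<open>Q\<close> fails. Such families
  arise when creation operators are cut off at a word length and the vectors of longer words
  vanish.\<close>

lemma partial_orthonormal:
  fixes e :: "'i \<Rightarrow> 'a::complex_hilbert"
  assumes fin: "finite I"
    and on: "\<And>i j. i \<in> I \<Longrightarrow> j \<in> I \<Longrightarrow> cinner (e i) (e j) = (if i = j \<and> Q i then 1 else 0)"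
  defines "p \<equiv> \<lambda>z. \<Sum>i\<in>I. cinner (e i) z *\<^sub>C e i"
  shows "(norm (p z))\<^sup>2 = (\<Sum>i\<in>I. (cmod (cinner (e i) z))\<^sup>2)" and "norm (p z) \<le> norm z"
proof -
  have proj: "cinner (e i) (p z) = cinner (e i) z" if i: "i \<in> I" for i
  proof (cases "Q i")
    case True
    have "cinner (e i) (p z) = (\<Sum>j\<in>I. if j = i then cinner (e j) z else 0)"
      unfolding p_def cinner_sum_right
      by (rule sum.cong) (use True i in \<open>auto simp: cinner_scaleC_right on\<close>)
    then show ?thesis using fin i by simp
  next
    case False
    then have "cinner (e i) (e i) = 0" using on[OF i i] by simp
    then have "e i = 0" by (simp add: norm_sq_cinner)
    then show ?thesis by simp
  qed
  have left: "cinner (p z) y = (\<Sum>i\<in>I. cnj (cinner (e i) z) * cinner (e i) y)" for y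
    by (simp add: p_def cinner_sum_left cinner_scaleC_left)
  have "cinner (p z) (p z) = complex_of_real (\<Sum>i\<in>I. (cmod (cinner (e i) z))\<^sup>2)"
    by (simp add: left proj complex_norm_square mult.commute del: of_real_power)
  then show 1: "(norm (p z))\<^sup>2 = (\<Sum>i\<in>I. (cmod (cinner (e i) z))\<^sup>2)"
    unfolding norm_sq_cinner using of_real_eq_iff by blast
  have "cinner (p z) z = cinner (p z) (p z)" by (simp add: left proj)
  then have "(norm (p z))\<^sup>2 \<le> norm (p z) * norm z"
    using Re_cinner_le[of "p z" z] by simp
  then show "norm (p z) \<le> norm z"
    by (cases "norm (p z) = 0") (auto simp: power2_eq_square)
qed

definition orthonormal :: "'a::complex_hilbert set \<Rightarrow> bool" where
  "orthonormal B \<longleftrightarrow> (\<forall>x\<in>B. \<forall>y\<in>B. cinner x y = (if x = y then 1 else 0))"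

lemma orthonormal_insert:
  assumes B: "finite B" "orthonormal B" and v: "v \<noteq> (\<Sum>b\<in>B. cinner b v *\<^sub>C b)"
  obtains w where "w \<notin> B" "orthonormal (insert w B)"
    "v = (\<Sum>b\<in>insert w B. cinner b v *\<^sub>C b)" "\<And>b. b \<in> B \<Longrightarrow> cinner w b = 0"
proof -
  define z where "z = v - (\<Sum>b\<in>B. cinner b v *\<^sub>C b)"
  define w where "w = (1 / norm z) *\<^sub>R z"
  have z: "norm z \<noteq> 0" using v by (simp add: z_def)
  have on: "cinner x y = (if x = y then 1 else 0)" if "x \<in> B" "y \<in> B" for x y
    using B(2) that by (simp add: orthonormal_def)
  have bz: "cinner b z = 0" if "b \<in> B" for b
  proof -
    have "(\<Sum>x\<in>B. cinner x v * cinner b x) = (\<Sum>x\<in>B. if x = b then cinner x v else 0)"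
      by (rule sum.cong) (use that on in auto)
    then show ?thesis
      using that B(1) by (simp add: z_def cinner_diff_right cinner_sum_right cinner_scaleC_right)
  qed
  have bw: "cinner b w = 0" and wb: "cinner w b = 0" if "b \<in> B" for b
    using bz[OF that] cinner_commute[of w b] by (simp_all add: w_def)
  have ww: "cinner w w = 1"
    using z by (simp add: w_def norm_sq_cinner power2_eq_square)
  have notin: "w \<notin> B" using bw ww by force
  have "cinner w v = cinner w z"
    by (simp add: z_def cinner_diff_right cinner_sum_right cinner_scaleC_right wb)
  also have "\<dots> = of_real (norm z)"
    using z by (simp add: w_def norm_sq_cinner power2_eq_square)
  finally have "cinner w v *\<^sub>C w = z"
    using z by (simp add: scaleC_of_real w_def)
  then have "v = (\<Sum>b\<in>insert w B. cinner b v *\<^sub>C b)"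
    using notin B(1) by (simp add: z_def)
  moreover have "orthonormal (insert w B)"
    unfolding orthonormal_def using on bw wb ww notin by auto
  ultimately show ?thesis using that notin wb by blast
qed

lemma gram_schmidt:
  assumes "finite (A :: 'a::complex_hilbert set)"
  shows "\<exists>B. finite B \<and> orthonormal B \<and> (\<forall>v\<in>A. v = (\<Sum>b\<in>B. cinner b v *\<^sub>C b))"
  using assms
proof (induction A rule: finite_induct)
  case empty
  show ?case by (rule exI[of _ "{}"]) (simp add: orthonormal_def)
next
  case (insert v A)
  then obtain B where B: "finite B" "orthonormal B" "\<And>u. u \<in> A \<Longrightarrow> u = (\<Sum>b\<in>B. cinner b u *\<^sub>C b)"
    by blast
  show ?case
  proof (cases "v = (\<Sum>b\<in>B. cinner b v *\<^sub>C b)")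
    case True
    then show ?thesis using B by (intro exI[of _ B]) auto
  next
    case False
    then obtain w where w: "w \<notin> B" "orthonormal (insert w B)"
      "v = (\<Sum>b\<in>insert w B. cinner b v *\<^sub>C b)" "\<And>b. b \<in> B \<Longrightarrow> cinner w b = 0"
      using orthonormal_insert[OF B(1,2)] by metis
    have "u = (\<Sum>b\<in>insert w B. cinner b u *\<^sub>C b)" if "u \<in> A" for u
    proof -
      have "cinner w u = 0"
        by (subst B(3)[OF that]) (simp add: cinner_sum_right cinner_scaleC_right w(4))
      then show ?thesis using B(1) B(3)[OF that] w(1) by simp
    qed
    then show ?thesis
      using B(1) w(2,3) by (intro exI[of _ "insert w B"]) auto
  qed
qed

lemma infinite_dim_orthonormal:
  assumes inf: "\<nexists>D :: 'k::complex_hilbert set. finite D \<and> span D = UNIV"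
  shows "\<exists>B :: 'k set. finite B \<and> orthonormal B \<and> card B = d"
proof (induction d)
  case 0
  show ?case by (rule exI[of _ "{}"]) (simp add: orthonormal_def)
next
  case (Suc d)
  then obtain B :: "'k set" where B: "finite B" "orthonormal B" "card B = d" by blast
  have "\<exists>v. v \<noteq> (\<Sum>b\<in>B. cinner b v *\<^sub>C b)"
  proof (rule ccontr)
    assume "\<not> ?thesis"
    then have v: "v = (\<Sum>b\<in>B. cinner b v *\<^sub>C b)" for v by blast
    \<comment> \<open>\<open>span\<close> is the real span, so the multiples by \<open>\<i>\<close>
      have to be listed to reach all complex combinations.\<close>
    let ?D = "B \<union> (\<lambda>b. \<i> *\<^sub>C b) ` B"
    have cb: "c *\<^sub>C b \<in> span ?D" if "b \<in> B" for b c
    proof -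
      have "c *\<^sub>C b = (of_real (Re c) + \<i> * of_real (Im c)) *\<^sub>C b"
        by (rule arg_cong[OF complex_eq])
      also have "\<dots> = Re c *\<^sub>R b + Im c *\<^sub>R (\<i> *\<^sub>C b)"
        by (simp only: scaleC_add_left scaleC_scaleC[symmetric] scaleC_of_real scaleC_scaleR_commute)
      also have "\<dots> \<in> span ?D"
        using that by (intro span_add span_scale span_base) auto
      finally show ?thesis .
    qed
    have "v \<in> span ?D" for v
    proof -
      have "(\<Sum>b\<in>B. cinner b v *\<^sub>C b) \<in> span ?D"
        by (intro span_sum cb)
      then show ?thesis by (simp only: v[symmetric])
    qed
    then have "span ?D = UNIV" by blast
    moreover have "finite ?D" using B(1) by simp
    ultimately show False using inf by blast
  qed
  then obtain v where v: "v \<noteq> (\<Sum>b\<in>B. cinner b v *\<^sub>C b)" by blast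
  obtain w where "w \<notin> B" "orthonormal (insert w B)"
    using orthonormal_insert[OF B(1,2) v] by blast
  then show ?case using B by (intro exI[of _ "insert w B"]) simp
qed

section \<open>Contractivity on coefficients\<close>

lemma scaleC_sum_left: "(\<Sum>i\<in>I. c i) *\<^sub>C x = (\<Sum>i\<in>I. c i *\<^sub>C (x::'a::complex_hilbert))"
  by (induction I rule: infinite_finite_induct) (simp_all add: scaleC_add_left)

lemma bounded_linear_rank_one: "bounded_linear (\<lambda>x. cinner a x *\<^sub>C (b::'a::complex_hilbert))"
proof (rule bounded_linear_intro[where K = "norm a * norm b"])
  fix x y :: 'b and r :: real
  show "cinner a (x + y) *\<^sub>C b = cinner a x *\<^sub>C b + cinner a y *\<^sub>C b"
    by (simp add: cinner_add_right scaleC_add_left)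
  show "cinner a (r *\<^sub>R x) *\<^sub>C b = r *\<^sub>R cinner a x *\<^sub>C b"
    by (simp add: scaleC_of_real[symmetric] scaleC_scaleC cinner_scaleC_right)
  show "norm (cinner a x *\<^sub>C b) \<le> norm x * (norm a * norm b)"
    using mult_right_mono[OF cmod_cinner_le[of a x], of "norm b"]
    by (simp add: norm_scaleC mult_ac)
qed

text \<open>The column of adjoints is no larger than the row: the row is evaluated at the column's
  own value \<open>v\<close>, which gives \<open>(norm v)\<^sup>2 = Re (cinner x S)\<close>.\<close>

lemma row_norm_adj:
  fixes A :: "'m::finite \<Rightarrow> 'k::complex_hilbert \<Rightarrow>\<^sub>L 'k"
  assumes A: "\<And>j. clin (A j)" and row: "row_norm A \<le> 1"
  shows "(\<Sum>j\<in>UNIV. (norm (blinfun_apply (adj (A j)) x))\<^sup>2) \<le> (norm x)\<^sup>2"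
proof -
  define v :: "'k ^ 'm" where "v = (\<chi> j. blinfun_apply (adj (A j)) x)"
  define S where "S = (\<Sum>j\<in>UNIV. blinfun_apply (A j) (v $ j))"
  have nv: "(norm v)\<^sup>2 = (\<Sum>j\<in>UNIV. (norm (blinfun_apply (adj (A j)) x))\<^sup>2)"
    by (simp add: norm_vec_def L2_set_def v_def sum_nonneg)
  have bl: "bounded_linear (\<lambda>v :: 'k ^ 'm. \<Sum>j\<in>UNIV. blinfun_apply (A j) (v $ j))"
    by (intro bounded_linear_sum bounded_linear_compose[OF blinfun.bounded_linear_right]
        bounded_linear_vec_nth)
  have "norm S \<le> row_norm A * norm v"
    unfolding S_def row_norm_def by (rule onorm[OF bl])
  also have "\<dots> \<le> 1 * norm v" by (rule mult_right_mono[OF row]) simp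
  finally have S: "norm S \<le> norm v" by simp
  have "(norm v)\<^sup>2 = Re (cinner x S)"
    unfolding nv S_def
    by (simp only: Re_cinner_self[symmetric] cinner_adj_left[OF A] cinner_sum_right Re_sum v_def vec_lambda_beta)
  also have "\<dots> \<le> norm x * norm S" by (rule Re_cinner_le)
  also have "\<dots> \<le> norm x * norm v" by (rule mult_left_mono[OF S]) simp
  finally have "norm v \<le> norm x"
    by (cases "norm v = 0") (auto simp: power2_eq_square)
  then show ?thesis
    unfolding nv[symmetric] by (rule power_mono) simp
qed

definition homogeneous_part ::
  "('n::finite list \<Rightarrow> complex) \<Rightarrow> nat \<Rightarrow> ('n \<Rightarrow> 'a::complex_hilbert \<Rightarrow>\<^sub>L 'a) \<Rightarrow> 'a \<Rightarrow>\<^sub>L 'a" where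
  "homogeneous_part a k X = (\<Sum>\<alpha> | length \<alpha> = k. scalar_op (a \<alpha>) o\<^sub>L word X \<alpha>)"

lemma free_eval_eq: "free_eval a X = (\<Sum>k. homogeneous_part a k X)"
  by (simp add: free_eval_def homogeneous_part_def)

lemma homogeneous_part_apply:
  "blinfun_apply (homogeneous_part a k X) x = (\<Sum>\<alpha> | length \<alpha> = k. a \<alpha> *\<^sub>C blinfun_apply (word X \<alpha>) x)"
  by (simp add: homogeneous_part_def blinfun.sum_left)

lemma clin_homogeneous_part: "(\<And>i. clin (X i)) \<Longrightarrow> clin (homogeneous_part a k X)"
  unfolding homogeneous_part_def by (intro clin_sum clin_compose clin_scalar_op clin_word)

lemma word_append: "word X (\<gamma> @ \<beta>) = word X \<gamma> o\<^sub>L word X \<beta>"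
  by (induction \<gamma>) (auto intro: blinfun_eqI)

text \<open>The test point is \<open>r\<close> times the compression of the left creation operators
  to words shorter than \<open>N\<close>, copied into \<open>'k\<close> along \<open>e\<close>; the
  factor \<open>r < 1\<close> puts it inside the open ball. It is nilpotent, so \<open>f\<close>
  becomes a polynomial there, and the coefficients of \<open>f\<close> can be read off from its
  action on the vectors \<open>e \<beta>\<close>. The inequality is then \<open>row_norm_adj\<close>
  at the vector with coordinates \<open>w\<close>.\<close>

lemma truncated_creation_contraction:
  fixes f :: "'m::finite \<Rightarrow> 'n::finite list \<Rightarrow> complex"
    and e :: "'n list \<Rightarrow> 'k::complex_hilbert"
  assumes contr: "contractive TYPE('k) f"
    and e: "\<And>\<alpha> \<beta>. cinner (e \<alpha>) (e \<beta>) = (if \<alpha> = \<beta> \<and> length \<alpha> < N then 1 else 0)"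
    and r: "0 < r" "r < 1" and N: "0 < N"
    and w: "\<And>\<alpha>. N \<le> length \<alpha> \<Longrightarrow> w \<alpha> = 0"
  shows "(\<Sum>j\<in>UNIV. \<Sum>\<beta> | length \<beta> < N.
      (cmod (\<Sum>\<gamma> | length \<gamma> < N. cnj (f j \<gamma>) * of_real (r ^ length \<gamma>) * w (\<gamma> @ \<beta>)))\<^sup>2)
    \<le> (\<Sum>\<alpha> | length \<alpha> < N. (cmod (w \<alpha>))\<^sup>2)"
proof -
  have e0: "e \<alpha> = 0" if "N \<le> length \<alpha>" for \<alpha>
    using e[of \<alpha> \<alpha>] that by (simp add: norm_sq_cinner)
  define X :: "'n \<Rightarrow> 'k \<Rightarrow>\<^sub>L 'k"
    where "X i = Blinfun (\<lambda>x. r *\<^sub>R (\<Sum>\<alpha> | length \<alpha> < N. cinner (e \<alpha>) x *\<^sub>C e (i # \<alpha>)))" for i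
  define Z :: "'n \<Rightarrow> 'k \<Rightarrow>\<^sub>L 'k"
    where "Z i = Blinfun (\<lambda>x. r *\<^sub>R (\<Sum>\<alpha> | length \<alpha> < N. cinner (e (i # \<alpha>)) x *\<^sub>C e \<alpha>))" for i
  have X: "blinfun_apply (X i) x = r *\<^sub>R (\<Sum>\<alpha> | length \<alpha> < N. cinner (e \<alpha>) x *\<^sub>C e (i # \<alpha>))" for i x
    unfolding X_def
    by (subst bounded_linear_Blinfun_apply)
      (intro bounded_linear_const_scaleR bounded_linear_sum bounded_linear_rank_one, simp)
  have Z: "blinfun_apply (Z i) x = r *\<^sub>R (\<Sum>\<alpha> | length \<alpha> < N. cinner (e (i # \<alpha>)) x *\<^sub>C e \<alpha>)" for i x
    unfolding Z_def
    by (subst bounded_linear_Blinfun_apply)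
      (intro bounded_linear_const_scaleR bounded_linear_sum bounded_linear_rank_one, simp)
  have clinX: "clin (X i)" for i
    unfolding clin_def X
    by (simp add: cinner_scaleC_right scaleC_scaleC[symmetric] scaleC_sum_right scaleC_scaleR_commute)
  have adjX: "adj (X i) = Z i" for i
  proof (rule cinner_unique_adj)
    fix x y
    have "cinner (blinfun_apply (X i) x) y = of_real r * (\<Sum>\<alpha> | length \<alpha> < N. cnj (cinner (e \<alpha>) x) * cinner (e (i # \<alpha>)) y)"
      by (simp add: X cinner_sum_left cinner_scaleC_left)
    also have "\<dots> = cinner x (blinfun_apply (Z i) y)"
      by (simp add: Z cinner_sum_right cinner_scaleC_right cinner_commute[of x] mult.commute)
    finally show "cinner (blinfun_apply (X i) x) y = cinner x (blinfun_apply (Z i) y)" .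
  qed
  have Xe: "blinfun_apply (X i) (e \<beta>) = r *\<^sub>R e (i # \<beta>)" for i \<beta>
  proof -
    have "(\<Sum>\<alpha> | length \<alpha> < N. cinner (e \<alpha>) (e \<beta>) *\<^sub>C e (i # \<alpha>))
        = (\<Sum>\<alpha> | length \<alpha> < N. if \<alpha> = \<beta> then e (i # \<beta>) else 0)"
      by (rule sum.cong) (auto simp: e)
    then show ?thesis by (simp add: X e0)
  qed
  have Xword: "blinfun_apply (word X \<gamma>) (e \<beta>) = r ^ length \<gamma> *\<^sub>R e (\<gamma> @ \<beta>)" for \<gamma> \<beta>
    by (induction \<gamma>) (simp_all add: blinfun.scaleR_right Xe mult.commute)
  \<comment> \<open>The innermost letter maps into the span of vectors of nonempty words, and each
    of the remaining \<open>N - 1\<close> or more letters lengthens these by one, until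
    \<open>e\<close> vanishes. Positivity of \<open>N\<close> excludes the empty word, whose
    operator is the identity.\<close>
  have Xnil: "word X \<gamma> = 0" if \<gamma>: "N \<le> length \<gamma>" for \<gamma>
  proof (cases \<gamma> rule: rev_cases)
    case (snoc \<delta> i)
    then show ?thesis using \<gamma>
      by (intro blinfun_eqI)
        (simp add: word_append X blinfun.scaleR_right blinfun.sum_right
          clin_scaleC[OF clin_word[OF clinX]] Xword e0)
  qed (use \<gamma> N in auto)
  have "X \<in> op_ball"
  proof -
    have "norm (blinfun_apply (\<Sum>i\<in>UNIV. X i o\<^sub>L adj (X i)) y) \<le> r\<^sup>2 * norm y" for y
    proof -
      \<comment> \<open>Indexed by pairs, the vectors \<open>e (i # \<alpha>)\<close> are
        orthonormal apart from those that vanish, so the operator at hand is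
        \<open>r\<^sup>2\<close> times an orthogonal projection.\<close>
      define I where "I = (UNIV :: 'n set) \<times> {\<alpha> :: 'n list. length \<alpha> < N}"
      define g where "g = (\<lambda>(i, \<alpha>). e (i # \<alpha>))"
      have on: "cinner (g p) (g q) = (if p = q \<and> Suc (length (snd p)) < N then 1 else 0)" for p q
        by (cases p; cases q) (auto simp: g_def e)
      have fin: "finite I" by (simp add: I_def)
      have "blinfun_apply (\<Sum>i\<in>UNIV. X i o\<^sub>L adj (X i)) y
          = (\<Sum>i\<in>UNIV. r\<^sup>2 *\<^sub>R (\<Sum>\<alpha> | length \<alpha> < N. cinner (e (i # \<alpha>)) y *\<^sub>C e (i # \<alpha>)))"
        by (simp add: blinfun.sum_left adjX Z blinfun.scaleR_right blinfun.sum_right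
            clin_scaleC[OF clinX] Xe scaleC_scaleR_commute scaleR_sum_right power2_eq_square)
      also have "\<dots> = r\<^sup>2 *\<^sub>R (\<Sum>p\<in>I. cinner (g p) y *\<^sub>C g p)"
        by (simp add: I_def g_def sum.cartesian_product scaleR_sum_right[symmetric] case_prod_unfold)
      finally show ?thesis
        using partial_orthonormal(2)[OF fin on, of y] by (simp add: mult_left_mono)
    qed
    then have "norm (\<Sum>i\<in>UNIV. X i o\<^sub>L adj (X i)) \<le> r\<^sup>2"
      by (intro norm_blinfun_bound) auto
    also have "r\<^sup>2 < 1" using r by (simp add: power_less_one_iff)
    finally show ?thesis by (simp add: op_ball_def clinX)
  qed
  then have row: "row_norm (\<lambda>j. free_eval (f j) X) \<le> 1"
    using contr by (simp add: contractive_def)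
  define F where "F j = free_eval (f j) X" for j
  have F: "F j = (\<Sum>k<N. homogeneous_part (f j) k X)" for j
    unfolding F_def free_eval_eq
    by (rule suminf_finite) (auto simp: homogeneous_part_def Xnil intro!: sum.neutral blinfun_eqI)
  have clinF: "clin (F j)" for j
    unfolding F by (intro clin_sum clin_homogeneous_part clinX)
  have Fe: "blinfun_apply (F j) (e \<beta>)
      = (\<Sum>\<gamma> | length \<gamma> < N. f j \<gamma> *\<^sub>C r ^ length \<gamma> *\<^sub>R e (\<gamma> @ \<beta>))" for j \<beta>
    by (simp add: F blinfun.sum_left homogeneous_part_apply Xword sum_words_less)
  note pon = partial_orthonormal[where I = "{\<alpha>. length \<alpha> < N}" and e = e
      and Q = "\<lambda>\<alpha>. length \<alpha> < N", OF finite_words_less e]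
  define x where "x = (\<Sum>\<alpha> | length \<alpha> < N. w \<alpha> *\<^sub>C e \<alpha>)"
  have ex: "cinner (e \<beta>) x = w \<beta>" for \<beta>
  proof -
    have "cinner (e \<beta>) x = (\<Sum>\<alpha> | length \<alpha> < N. if \<alpha> = \<beta> then w \<beta> else 0)"
      unfolding x_def cinner_sum_right cinner_scaleC_right e by (rule sum.cong) auto
    then show ?thesis by (simp add: w)
  qed
  have nx: "(norm x)\<^sup>2 = (\<Sum>\<alpha> | length \<alpha> < N. (cmod (w \<alpha>))\<^sup>2)"
    using pon(1)[of x] by (simp add: ex x_def[symmetric])
  have coeff: "cinner (e \<beta>) (blinfun_apply (adj (F j)) x)
      = (\<Sum>\<gamma> | length \<gamma> < N. cnj (f j \<gamma>) * of_real (r ^ length \<gamma>) * w (\<gamma> @ \<beta>))" for \<beta> j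
    by (simp add: cinner_adj_right[OF clinF] Fe cinner_sum_left cinner_scaleC_left ex mult.assoc)
  have "(\<Sum>\<beta> | length \<beta> < N. (cmod (cinner (e \<beta>) z))\<^sup>2) \<le> (norm z)\<^sup>2" for z
    unfolding pon(1)[symmetric] by (intro power_mono pon(2)) auto
  then have "(\<Sum>j\<in>UNIV. \<Sum>\<beta> | length \<beta> < N. (cmod (cinner (e \<beta>) (blinfun_apply (adj (F j)) x)))\<^sup>2)
      \<le> (\<Sum>j\<in>UNIV. (norm (blinfun_apply (adj (F j)) x))\<^sup>2)"
    by (intro sum_mono) auto
  also have "\<dots> \<le> (norm x)\<^sup>2"
    by (rule row_norm_adj[OF clinF]) (use row in \<open>simp add: F_def\<close>)
  finally show ?thesis unfolding nx coeff .
qed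

text \<open>An infinite-dimensional \<open>'k\<close> has room for orthonormal vectors indexed by
  all words shorter than \<open>N\<close>. The factor \<open>r\<close> disappears by continuity,
  since only finite sums are involved; from here on \<open>'k\<close> has served its
  purpose.\<close>

lemma contractive_coefficients:
  fixes f :: "'m::finite \<Rightarrow> 'n::finite list \<Rightarrow> complex"
  assumes inf: "\<nexists>D :: 'k::complex_hilbert set. finite D \<and> span D = UNIV"
    and contr: "contractive TYPE('k) f"
    and w: "\<And>\<alpha>. N \<le> length \<alpha> \<Longrightarrow> w \<alpha> = 0"
  shows "(\<Sum>j\<in>UNIV. \<Sum>\<beta> | length \<beta> < N.
      (cmod (\<Sum>\<gamma> | length \<gamma> < N. cnj (f j \<gamma>) * w (\<gamma> @ \<beta>)))\<^sup>2)
    \<le> (\<Sum>\<alpha> | length \<alpha> < N. (cmod (w \<alpha>))\<^sup>2)"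
proof (cases "N = 0")
  case False
  let ?A = "{\<alpha> :: 'n list. length \<alpha> < N}"
  obtain B :: "'k set" where B: "finite B" "orthonormal B" "card B = card ?A"
    using infinite_dim_orthonormal[OF inf, of "card ?A"] by blast
  then obtain g where g: "bij_betw g ?A B"
    using finite_same_card_bij[of ?A B] by auto
  define e where "e \<alpha> = (if length \<alpha> < N then g \<alpha> else 0)" for \<alpha>
  have e: "cinner (e \<alpha>) (e \<beta>) = (if \<alpha> = \<beta> \<and> length \<alpha> < N then 1 else 0)" for \<alpha> \<beta>
  proof (cases "length \<alpha> < N \<and> length \<beta> < N")
    case True
    then have "g \<alpha> \<in> B" "g \<beta> \<in> B" "g \<alpha> = g \<beta> \<longleftrightarrow> \<alpha> = \<beta>"
      using g by (auto simp: bij_betw_def inj_on_def)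
    then show ?thesis using B(2) True by (simp add: e_def orthonormal_def)
  qed (auto simp: e_def)
  let ?L = "\<lambda>r::real. \<Sum>j\<in>UNIV. \<Sum>\<beta> | length \<beta> < N.
      (cmod (\<Sum>\<gamma> | length \<gamma> < N. cnj (f j \<gamma>) * of_real (r ^ length \<gamma>) * w (\<gamma> @ \<beta>)))\<^sup>2"
  have "?L 1 \<le> (\<Sum>\<alpha> | length \<alpha> < N. (cmod (w \<alpha>))\<^sup>2)"
  proof (rule tendsto_upperbound)
    have "isCont ?L 1" by (intro continuous_intros)
    then show "(?L \<longlongrightarrow> ?L 1) (at_left 1)"
      unfolding isCont_def by (rule filterlim_mono[OF _ order_refl at_le]) simp
    have "eventually (\<lambda>r::real. r \<in> {0<..<1}) (at_left 1)"
      by (rule eventually_at_left_real) simp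
    then show "\<forall>\<^sub>F r in at_left 1. ?L r \<le> (\<Sum>\<alpha> | length \<alpha> < N. (cmod (w \<alpha>))\<^sup>2)"
      by eventually_elim (use truncated_creation_contraction[OF contr e _ _ _ w] False in auto)
  qed simp
  then show ?thesis by simp
qed simp

text \<open>This is ampliation by the identity: the finitely many relevant values of
  \<open>w\<close> lie in the span of a finite orthonormal set, and the scalar inequality is summed
  over its coordinates.\<close>

lemma contractive_coefficients_vector:
  fixes f :: "'m::finite \<Rightarrow> 'n::finite list \<Rightarrow> complex"
    and w :: "'n list \<Rightarrow> 'g::complex_hilbert"
  assumes inf: "\<nexists>D :: 'k::complex_hilbert set. finite D \<and> span D = UNIV"
    and contr: "contractive TYPE('k) f"
    and w: "\<And>\<alpha>. N \<le> length \<alpha> \<Longrightarrow> w \<alpha> = 0"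
  shows "(\<Sum>j\<in>UNIV. \<Sum>\<beta> | length \<beta> < N.
      (norm (\<Sum>\<gamma> | length \<gamma> < N. cnj (f j \<gamma>) *\<^sub>C w (\<gamma> @ \<beta>)))\<^sup>2)
    \<le> (\<Sum>\<alpha> | length \<alpha> < N. (norm (w \<alpha>))\<^sup>2)"
proof -
  obtain B where B: "finite B" "orthonormal B"
    and exp: "\<forall>v\<in>w ` {\<alpha>. length \<alpha> < N}. v = (\<Sum>b\<in>B. cinner b v *\<^sub>C b)"
    using gram_schmidt[OF finite_imageI[OF finite_words_less], of w N] by (elim exE conjE)
  have expw: "(\<Sum>b\<in>B. cinner b (w \<alpha>) *\<^sub>C b) = w \<alpha>" for \<alpha>
  proof (cases "length \<alpha> < N")
    case True
    then show ?thesis by (intro exp[rule_format, symmetric] imageI CollectI)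
  qed (simp add: w)
  have on: "cinner x y = (if x = y \<and> True then 1 else 0)" if "x \<in> B" "y \<in> B" for x y
    using B(2) that by (simp add: orthonormal_def)
  have norm_exp: "(norm v)\<^sup>2 = (\<Sum>b\<in>B. (cmod (cinner b v))\<^sup>2)"
    if "(\<Sum>b\<in>B. cinner b v *\<^sub>C b) = v" for v
    using partial_orthonormal(1)[where e = "\<lambda>b. b" and Q = "\<lambda>_. True" and z = v, OF B(1) on]
    unfolding that by simp
  define u where "u j \<beta> = (\<Sum>\<gamma> | length \<gamma> < N. cnj (f j \<gamma>) *\<^sub>C w (\<gamma> @ \<beta>))" for j \<beta>
  have cu: "cinner b (u j \<beta>) = (\<Sum>\<gamma> | length \<gamma> < N. cnj (f j \<gamma>) * cinner b (w (\<gamma> @ \<beta>)))" for b j \<beta>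
    by (simp add: u_def cinner_sum_right cinner_scaleC_right)
  have expu: "(\<Sum>b\<in>B. cinner b (u j \<beta>) *\<^sub>C b) = u j \<beta>" for j \<beta>
  proof -
    have "(\<Sum>b\<in>B. cinner b (u j \<beta>) *\<^sub>C b)
        = (\<Sum>b\<in>B. \<Sum>\<gamma> | length \<gamma> < N. cnj (f j \<gamma>) *\<^sub>C cinner b (w (\<gamma> @ \<beta>)) *\<^sub>C b)"
      unfolding cu scaleC_scaleC scaleC_sum_left ..
    also have "\<dots> = (\<Sum>\<gamma> | length \<gamma> < N. cnj (f j \<gamma>) *\<^sub>C (\<Sum>b\<in>B. cinner b (w (\<gamma> @ \<beta>)) *\<^sub>C b))"
      unfolding scaleC_sum_right by (rule sum.swap)
    finally show ?thesis by (simp add: expw u_def)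
  qed
  have "(\<Sum>j\<in>UNIV. \<Sum>\<beta> | length \<beta> < N. (norm (u j \<beta>))\<^sup>2)
      = (\<Sum>j\<in>UNIV. \<Sum>\<beta> | length \<beta> < N. \<Sum>b\<in>B. (cmod (cinner b (u j \<beta>)))\<^sup>2)"
    by (simp only: norm_exp[OF expu])
  also have "\<dots> = (\<Sum>j\<in>UNIV. \<Sum>b\<in>B. \<Sum>\<beta> | length \<beta> < N. (cmod (cinner b (u j \<beta>)))\<^sup>2)"
    by (intro sum.cong refl sum.swap)
  also have "\<dots> = (\<Sum>b\<in>B. \<Sum>j\<in>UNIV. \<Sum>\<beta> | length \<beta> < N. (cmod (cinner b (u j \<beta>)))\<^sup>2)"
    by (rule sum.swap)
  also have "\<dots> \<le> (\<Sum>b\<in>B. \<Sum>\<alpha> | length \<alpha> < N. (cmod (cinner b (w \<alpha>)))\<^sup>2)"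
    unfolding cu by (intro sum_mono contractive_coefficients[OF inf contr]) (simp add: w)
  also have "\<dots> = (\<Sum>\<alpha> | length \<alpha> < N. (norm (w \<alpha>))\<^sup>2)"
    unfolding norm_exp[OF expw] by (rule sum.swap)
  finally show ?thesis unfolding u_def .
qed

section \<open>A Schwarz--Pick bound for strict row contractions\<close>

text \<open>
  The contraction on coefficients is tested on the Poisson vector of \<open>h\<close> plus a vector \<open>g\<close> in the
  vacuum component, as in the proof of the Schwarz--Pick lemma by positivity of a two-point Pick
  matrix; the choice of \<open>g\<close> optimises the resulting inequality.
\<close>

lemma free_eval_strict_row_contraction:
  fixes f :: "'m::finite \<Rightarrow> 'n::finite list \<Rightarrow> complex"
    and W :: "'n \<Rightarrow> 'g::complex_hilbert \<Rightarrow>\<^sub>L 'g"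
  assumes inf: "\<nexists>D :: 'k::complex_hilbert set. finite D \<and> span D = UNIV"
    and contr: "contractive TYPE('k) f"
    and f0: "norm (value_at_0 f) \<le> 1"
    and W: "\<And>i. clin (W i)" and c: "0 \<le> c" "c < 1"
    and row: "\<And>h. (\<Sum>i\<in>UNIV. (norm (blinfun_apply (adj (W i)) h))\<^sup>2) \<le> c * (norm h)\<^sup>2"
    and Y: "\<And>j. (\<lambda>k. homogeneous_part (f j) k W) sums Y j"
  shows "(\<Sum>j\<in>UNIV. (norm (blinfun_apply (adj (Y j)) h))\<^sup>2)
    \<le> (1 - (1 - c) * (1 - norm (value_at_0 f))\<^sup>2) * (norm h)\<^sup>2"
proof -
  obtain D :: "'g \<Rightarrow>\<^sub>L 'g" where D: "clin D"
    and nD: "\<And>h. (norm (blinfun_apply D h))\<^sup>2 = (norm h)\<^sup>2 - (\<Sum>i\<in>UNIV. (norm (blinfun_apply (adj (W i)) h))\<^sup>2)"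
    and hsD: "\<And>h. ((\<lambda>\<alpha>. (norm (blinfun_apply D (blinfun_apply (adj (word W \<alpha>)) h)))\<^sup>2) has_sum (norm h)\<^sup>2) UNIV"
    using poisson_defect[OF W c row] by metis
  define A where "A = norm (value_at_0 f)"
  have A: "A = L2_set (\<lambda>j. cmod (f j [])) UNIV"
    by (simp add: A_def norm_vec_def value_at_0_def)
  have A2: "A\<^sup>2 = (\<Sum>j\<in>UNIV. (cmod (f j []))\<^sup>2)"
    by (simp add: A L2_set_def sum_nonneg)
  define Q where "Q j n = (\<Sum>k<n. homogeneous_part (f j) k W)" for j n
  have Q: "(\<lambda>n. Q j n) \<longlonglongrightarrow> Y j" for j
    using Y by (simp add: sums_def Q_def)
  have clinQ: "clin (Q j n)" for j n
    unfolding Q_def by (intro clin_sum clin_homogeneous_part W)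
  have clinY: "clin (Y j)" for j
    by (rule clin_tendsto[OF Q _ clinQ]) simp
  have adjQ: "blinfun_apply (adj (Q j n)) h = (\<Sum>\<gamma> | length \<gamma> < n. cnj (f j \<gamma>) *\<^sub>C blinfun_apply (adj (word W \<gamma>)) h)" for j n
  proof (rule cinner_ext)
    fix x
    show "cinner x (blinfun_apply (adj (Q j n)) h)
      = cinner x (\<Sum>\<gamma> | length \<gamma> < n. cnj (f j \<gamma>) *\<^sub>C blinfun_apply (adj (word W \<gamma>)) h)"
      unfolding cinner_adj_right[OF clinQ]
      by (simp add: cinner_sum_right cinner_scaleC_right cinner_adj_right[OF clin_word[OF W]]
          Q_def blinfun.sum_left homogeneous_part_apply cinner_sum_left cinner_scaleC_left sum_words_less)
  qed
  define y where "y j = blinfun_apply (adj (Y j)) h" for j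
  define S where "S = (\<Sum>j\<in>UNIV. (norm (y j))\<^sup>2)"
  have adj_nil: "blinfun_apply (adj (word W [])) x = x" for x
  proof -
    have "adj (id_blinfun :: 'g \<Rightarrow>\<^sub>L 'g) = id_blinfun"
      by (rule cinner_unique_adj) simp
    then show ?thesis by simp
  qed
  \<comment> \<open>On the Poisson vector of \<open>h\<close>, an adjoint creation operator acts as
    the adjoint of \<open>W i\<close> acts on \<open>h\<close>; hence the coefficient map of
    \<open>f\<close> sends it to the Poisson vectors of the \<open>y j\<close>. The vacuum vector
    \<open>g\<close> is annihilated by every nonempty word and so meets only the constant
    coefficients \<open>f j []\<close>.\<close>
  have main: "(\<Sum>j\<in>UNIV. (norm (y j))\<^sup>2 + (norm (blinfun_apply D (y j) + cnj (f j []) *\<^sub>C g))\<^sup>2 - (norm (blinfun_apply D (y j)))\<^sup>2)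
    \<le> (norm h)\<^sup>2 + (norm (blinfun_apply D h + g))\<^sup>2 - (norm (blinfun_apply D h))\<^sup>2" (is "_ \<le> ?R") for g
  proof -
    define w where "w N \<alpha> = (if length \<alpha> < N then blinfun_apply D (blinfun_apply (adj (word W \<alpha>)) h) + (if \<alpha> = [] then g else 0) else 0)" for N \<alpha>
    define v where "v j \<beta> = blinfun_apply D (blinfun_apply (adj (word W \<beta>)) (y j)) + (if \<beta> = [] then cnj (f j []) *\<^sub>C g else 0)" for j \<beta>
    have split0: "(\<Sum>\<alpha> | length \<alpha> < N. (norm (F \<alpha> + (if \<alpha> = [] then z else 0)))\<^sup>2)
        = (\<Sum>\<alpha> | length \<alpha> < N. (norm (F \<alpha>))\<^sup>2) + ((norm (F [] + z))\<^sup>2 - (norm (F []))\<^sup>2)"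
      if "0 < N" for N :: nat and F :: "'n list \<Rightarrow> 'g" and z
    proof -
      have "(\<Sum>\<alpha> | length \<alpha> < N. (norm (F \<alpha> + (if \<alpha> = [] then z else 0)))\<^sup>2 - (norm (F \<alpha>))\<^sup>2)
          = (\<Sum>\<alpha> :: 'n list | length \<alpha> < N. if \<alpha> = [] then (norm (F [] + z))\<^sup>2 - (norm (F []))\<^sup>2 else 0)"
        by (rule sum.cong) auto
      also have "\<dots> = (norm (F [] + z))\<^sup>2 - (norm (F []))\<^sup>2" using that by simp
      finally show ?thesis by (simp add: sum_subtractf)
    qed
    have R: "(\<Sum>\<alpha> | length \<alpha> < N. (norm (w N \<alpha>))\<^sup>2) \<le> ?R" if "0 < N" for N
    proof -
      have "(\<Sum>\<alpha> | length \<alpha> < N. (norm (w N \<alpha>))\<^sup>2)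
          = (\<Sum>\<alpha> | length \<alpha> < N. (norm (blinfun_apply D (blinfun_apply (adj (word W \<alpha>)) h) + (if \<alpha> = [] then g else 0)))\<^sup>2)"
        by (simp add: w_def)
      also have "\<dots> \<le> ?R"
        unfolding split0[OF that]
        using finite_sum_le_has_sum[OF hsD[of h] finite_words_less[of N]] by (simp only: adj_nil) simp
      finally show ?thesis .
    qed
    \<comment> \<open>The cutoff of \<open>w\<close> at \<open>N\<close> leaves at the word
      \<open>\<beta>\<close> only those \<open>\<gamma>\<close> with length below
      \<open>N - length \<beta>\<close>. This is why partial sums \<open>Q j\<close> appear in place
      of \<open>Y j\<close>.\<close>
    have u: "(\<Sum>\<gamma> | length \<gamma> < N. cnj (f j \<gamma>) *\<^sub>C w N (\<gamma> @ \<beta>))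
        = blinfun_apply D (blinfun_apply (adj (word W \<beta>)) (blinfun_apply (adj (Q j (N - length \<beta>))) h))
          + (if \<beta> = [] then cnj (f j []) *\<^sub>C g else 0)" if "length \<beta> < N" for N j \<beta>
    proof -
      have "(\<Sum>\<gamma> | length \<gamma> < N. cnj (f j \<gamma>) *\<^sub>C w N (\<gamma> @ \<beta>))
          = (\<Sum>\<gamma> | length \<gamma> < N - length \<beta>. cnj (f j \<gamma>) *\<^sub>C w N (\<gamma> @ \<beta>))"
        by (rule sum.mono_neutral_right) (auto simp: w_def)
      also have "\<dots> = (\<Sum>\<gamma> | length \<gamma> < N - length \<beta>. cnj (f j \<gamma>) *\<^sub>C blinfun_apply D (blinfun_apply (adj (word W \<beta>)) (blinfun_apply (adj (word W \<gamma>)) h))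
          + (if \<gamma> = [] then if \<beta> = [] then cnj (f j []) *\<^sub>C g else 0 else 0))"
        by (rule sum.cong) (auto simp: w_def adj_word_append[OF W] adj_nil scaleC_add_right simp del: word.simps)
      also have "\<dots> = (\<Sum>\<gamma> | length \<gamma> < N - length \<beta>. cnj (f j \<gamma>) *\<^sub>C blinfun_apply D (blinfun_apply (adj (word W \<beta>)) (blinfun_apply (adj (word W \<gamma>)) h)))
          + (if \<beta> = [] then cnj (f j []) *\<^sub>C g else 0)"
        using that by (simp add: sum.distrib)
      also have "(\<Sum>\<gamma> | length \<gamma> < N - length \<beta>. cnj (f j \<gamma>) *\<^sub>C blinfun_apply D (blinfun_apply (adj (word W \<beta>)) (blinfun_apply (adj (word W \<gamma>)) h)))
          = blinfun_apply D (blinfun_apply (adj (word W \<beta>)) (blinfun_apply (adj (Q j (N - length \<beta>))) h))"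
        unfolding adjQ blinfun.sum_right clin_scaleC[OF clin_adj[OF clin_word[OF W]]] clin_scaleC[OF D] ..
      finally show ?thesis .
    qed
    \<comment> \<open>The bound \<open>M\<close> on \<open>\<beta>\<close> stays fixed while
      \<open>N\<close> grows, so finitely many terms pass to the limit and the index
      \<open>N - length \<beta>\<close> tends to infinity in each; \<open>M\<close> is released only
      afterwards.\<close>
    have part: "(\<Sum>j\<in>UNIV. \<Sum>\<beta> | length \<beta> < M. (norm (v j \<beta>))\<^sup>2) \<le> ?R" if M: "0 < M" for M
    proof (rule tendsto_upperbound)
      show "(\<lambda>N. \<Sum>j\<in>UNIV. \<Sum>\<beta> | length \<beta> < M. (norm (blinfun_apply D (blinfun_apply (adj (word W \<beta>)) (blinfun_apply (adj (Q j (N - length \<beta>))) h))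
          + (if \<beta> = [] then cnj (f j []) *\<^sub>C g else 0)))\<^sup>2) \<longlonglongrightarrow> (\<Sum>j\<in>UNIV. \<Sum>\<beta> | length \<beta> < M. (norm (v j \<beta>))\<^sup>2)"
        unfolding v_def y_def
        by (intro tendsto_intros tendsto_adj clinQ filterlim_compose[OF Q filterlim_minus_const_nat_at_top]) simp
      show "\<forall>\<^sub>F N in sequentially. (\<Sum>j\<in>UNIV. \<Sum>\<beta> | length \<beta> < M. (norm (blinfun_apply D (blinfun_apply (adj (word W \<beta>)) (blinfun_apply (adj (Q j (N - length \<beta>))) h))
          + (if \<beta> = [] then cnj (f j []) *\<^sub>C g else 0)))\<^sup>2) \<le> ?R"
      proof (rule eventually_sequentiallyI[of M])
        fix N assume N: "M \<le> N"
        have "(\<Sum>j\<in>UNIV. \<Sum>\<beta> | length \<beta> < M. (norm (blinfun_apply D (blinfun_apply (adj (word W \<beta>)) (blinfun_apply (adj (Q j (N - length \<beta>))) h))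
          + (if \<beta> = [] then cnj (f j []) *\<^sub>C g else 0)))\<^sup>2)
          = (\<Sum>j\<in>UNIV. \<Sum>\<beta> | length \<beta> < M. (norm (\<Sum>\<gamma> | length \<gamma> < N. cnj (f j \<gamma>) *\<^sub>C w N (\<gamma> @ \<beta>)))\<^sup>2)"
          by (intro sum.cong refl) (use N in \<open>simp only: u mem_Collect_eq\<close>; use N in \<open>subst u; simp\<close>)
        also have "\<dots> \<le> (\<Sum>j\<in>UNIV. \<Sum>\<beta> | length \<beta> < N. (norm (\<Sum>\<gamma> | length \<gamma> < N. cnj (f j \<gamma>) *\<^sub>C w N (\<gamma> @ \<beta>)))\<^sup>2)"
          by (intro sum_mono sum_mono2) (use N in auto)
        also have "\<dots> \<le> (\<Sum>\<alpha> | length \<alpha> < N. (norm (w N \<alpha>))\<^sup>2)"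
          by (rule contractive_coefficients_vector[OF inf contr]) (simp add: w_def)
        also have "\<dots> \<le> ?R" by (rule R) (use M N in simp)
        finally show "(\<Sum>j\<in>UNIV. \<Sum>\<beta> | length \<beta> < M. (norm (blinfun_apply D (blinfun_apply (adj (word W \<beta>)) (blinfun_apply (adj (Q j (N - length \<beta>))) h))
          + (if \<beta> = [] then cnj (f j []) *\<^sub>C g else 0)))\<^sup>2) \<le> ?R" .
      qed
    qed simp
    show ?thesis
    proof (rule tendsto_upperbound)
      show "(\<lambda>M. \<Sum>j\<in>UNIV. (\<Sum>\<beta> | length \<beta> < M. (norm (blinfun_apply D (blinfun_apply (adj (word W \<beta>)) (y j))))\<^sup>2)
          + (norm (blinfun_apply D (y j) + cnj (f j []) *\<^sub>C g))\<^sup>2 - (norm (blinfun_apply D (y j)))\<^sup>2)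
        \<longlonglongrightarrow> (\<Sum>j\<in>UNIV. (norm (y j))\<^sup>2 + (norm (blinfun_apply D (y j) + cnj (f j []) *\<^sub>C g))\<^sup>2 - (norm (blinfun_apply D (y j)))\<^sup>2)"
        by (intro tendsto_sum tendsto_diff tendsto_add tendsto_const has_sum_words_lim hsD)
      have "(\<Sum>\<beta> | length \<beta> < M. (norm (v j \<beta>))\<^sup>2) = (\<Sum>\<beta> | length \<beta> < M. (norm (blinfun_apply D (blinfun_apply (adj (word W \<beta>)) (y j))))\<^sup>2)
          + (norm (blinfun_apply D (y j) + cnj (f j []) *\<^sub>C g))\<^sup>2 - (norm (blinfun_apply D (y j)))\<^sup>2" if "0 < M" for j M
        unfolding v_def split0[OF that] adj_nil by simp
      then show "\<forall>\<^sub>F M in sequentially. (\<Sum>j\<in>UNIV. (\<Sum>\<beta> | length \<beta> < M. (norm (blinfun_apply D (blinfun_apply (adj (word W \<beta>)) (y j))))\<^sup>2)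
          + (norm (blinfun_apply D (y j) + cnj (f j []) *\<^sub>C g))\<^sup>2 - (norm (blinfun_apply D (y j)))\<^sup>2) \<le> ?R"
        using part by (intro eventually_sequentiallyI[of 1]) simp
    qed simp
  qed
  define z where "z = (\<Sum>j\<in>UNIV. f j [] *\<^sub>C y j)"
  define x where "x = h - z"
  have dz: "(\<Sum>j\<in>UNIV. Re (cinner (blinfun_apply D (y j)) (cnj (f j []) *\<^sub>C g))) = Re (cinner (blinfun_apply D z) g)" for g
    by (simp add: z_def blinfun.sum_right clin_scaleC[OF D] cinner_sum_left cinner_scaleC_left cinner_scaleC_right)
  have ineq: "S + 2 * Re (cinner (blinfun_apply D z) g) + A\<^sup>2 * (norm g)\<^sup>2
      \<le> (norm h)\<^sup>2 + 2 * Re (cinner (blinfun_apply D h) g) + (norm g)\<^sup>2" for g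
  proof -
    have "(\<Sum>j\<in>UNIV. (norm (y j))\<^sup>2 + (norm (blinfun_apply D (y j) + cnj (f j []) *\<^sub>C g))\<^sup>2 - (norm (blinfun_apply D (y j)))\<^sup>2)
        = (\<Sum>j\<in>UNIV. (norm (y j))\<^sup>2 + 2 * Re (cinner (blinfun_apply D (y j)) (cnj (f j []) *\<^sub>C g)) + (cmod (f j []))\<^sup>2 * (norm g)\<^sup>2)"
      unfolding norm_add_sq norm_scaleC power_mult_distrib by (simp add: add.assoc)
    also have "\<dots> = S + 2 * Re (cinner (blinfun_apply D z) g) + A\<^sup>2 * (norm g)\<^sup>2"
      unfolding S_def A2 dz[symmetric] by (simp add: sum.distrib sum_distrib_left sum_distrib_right)
    finally show ?thesis
      using main[of g] by (simp add: norm_add_sq)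
  qed
  \<comment> \<open>\<open>g = - D x\<close> minimises
    \<open>2 * Re (cinner (D x) g) + (norm g)\<^sup>2\<close>, which is what remains on the right
    after \<open>D z\<close> has been moved there. The nonnegative term with
    \<open>A\<^sup>2\<close> is discarded next.\<close>
  have "S + A\<^sup>2 * (norm (blinfun_apply D x))\<^sup>2 \<le> (norm h)\<^sup>2 - (norm (blinfun_apply D x))\<^sup>2"
    using ineq[of "- blinfun_apply D x"]
    by (simp add: x_def blinfun.diff_right norm_minus_commute norm_diff_sq cinner_diff_right
        Re_cinner_commute[of "blinfun_apply D z" "blinfun_apply D h"] algebra_simps)
  then have S1: "S \<le> (norm h)\<^sup>2 - (norm (blinfun_apply D x))\<^sup>2"
    using mult_nonneg_nonneg[OF zero_le_power2 zero_le_power2, of A "norm (blinfun_apply D x)"]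
    by linarith
  \<comment> \<open>\<open>S1\<close> is used twice. Its weak form
    \<open>S \<le> (norm h)\<^sup>2\<close> keeps \<open>z\<close> below \<open>A * norm h\<close>,
    hence \<open>x = h - z\<close> away from 0; then \<open>D x\<close> is bounded below, and
    \<open>S1\<close> itself becomes strict.\<close>
  have "norm z \<le> (\<Sum>j\<in>UNIV. \<bar>cmod (f j [])\<bar> * \<bar>norm (y j)\<bar>)"
    unfolding z_def by (rule order_trans[OF norm_sum]) (simp add: norm_scaleC)
  also have "\<dots> \<le> A * L2_set (\<lambda>j. norm (y j)) UNIV"
    unfolding A by (rule L2_set_mult_ineq)
  also have "L2_set (\<lambda>j. norm (y j)) UNIV \<le> norm h"
    unfolding L2_set_def S_def[symmetric] by (rule real_le_lsqrt) (use S1 in \<open>auto intro: order_trans\<close>)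
  finally have "norm z \<le> A * norm h"
    by (simp add: A_def mult_left_mono)
  then have "(1 - A) * norm h \<le> norm x"
    using norm_triangle_ineq2[of h z] by (simp add: x_def algebra_simps)
  then have "((1 - A) * norm h)\<^sup>2 \<le> (norm x)\<^sup>2"
    by (rule power_mono) (use f0 in \<open>simp add: A_def\<close>)
  then have "(1 - c) * ((1 - A)\<^sup>2 * (norm h)\<^sup>2) \<le> (1 - c) * (norm x)\<^sup>2"
    using c by (intro mult_left_mono) (auto simp: power_mult_distrib)
  also have "\<dots> \<le> (norm (blinfun_apply D x))\<^sup>2"
    unfolding nD using row[of x] by (simp add: algebra_simps)
  finally show ?thesis
    using S1 unfolding S_def y_def A_def by (simp add: algebra_simps)
qed

section \<open>Isometries with orthogonal ranges, and convergence of the series\<close>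

lemma isometric_cinner:
  assumes "clin A" "isometric A"
  shows "cinner (blinfun_apply A x) (blinfun_apply A y) = cinner x y"
proof -
  have n: "norm (blinfun_apply A z) = norm z" for z
    using assms(2) by (simp add: isometric_def)
  show ?thesis
    unfolding cinner_polarization[of x y] cinner_polarization[of "blinfun_apply A x"]
      blinfun.add_right[symmetric] blinfun.diff_right[symmetric] clin_scaleC[OF assms(1), symmetric] n ..
qed

definition isometric_tuple :: "('i \<Rightarrow> 'g::complex_hilbert \<Rightarrow>\<^sub>L 'g) \<Rightarrow> bool" where
  "isometric_tuple V \<longleftrightarrow> (\<forall>i. clin (V i) \<and> isometric (V i)) \<and>
    (\<forall>i j x y. i \<noteq> j \<longrightarrow> cinner (blinfun_apply (V i) x) (blinfun_apply (V j) y) = 0)"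

lemma isometric_tuple_cinner_word:
  assumes V: "isometric_tuple V" and "length \<alpha> = length \<beta>"
  shows "cinner (blinfun_apply (word V \<alpha>) x) (blinfun_apply (word V \<beta>) y) = (if \<alpha> = \<beta> then cinner x y else 0)"
  using assms(2)
proof (induction \<alpha> \<beta> rule: list_induct2)
  case (Cons i \<alpha> j \<beta>)
  then show ?case
    using V by (cases "i = j") (auto simp: isometric_tuple_def isometric_cinner)
qed simp

text \<open>Bessel's inequality for the orthogonal ranges: \<open>z\<close> is the projection of
  \<open>h\<close> onto their sum.\<close>

lemma isometric_tuple_adj_sum:
  fixes V :: "'i::finite \<Rightarrow> 'g::complex_hilbert \<Rightarrow>\<^sub>L 'g"
  assumes V: "isometric_tuple V"
  shows "(\<Sum>i\<in>UNIV. (norm (blinfun_apply (adj (V i)) h))\<^sup>2) \<le> (norm h)\<^sup>2"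
proof -
  let ?y = "\<lambda>i. blinfun_apply (adj (V i)) h"
  define z where "z = (\<Sum>i\<in>UNIV. blinfun_apply (V i) (?y i))"
  define S where "S = (\<Sum>i\<in>UNIV. (norm (?y i))\<^sup>2)"
  have clinV: "clin (V i)" for i using V by (simp add: isometric_tuple_def)
  have hz: "Re (cinner h z) = S"
    by (simp add: z_def S_def cinner_sum_right cinner_adj_left[OF clinV, symmetric])
  have "cinner (blinfun_apply (V i) (?y i)) z = (\<Sum>j\<in>UNIV. if j = i then cinner (?y i) (?y i) else 0)" for i
    unfolding z_def cinner_sum_right
    by (rule sum.cong) (use V in \<open>auto simp: isometric_tuple_def isometric_cinner\<close>)
  then have "Re (cinner z z) = S"
    by (subst z_def) (simp add: cinner_sum_left S_def)
  then have "0 \<le> (norm h)\<^sup>2 - S"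
    using zero_le_power2[of "norm (h - z)"] unfolding norm_diff_sq hz by simp
  then show ?thesis by (simp add: S_def)
qed

lemma word_scaleR: "word (\<lambda>i. t *\<^sub>R V i) \<alpha> = t ^ length \<alpha> *\<^sub>R word V \<alpha>"
  by (induction \<alpha>) (simp_all add: bounded_bilinear.scaleR_left[OF bounded_bilinear_blinfun_compose]
     bounded_bilinear.scaleR_right[OF bounded_bilinear_blinfun_compose])

lemma homogeneous_part_scaleR:
  "homogeneous_part a k (\<lambda>i. t *\<^sub>R V i) = t ^ k *\<^sub>R homogeneous_part a k V"
  by (simp add: homogeneous_part_def word_scaleR scaleR_sum_right bounded_bilinear.scaleR_right[OF bounded_bilinear_blinfun_compose])

definition coeff_norm :: "('n::finite list \<Rightarrow> complex) \<Rightarrow> nat \<Rightarrow> real" where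
  "coeff_norm a k = sqrt (\<Sum>\<alpha> | length \<alpha> = k. (cmod (a \<alpha>))\<^sup>2)"

lemma coeff_norm_nonneg: "0 \<le> coeff_norm a k"
  by (simp add: coeff_norm_def sum_nonneg)

text \<open>The vectors \<open>word V \<alpha>\<close> applied to \<open>x\<close>, with
  \<open>\<alpha>\<close> of length \<open>k\<close>, are pairwise orthogonal and of norm
  \<open>norm x\<close>, so this is Pythagoras. It turns the growth condition on coefficients into
  norm convergence.\<close>

lemma norm_homogeneous_part_isometric:
  assumes V: "isometric_tuple V"
  shows "norm (blinfun_apply (homogeneous_part a k V) x) = coeff_norm a k * norm x"
proof -
  let ?z = "blinfun_apply (homogeneous_part a k V) x"
  have "cinner (a \<alpha> *\<^sub>C blinfun_apply (word V \<alpha>) x) ?z = of_real ((cmod (a \<alpha>))\<^sup>2 * (norm x)\<^sup>2)"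
    if \<alpha>: "length \<alpha> = k" for \<alpha>
  proof -
    have "cinner (a \<alpha> *\<^sub>C blinfun_apply (word V \<alpha>) x) ?z
        = (\<Sum>\<beta> | length \<beta> = k. if \<beta> = \<alpha> then cnj (a \<alpha>) * a \<alpha> * cinner x x else 0)"
      unfolding homogeneous_part_apply cinner_sum_right cinner_scaleC_left cinner_scaleC_right
      by (rule sum.cong) (auto simp: isometric_tuple_cinner_word[OF V] \<alpha>)
    then show ?thesis
      using \<alpha> by (simp add: norm_sq_cinner complex_norm_square[unfolded of_real_power] mult.commute)
  qed
  then have "cinner ?z ?z = of_real (\<Sum>\<alpha> | length \<alpha> = k. (cmod (a \<alpha>))\<^sup>2 * (norm x)\<^sup>2)"
    by (subst homogeneous_part_apply) (simp add: cinner_sum_left)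
  then have "(norm ?z)\<^sup>2 = (\<Sum>\<alpha> | length \<alpha> = k. (cmod (a \<alpha>))\<^sup>2 * (norm x)\<^sup>2)"
    unfolding norm_sq_cinner using of_real_eq_iff by blast
  also have "\<dots> = (coeff_norm a k * norm x)\<^sup>2"
    by (simp add: coeff_norm_def sum_nonneg power_mult_distrib sum_distrib_right)
  finally show ?thesis
    by (simp add: power2_eq_iff_nonneg coeff_norm_nonneg)
qed

lemma summable_coeff_norm:
  assumes a: "free_holomorphic a" and t: "0 < t" "t < 1"
  shows "summable (\<lambda>k. t ^ k * coeff_norm a k)"
proof -
  \<comment> \<open>Any \<open>d\<close> strictly between 1 and \<open>1 / t\<close> would do: the
    limsup is below \<open>d\<close> eventually, and \<open>d * t < 1\<close> is the ratio of the
    geometric majorant.\<close>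
  define d where "d = 2 / (1 + t)"
  have d: "1 < d" "d * t < 1" "0 < d" using t by (auto simp: d_def field_simps)
  have "limsup (\<lambda>k. ereal (root (2 * k) (\<Sum>\<alpha> | length \<alpha> = k. (cmod (a \<alpha>))\<^sup>2))) < ereal d"
    using a d(1) by (auto simp: free_holomorphic_def intro: le_less_trans)
  then have "\<forall>\<^sub>F k in sequentially. ereal (root (2 * k) (\<Sum>\<alpha> | length \<alpha> = k. (cmod (a \<alpha>))\<^sup>2)) < ereal d"
    by (rule Limsup_lessD)
  \<comment> \<open>The index 0 is set aside because \<open>root 0\<close> is 0 by convention and
    carries no information on the coefficient.\<close>
  then have "\<forall>\<^sub>F k in sequentially. norm (t ^ k * coeff_norm a k) \<le> (d * t) ^ k"
    using eventually_gt_at_top[of 0]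
  proof eventually_elim
    case (elim k)
    let ?s = "\<Sum>\<alpha> | length \<alpha> = k. (cmod (a \<alpha>))\<^sup>2"
    have s: "0 \<le> ?s" by (simp add: sum_nonneg)
    have "?s = root (2 * k) ?s ^ (2 * k)"
      using elim(2) s by (simp add: real_root_pow_pos2)
    also have "\<dots> \<le> d ^ (2 * k)"
      using elim s by (intro power_mono) auto
    also have "\<dots> = (d ^ k)\<^sup>2" by (simp add: power_mult[symmetric] mult.commute)
    finally have "coeff_norm a k \<le> d ^ k"
      unfolding coeff_norm_def using d by (intro real_le_lsqrt) auto
    then show ?case
      using t coeff_norm_nonneg[of a k] by (simp add: power_mult_distrib mult.commute mult_left_mono)
  qed
  then show ?thesis
    by (rule summable_comparison_test_ev) (use t d in \<open>simp add: summable_geometric\<close>)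
qed

text \<open>An Abel limit: for \<open>r\<close> in \<open>{0..1}\<close> the terms are dominated by
  those at \<open>r = 1\<close>, so the M-test makes the sum continuous up to the endpoint.\<close>

lemma free_eval_lim_eq:
  assumes s: "summable (\<lambda>k. norm (homogeneous_part a k T))"
  shows "free_eval_lim a T = (\<Sum>k. homogeneous_part a k T)"
proof -
  define F where "F r = (\<Sum>k. r ^ k *\<^sub>R homogeneous_part a k T)" for r :: real
  have F1: "F 1 = (\<Sum>k. homogeneous_part a k T)"
    by (simp add: F_def)
  have "uniform_limit {0..1} (\<lambda>n r. \<Sum>k<n. r ^ k *\<^sub>R homogeneous_part a k T) F sequentially"
    unfolding F_def
    by (rule Weierstrass_m_test[OF _ s]) (auto intro!: mult_left_le_one_le power_le_one)
  then have "continuous_on {0..1} F"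
    by (rule uniform_limit_theorem[rotated]) (auto intro!: always_eventually continuous_intros)
  then have "(F \<longlongrightarrow> F 1) (at 1 within {0..1})"
    by (simp add: continuous_on)
  then have "(F \<longlongrightarrow> F 1) (at_left 1)"
    by (simp add: at_within_Icc_at_left)
  then have "Lim (at_left 1) F = F 1"
    by (rule tendsto_Lim[rotated]) simp
  then show ?thesis
    unfolding free_eval_lim_def free_eval_eq homogeneous_part_scaleR F_def[symmetric] F1 .
qed

section \<open>Dilations on Hilbert direct sums\<close>

text \<open>The equations of \<open>class_C\<close> in weak form, with \<open>adj J\<close> moved
  across the inner product and the witnesses \<open>J\<close>, \<open>V\<close> as
  arguments.\<close>

definition dilation ::
  "('h::complex_hilbert \<Rightarrow>\<^sub>L 'g::complex_hilbert) \<Rightarrow> ('i \<Rightarrow> 'g \<Rightarrow>\<^sub>L 'g) \<Rightarrow> real \<Rightarrow> ('i \<Rightarrow> 'h \<Rightarrow>\<^sub>L 'h) \<Rightarrow> bool" where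
  "dilation J V \<rho> T \<longleftrightarrow> clin J \<and> isometric J \<and> isometric_tuple V \<and>
    (\<forall>\<alpha> h k. \<alpha> \<noteq> [] \<longrightarrow> cinner h (blinfun_apply (word T \<alpha>) k)
      = of_real \<rho> * cinner (blinfun_apply J h) (blinfun_apply (word V \<alpha>) (blinfun_apply J k)))"

lemma class_C_iff_dilation:
  "class_C TYPE('g::complex_hilbert) \<rho> T \<longleftrightarrow> (\<exists>(J :: 'h::complex_hilbert \<Rightarrow>\<^sub>L 'g) V. dilation J V \<rho> T)"
proof -
  have eq: "(word T \<alpha> = \<rho> *\<^sub>R (adj J o\<^sub>L word V \<alpha> o\<^sub>L J)) \<longleftrightarrow>
      (\<forall>h k. cinner h (blinfun_apply (word T \<alpha>) k)
      = of_real \<rho> * cinner (blinfun_apply J h) (blinfun_apply (word V \<alpha>) (blinfun_apply J k)))"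
    if J: "clin J" for J :: "'h \<Rightarrow>\<^sub>L 'g" and V \<alpha>
  proof
    assume *: "\<forall>h k. cinner h (blinfun_apply (word T \<alpha>) k)
      = of_real \<rho> * cinner (blinfun_apply J h) (blinfun_apply (word V \<alpha>) (blinfun_apply J k))"
    show "word T \<alpha> = \<rho> *\<^sub>R (adj J o\<^sub>L word V \<alpha> o\<^sub>L J)"
      by (rule blinfun_eqI, rule cinner_ext)
        (simp add: * blinfun.scaleR_left cinner_adj_right[OF J])
  qed (simp add: blinfun.scaleR_left cinner_adj_right[OF J])
  show ?thesis
    unfolding class_C_def dilation_def isometric_tuple_def conj_assoc
    by (intro iff_exI conj_cong refl) (simp only: eq imp_conjR all_simps)
qed

lemma ell2_norm_has_sum: "((\<lambda>i. (norm (ell2_nth \<phi> i))\<^sup>2) has_sum (norm \<phi>)\<^sup>2) UNIV"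
proof -
  have "(\<lambda>i. (norm (ell2_nth \<phi> i))\<^sup>2) summable_on UNIV"
    using ell2_nth[of \<phi>] by simp
  then show ?thesis
    by (simp add: norm_ell2.rep_eq infsum_nonneg)
qed

lemma ell2_cinner_has_sum:
  "((\<lambda>i. cinner (ell2_nth \<phi> i) (ell2_nth \<psi> i)) has_sum cinner \<phi> (\<psi> :: ('i, 'h::complex_hilbert) ell2)) UNIV"
proof -
  have "(\<lambda>i. cinner (ell2_nth \<phi> i) (ell2_nth \<psi> i)) summable_on UNIV"
    by (rule cinner_summable) (use ell2_nth in auto)
  then show ?thesis by (simp add: cinner_ell2.rep_eq)
qed

lemma ell2_eqI: "(\<And>i. ell2_nth \<phi> i = ell2_nth \<psi> i) \<Longrightarrow> \<phi> = \<psi>"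
  by (simp add: ell2_nth_inject[symmetric] fun_eq_iff)

lemma isometric_into_ell2:
  fixes F :: "'i \<Rightarrow> 'a::complex_hilbert \<Rightarrow> 'b::complex_hilbert"
  assumes add: "\<And>i x y. F i (x + y) = F i x + F i y"
    and scale: "\<And>i c x. F i (c *\<^sub>C x) = c *\<^sub>C F i x"
    and sum: "\<And>x. ((\<lambda>i. (norm (F i x))\<^sup>2) has_sum (norm x)\<^sup>2) UNIV"
  obtains P :: "'a \<Rightarrow>\<^sub>L ('i, 'b) ell2" where "clin P" "isometric P"
    "\<And>x i. ell2_nth (blinfun_apply P x) i = F i x"
proof -
  define p where "p x = Abs_ell2 (\<lambda>i. F i x)" for x
  have nth: "ell2_nth (p x) i = F i x" for x i
  proof -
    have "(\<lambda>i. (norm (F i x))\<^sup>2) summable_on UNIV"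
      using sum by (rule has_sum_imp_summable)
    then show ?thesis by (simp add: p_def Abs_ell2_inverse)
  qed
  have scaleR: "F i (r *\<^sub>R x) = r *\<^sub>R F i x" for i r x
    using scale[of i "of_real r" x] by (simp add: scaleC_of_real)
  have norm: "norm (p x) = norm x" for x
  proof -
    have "(norm (p x))\<^sup>2 = (norm x)\<^sup>2"
      using ell2_norm_has_sum[of "p x"] sum[of x] unfolding nth by (rule has_sum_unique)
    then show ?thesis by (simp add: power2_eq_iff_nonneg)
  qed
  have "bounded_linear p"
    by (rule bounded_linear_intro[where K = 1])
      (auto intro!: ell2_eqI simp: norm nth plus_ell2.rep_eq scaleR_ell2.rep_eq add scaleR)
  then have P: "blinfun_apply (Blinfun p) = p"
    by (rule bounded_linear_Blinfun_apply)
  show thesis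
  proof (rule that[of "Blinfun p"])
    show "clin (Blinfun p)"
      unfolding clin_def P by (auto intro!: ell2_eqI simp: nth scaleC_ell2.rep_eq scale)
    show "isometric (Blinfun p)" by (simp add: isometric_def P norm)
    show "ell2_nth (blinfun_apply (Blinfun p) x) i = F i x" for x i by (simp add: P nth)
  qed
qed

text \<open>\<open>P\<close> is the tensor product of the index map
  \<open>e i \<mapsto> e (\<sigma> i)\<close> with the fibre operator \<open>A\<close>. Creation
  operators tensored with the identity and a shift tensored with \<open>V i\<close> are both of this
  form, and it is stable under composition.\<close>

definition pushes :: "('i \<Rightarrow> 'i) \<Rightarrow> ('g::complex_hilbert \<Rightarrow>\<^sub>L 'g) \<Rightarrow> (('i, 'g) ell2 \<Rightarrow>\<^sub>L ('i, 'g) ell2) \<Rightarrow> bool" where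
  "pushes \<sigma> A P \<longleftrightarrow> inj \<sigma> \<and> (\<forall>\<phi> i. ell2_nth (blinfun_apply P \<phi>) (\<sigma> i) = blinfun_apply A (ell2_nth \<phi> i)) \<and>
    (\<forall>\<phi> j. j \<notin> range \<sigma> \<longrightarrow> ell2_nth (blinfun_apply P \<phi>) j = 0)"

lemma pushes_exists:
  assumes \<sigma>: "inj \<sigma>" and A: "clin A" "isometric A"
  obtains P where "clin P" "isometric P" "pushes \<sigma> A P"
proof -
  define F where "F j \<phi> = (if j \<in> range \<sigma> then blinfun_apply A (ell2_nth \<phi> (inv \<sigma> j)) else 0)" for j \<phi>
  have add: "F j (\<phi> + \<psi>) = F j \<phi> + F j \<psi>" for j \<phi> \<psi>
    by (simp add: F_def plus_ell2.rep_eq blinfun.add_right)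
  have scale: "F j (c *\<^sub>C \<phi>) = c *\<^sub>C F j \<phi>" for j c \<phi>
    by (simp add: F_def scaleC_ell2.rep_eq clin_scaleC[OF A(1)])
  have sum: "((\<lambda>j. (norm (F j \<phi>))\<^sup>2) has_sum (norm \<phi>)\<^sup>2) UNIV" for \<phi>
  proof -
    have "((\<lambda>j. (norm (F j \<phi>))\<^sup>2) has_sum (norm \<phi>)\<^sup>2) (range \<sigma>)"
      unfolding has_sum_reindex[OF \<sigma>]
      using ell2_norm_has_sum[of \<phi>] A(2) \<sigma> by (simp add: o_def F_def isometric_def)
    then show ?thesis
      by (rule has_sum_cong_neutral[THEN iffD1, rotated 3]) (auto simp: F_def)
  qed
  obtain P where P: "clin P" "isometric P" "\<And>x i. ell2_nth (blinfun_apply P x) i = F i x"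
    using isometric_into_ell2[OF add scale sum] by metis
  have "pushes \<sigma> A P"
    using \<sigma> by (auto simp: pushes_def P(3) F_def)
  then show ?thesis using that P(1,2) by blast
qed

lemma pushes_id: "pushes id id_blinfun id_blinfun"
  by (simp add: pushes_def)

lemma pushes_compose:
  assumes "pushes \<sigma> A P" "pushes \<tau> B Q"
  shows "pushes (\<sigma> \<circ> \<tau>) (A o\<^sub>L B) (P o\<^sub>L Q)"
proof -
  have "ell2_nth (blinfun_apply P (blinfun_apply Q \<phi>)) j = 0" if j: "j \<notin> range (\<sigma> \<circ> \<tau>)" for \<phi> j
  proof (cases "j \<in> range \<sigma>")
    case True
    then obtain i where i: "j = \<sigma> i" by blast
    then have "i \<notin> range \<tau>" using j by auto
    then show ?thesis using assms by (simp add: pushes_def i)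
  qed (use assms in \<open>simp add: pushes_def\<close>)
  then show ?thesis
    using assms by (auto simp: pushes_def intro: inj_compose)
qed

lemma pushes_cinner:
  assumes "pushes \<sigma> A P"
  shows "((\<lambda>i. cinner (ell2_nth \<phi> (\<sigma> i)) (blinfun_apply A (ell2_nth \<psi> i))) has_sum cinner \<phi> (blinfun_apply P \<psi>)) UNIV"
proof -
  have "((\<lambda>j. cinner (ell2_nth \<phi> j) (ell2_nth (blinfun_apply P \<psi>) j)) has_sum cinner \<phi> (blinfun_apply P \<psi>)) (range \<sigma>)"
    by (rule has_sum_cong_neutral[THEN iffD1, rotated 3, OF ell2_cinner_has_sum])
      (use assms in \<open>auto simp: pushes_def\<close>)
  then show ?thesis
    using assms by (subst (asm) has_sum_reindex) (auto simp: pushes_def o_def)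
qed

lemma has_sum_delta: "((\<lambda>x. if x = a then c else 0) has_sum c) UNIV"
proof -
  have "((\<lambda>x. if x = a then c else 0) has_sum c) {a}"
    by (rule has_sum_finiteI) auto
  then show ?thesis
    by (rule has_sum_cong_neutral[THEN iffD1, rotated 3]) auto
qed

text \<open>The claim is that \<open>u\<close> realises \<open>P - c\<close> for
  \<open>\<sigma> = 1\<close> and \<open>C - P\<close> for \<open>\<sigma> = -1\<close>; the
  diagonal mass \<open>2 * \<beta> / (1 + \<sigma> * \<beta>)\<close> is \<open>1 - c\<close> or
  \<open>C - 1\<close>, with \<open>c = (1 - \<beta>) / (1 + \<beta>)\<close> and
  \<open>C = 1 / c\<close>. For one generator and \<open>b = \<beta>\<close> these are nonnegative
  functions with a zero on the unit circle, and \<open>u\<close> is their Fejer-Riesz factor, a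
  multiple of \<open>(1 + \<sigma> z) / (1 - \<beta> z)\<close>. The same combination of the vacuum
  and the conjugated products of \<open>b\<close> works for several generators.\<close>

lemma scalar_dilation_vector:
  fixes b :: "'m::finite \<Rightarrow> complex" and \<beta> \<sigma> :: real
  assumes \<beta>: "0 \<le> \<beta>" "\<beta> < 1" "\<beta>\<^sup>2 = (\<Sum>j\<in>UNIV. (cmod (b j))\<^sup>2)"
    and \<sigma>: "\<sigma> = 1 \<or> \<sigma> = -1"
  obtains u :: "'m list \<Rightarrow> complex"
  where "((\<lambda>\<alpha>. (cmod (u \<alpha>))\<^sup>2) has_sum (2 * \<beta> / (1 + \<sigma> * \<beta>))) UNIV"
    and "\<And>\<gamma>. \<gamma> \<noteq> [] \<Longrightarrow> ((\<lambda>\<alpha>. cnj (u (\<gamma> @ \<alpha>)) * u \<alpha>) has_sum of_real \<sigma> * prod_list (map b \<gamma>)) UNIV"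
proof (cases "\<beta> = 0")
  case True
  then have "\<forall>j. b j = 0" using \<beta>(3) by (simp add: sum_nonneg_eq_0_iff)
  then have "prod_list (map b \<gamma>) = 0" if "\<gamma> \<noteq> []" for \<gamma>
    using that by (cases \<gamma>) auto
  then show ?thesis using that[of "\<lambda>_. 0"] True by simp
next
  case False
  define p where "p \<alpha> = prod_list (map b \<alpha>)" for \<alpha>
  \<comment> \<open>The value of \<open>\<theta>\<close> comes from \<open>1 - \<theta> / (1 -
    \<beta> z) = - \<sigma> \<beta> (1 + \<sigma> z) / (1 - \<beta> z)\<close>, and
    \<open>\<kappa>\<close> scales the off-diagonal entries to \<open>\<sigma>\<close> times the
    products of \<open>b\<close>. As \<open>\<kappa>\<close> vanishes with \<open>\<beta>\<close>,
    the case \<open>\<beta> = 0\<close> was separated.\<close>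
  define \<theta> where "\<theta> = 1 + \<sigma> * \<beta>"
  define \<kappa> where "\<kappa> = \<beta> * (1 + \<sigma> * \<beta>) / (1 - \<sigma> * \<beta>)"
  have pos: "0 < 1 + \<sigma> * \<beta>" "0 < 1 - \<sigma> * \<beta>" "0 < \<beta>" and \<sigma>2: "\<sigma> * \<sigma> = 1" using \<beta> \<sigma> False by auto
  then have \<kappa>: "0 < \<kappa>" by (simp add: \<kappa>_def)
  have fact: "1 - \<beta>\<^sup>2 = (1 + \<sigma> * \<beta>) * (1 - \<sigma> * \<beta>)"
    using \<sigma> by (auto simp: power2_eq_square algebra_simps)
  have \<beta>1: "\<bar>\<beta>\<^sup>2\<bar> < 1" using \<beta>(1,2) by (simp add: power_less_one_iff)
  have "(\<Sum>\<alpha> | length \<alpha> = k. (cmod (p \<alpha>))\<^sup>2) = (\<beta>\<^sup>2) ^ k" for k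
  proof (induction k)
    case (Suc k)
    have "(\<Sum>\<alpha> | length \<alpha> = Suc k. (cmod (p \<alpha>))\<^sup>2) = (\<Sum>\<alpha> | length \<alpha> = k. (cmod (p \<alpha>))\<^sup>2 * (\<Sum>i\<in>UNIV. (cmod (b i))\<^sup>2))"
      by (simp add: sum_words_snoc p_def norm_mult power_mult_distrib sum_distrib_left)
    then show ?case using Suc by (simp add: sum_distrib_right[symmetric] \<beta>(3)[symmetric])
  qed (simp add: p_def)
  then have "(\<lambda>N. \<Sum>\<alpha> | length \<alpha> < N. (cmod (p \<alpha>))\<^sup>2) \<longlonglongrightarrow> 1 / (1 - \<beta>\<^sup>2)"
    using geometric_sums[of "\<beta>\<^sup>2"] \<beta>1 by (simp add: sum_words_less sums_def)
  then have hs: "((\<lambda>\<alpha>. (cmod (p \<alpha>))\<^sup>2) has_sum 1 / (1 - \<beta>\<^sup>2)) UNIV"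
    by (rule has_sum_wordsI[rotated]) simp
  define u where "u \<alpha> = ((if \<alpha> = [] then 1 else 0) - of_real \<theta> * cnj (p \<alpha>)) / of_real (sqrt \<kappa>)" for \<alpha>
  have sqrt_\<kappa>: "complex_of_real (sqrt \<kappa>) * complex_of_real (sqrt \<kappa>) = of_real \<kappa>"
    using \<kappa> by (simp add: of_real_mult[symmetric] del: of_real_mult)
  have "(cmod (u \<alpha>))\<^sup>2 = (\<theta>\<^sup>2 * (cmod (p \<alpha>))\<^sup>2 + (if \<alpha> = [] then 1 - 2 * \<theta> else 0)) * (1 / \<kappa>)" for \<alpha>
  proof (cases "\<alpha> = []")
    case True
    have "u \<alpha> = of_real ((1 - \<theta>) / sqrt \<kappa>)" by (simp add: u_def True p_def)
    then have "(cmod (u \<alpha>))\<^sup>2 = ((1 - \<theta>) / sqrt \<kappa>)\<^sup>2" by (simp only: norm_of_real power2_abs)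
    then show ?thesis using \<kappa> by (simp add: True p_def power_divide power2_diff)
  next
    case False
    then show ?thesis using \<kappa> by (simp add: u_def norm_divide norm_mult power_divide power_mult_distrib)
  qed
  moreover have "((\<lambda>\<alpha>. (\<theta>\<^sup>2 * (cmod (p \<alpha>))\<^sup>2 + (if \<alpha> = [] then 1 - 2 * \<theta> else 0)) * (1 / \<kappa>))
      has_sum (\<theta>\<^sup>2 * (1 / (1 - \<beta>\<^sup>2)) + (1 - 2 * \<theta>)) * (1 / \<kappa>)) UNIV"
    by (intro has_sum_cmult_left has_sum_add has_sum_cmult_right hs has_sum_delta)
  moreover have "(\<theta>\<^sup>2 * (1 / (1 - \<beta>\<^sup>2)) + (1 - 2 * \<theta>)) * (1 / \<kappa>) = 2 * \<beta> / (1 + \<sigma> * \<beta>)"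
  proof -
    have "(p\<^sup>2 * (1 / (p * m)) + (1 - 2 * p)) * (1 / (b * p / m)) = (p + m - 2 * (p * m)) / (b * p)"
      if "p > 0" "m > 0" "b > 0" for p m b :: real
      using that by (simp add: field_simps power2_eq_square)
    from this[OF pos] show ?thesis
      unfolding fact[symmetric] \<theta>_def \<kappa>_def using pos by (simp add: power2_eq_square)
  qed
  ultimately have 1: "((\<lambda>\<alpha>. (cmod (u \<alpha>))\<^sup>2) has_sum (2 * \<beta> / (1 + \<sigma> * \<beta>))) UNIV"
    by simp
  have 2: "((\<lambda>\<alpha>. cnj (u (\<gamma> @ \<alpha>)) * u \<alpha>) has_sum of_real \<sigma> * prod_list (map b \<gamma>)) UNIV" if \<gamma>: "\<gamma> \<noteq> []" for \<gamma>
  proof -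
    have "cnj (u (\<gamma> @ \<alpha>)) * u \<alpha> = (- of_real (\<theta> / \<kappa>) * p \<gamma>) * ((if \<alpha> = [] then 1 else 0) - of_real \<theta> * of_real ((cmod (p \<alpha>))\<^sup>2))" for \<alpha>
    proof -
      have 1: "cnj (u (\<gamma> @ \<alpha>)) = - (of_real \<theta> * (p \<gamma> * p \<alpha>)) / of_real (sqrt \<kappa>)"
        using \<gamma> by (simp add: u_def p_def)
      have 2: "p \<alpha> * ((if \<alpha> = [] then 1 else 0) - of_real \<theta> * cnj (p \<alpha>))
          = (if \<alpha> = [] then 1 else 0) - of_real \<theta> * of_real ((cmod (p \<alpha>))\<^sup>2)"
        unfolding complex_norm_square by (auto simp: p_def right_diff_distrib mult.left_commute)
      have "cnj (u (\<gamma> @ \<alpha>)) * u \<alpha> = (- (of_real \<theta> / (of_real (sqrt \<kappa>) * of_real (sqrt \<kappa>))) * p \<gamma>)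
          * (p \<alpha> * ((if \<alpha> = [] then 1 else 0) - of_real \<theta> * cnj (p \<alpha>)))"
        unfolding 1 by (simp add: u_def)
      then show ?thesis unfolding 2 sqrt_\<kappa> by simp
    qed
    moreover have "((\<lambda>\<alpha>. (- of_real (\<theta> / \<kappa>) * p \<gamma>) * ((if \<alpha> = [] then 1 else 0) - of_real \<theta> * of_real ((cmod (p \<alpha>))\<^sup>2)))
       has_sum (- of_real (\<theta> / \<kappa>) * p \<gamma>) * (1 - of_real \<theta> * of_real (1 / (1 - \<beta>\<^sup>2)))) UNIV"
      by (intro has_sum_cmult_right has_sum_diff has_sum_delta has_sum_of_real hs)
    moreover have "- (\<theta> / \<kappa>) * (1 - \<theta> * (1 / (1 - \<beta>\<^sup>2))) = \<sigma>"
    proof -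
      have "- (p / (b * p / m)) * (1 - p * (1 / (p * m))) = (1 - m) / b"
        if "p > 0" "m > 0" "b > 0" for p m b :: real
        using that by (simp add: field_simps)
      from this[OF pos] show ?thesis
        unfolding fact[symmetric] \<theta>_def \<kappa>_def using pos by simp
    qed
    then have \<sigma>': "complex_of_real \<sigma> = of_real (- (\<theta> / \<kappa>) * (1 - \<theta> * (1 / (1 - \<beta>\<^sup>2))))"
      by simp
    have "(- of_real (\<theta> / \<kappa>) * p \<gamma>) * (1 - of_real \<theta> * of_real (1 / (1 - \<beta>\<^sup>2))) = of_real \<sigma> * prod_list (map b \<gamma>)"
      unfolding p_def \<sigma>' by (simp add: mult_ac)
    ultimately show ?thesis by (simp only:)
  qed
  show ?thesis by (rule that[OF 1 2])
qed

text \<open>The sequence \<open>r ^ k\<close> is the case of one generator with \<open>b = r\<close>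
  and \<open>\<sigma> = 1\<close>: it is the pairing of \<open>u\<close> with its
  \<open>k\<close>-fold shift, where \<open>u\<close> has squared norm
  \<open>q = 2 * r / (1 + r) < 1\<close>. Tensoring the normalised \<open>u\<close> with
  \<open>J\<close> and the shift with \<open>V\<close> therefore moves the factor \<open>q\<close>
  into the parameter. Lists over \<open>unit\<close> play the natural numbers; every letter of
  \<open>\<alpha>\<close> shifts the same index, so only the length of \<open>\<alpha>\<close> is
  seen.\<close>

lemma dilation_slack:
  fixes J :: "'h::complex_hilbert \<Rightarrow>\<^sub>L 'g::complex_hilbert"
  assumes dil: "dilation J V \<rho> T" and r: "0 < r" "r < 1"
  obtains J' :: "'h \<Rightarrow>\<^sub>L (unit list, 'g) ell2" and V'
  where "dilation J' V' (\<rho> * (2 * r / (1 + r))) (\<lambda>i. r *\<^sub>R T i)"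
proof -
  have J: "clin J" "isometric J" and V: "isometric_tuple V"
    and T: "\<And>\<alpha> h k. \<alpha> \<noteq> [] \<Longrightarrow> cinner h (blinfun_apply (word T \<alpha>) k)
      = of_real \<rho> * cinner (blinfun_apply J h) (blinfun_apply (word V \<alpha>) (blinfun_apply J k))"
    using dil by (auto simp: dilation_def)
  define q where "q = 2 * r / (1 + r)"
  have q: "0 < q" using r by (simp add: q_def)
  obtain u :: "unit list \<Rightarrow> complex" where
    u1: "((\<lambda>\<alpha>. (cmod (u \<alpha>))\<^sup>2) has_sum (2 * r / (1 + 1 * r))) UNIV" and
    u2: "\<And>\<gamma>. \<gamma> \<noteq> [] \<Longrightarrow> ((\<lambda>\<alpha>. cnj (u (\<gamma> @ \<alpha>)) * u \<alpha>) has_sum of_real 1 * prod_list (map (\<lambda>_. of_real r) \<gamma>)) UNIV"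
    using scalar_dilation_vector[of r "\<lambda>_ :: unit. of_real r" 1] r by auto
  define F where "F \<delta> h = (u \<delta> / of_real (sqrt q)) *\<^sub>C blinfun_apply J h" for \<delta> h
  have "((\<lambda>\<delta>. (norm (F \<delta> h))\<^sup>2) has_sum (norm h)\<^sup>2) UNIV" for h
  proof -
    have "((\<lambda>\<delta>. (cmod (u \<delta>))\<^sup>2 * ((norm h)\<^sup>2 / q)) has_sum q * ((norm h)\<^sup>2 / q)) UNIV"
      by (intro has_sum_cmult_left) (use u1 in \<open>simp add: q_def\<close>)
    moreover have "(norm (F \<delta> h))\<^sup>2 = (cmod (u \<delta>))\<^sup>2 * ((norm h)\<^sup>2 / q)" for \<delta>
      using J(2) q by (simp add: F_def norm_scaleC norm_divide power_mult_distrib power_divide isometric_def)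
    ultimately show ?thesis using q by simp
  qed
  then obtain J' :: "'h \<Rightarrow>\<^sub>L (unit list, 'g) ell2" where J': "clin J'" "isometric J'"
    and nthJ': "\<And>x i. ell2_nth (blinfun_apply J' x) i = F i x"
    using isometric_into_ell2[of F]
    by (auto simp: F_def blinfun.add_right scaleC_add_right clin_scaleC[OF J(1)] scaleC_scaleC mult.commute)
  have "\<exists>P. clin P \<and> isometric P \<and> pushes ((#) ()) (V i) P" for i
    by (rule pushes_exists[of "(#) ()" "V i"]) (use V in \<open>auto simp: isometric_tuple_def\<close>)
  then obtain V' where V': "\<And>i. clin (V' i)" "\<And>i. isometric (V' i)" "\<And>i. pushes ((#) ()) (V i) (V' i)"
    by metis
  have "cinner (blinfun_apply (V' i) \<phi>) (blinfun_apply (V' j) \<psi>) = 0" if "i \<noteq> j" for i j \<phi> \<psi>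
  proof -
    have "((\<lambda>_. 0) has_sum cinner (blinfun_apply (V' i) \<phi>) (blinfun_apply (V' j) \<psi>)) (UNIV :: unit list set)"
      using pushes_cinner[OF V'(3)[of j], of "blinfun_apply (V' i) \<phi>" \<psi>] V'(3)[of i] V that
      by (simp add: pushes_def isometric_tuple_def)
    then show ?thesis using has_sum_unique has_sum_0_simp by blast
  qed
  then have tuple: "isometric_tuple V'" using V' by (auto simp: isometric_tuple_def)
  have word': "pushes ((@) (replicate (length \<alpha>) ())) (word V \<alpha>) (word V' \<alpha>)" for \<alpha>
  proof (induction \<alpha>)
    case Nil
    then show ?case using pushes_id by (simp add: id_def)
  next
    case (Cons i \<alpha>)
    then show ?case using pushes_compose[OF V'(3)[of i] Cons] by (simp add: o_def)
  qed
  have "cinner h (blinfun_apply (word (\<lambda>i. r *\<^sub>R T i) \<alpha>) k)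
      = of_real (\<rho> * q) * cinner (blinfun_apply J' h) (blinfun_apply (word V' \<alpha>) (blinfun_apply J' k))"
    if \<alpha>: "\<alpha> \<noteq> []" for \<alpha> h k
  proof -
    let ?z = "cinner (blinfun_apply J h) (blinfun_apply (word V \<alpha>) (blinfun_apply J k))"
    let ?\<gamma> = "replicate (length \<alpha>) ()"
    have sq: "complex_of_real (sqrt q) * complex_of_real (sqrt q) = of_real q"
      using q by (simp add: of_real_mult[symmetric] del: of_real_mult)
    have clinV: "clin (word V \<alpha>)" using V by (auto simp: isometric_tuple_def)
    have "cinner (F (?\<gamma> @ \<delta>) h) (blinfun_apply (word V \<alpha>) (F \<delta> k)) = cnj (u (?\<gamma> @ \<delta>)) * u \<delta> * (?z / of_real q)" for \<delta>
      by (simp add: F_def clin_scaleC[OF clinV] cinner_scaleC_left cinner_scaleC_right sq[symmetric])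
    then have "((\<lambda>\<delta>. cnj (u (?\<gamma> @ \<delta>)) * u \<delta> * (?z / of_real q)) has_sum
        cinner (blinfun_apply J' h) (blinfun_apply (word V' \<alpha>) (blinfun_apply J' k))) UNIV"
      using pushes_cinner[OF word'[of \<alpha>], of "blinfun_apply J' h" "blinfun_apply J' k"] by (simp add: nthJ')
    moreover have "((\<lambda>\<delta>. cnj (u (?\<gamma> @ \<delta>)) * u \<delta> * (?z / of_real q)) has_sum
        of_real r ^ length \<alpha> * (?z / of_real q)) UNIV"
      using has_sum_cmult_left[OF u2[of ?\<gamma>], of "?z / of_real q"] \<alpha> by (simp add: map_replicate_const prod_list_replicate)
    ultimately have "cinner (blinfun_apply J' h) (blinfun_apply (word V' \<alpha>) (blinfun_apply J' k)) = of_real r ^ length \<alpha> * (?z / of_real q)"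
      by (rule has_sum_unique)
    then show ?thesis
      using q by (simp add: word_scaleR blinfun.scaleR_left T[OF \<alpha>])
  qed
  then have "dilation J' V' (\<rho> * q) (\<lambda>i. r *\<^sub>R T i)"
    using J' tuple by (simp add: dilation_def)
  then show ?thesis using that by (simp add: q_def)
qed

section \<open>Gram embeddings\<close>

lift_definition single :: "'i \<Rightarrow> 'h::real_normed_vector \<Rightarrow> ('i, 'h) ell2"
  is "\<lambda>i x j. if j = i then x else 0"
proof -
  fix i :: 'i and x :: 'h
  have "((\<lambda>j. if j = i then (norm x)\<^sup>2 else 0) has_sum (norm x)\<^sup>2) UNIV"
    by (rule has_sum_delta)
  then have "(\<lambda>j. if j = i then (norm x)\<^sup>2 else 0) summable_on UNIV"
    by (rule has_sum_imp_summable)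
  then show "(\<lambda>j. (norm (if j = i then x else 0))\<^sup>2) summable_on UNIV"
    by (simp add: if_distrib[of norm] if_distrib[of "\<lambda>x. x\<^sup>2"] cong: if_cong)
qed

lemma single_add: "single i (x + y) = single i x + single i y"
  by transfer auto

lemma single_scaleC: "single i (c *\<^sub>C x) = c *\<^sub>C single i (x::'h::complex_hilbert)"
  by transfer auto

text \<open>
  The synthesis operator \<open>L\<close> of the (damped) family \<open>C\<close> has a polar decomposition: \<open>R = |L|\<close>
  acts on \<open>ell2\<close> and yields the same inner products as \<open>L\<close>.
\<close>

lemma gram_embedding:
  fixes C :: "'i::countable \<Rightarrow> 'h::complex_hilbert \<Rightarrow> 'e::complex_hilbert"
  assumes add: "\<And>i x y. C i (x + y) = C i x + C i y"
    and scale: "\<And>i c x. C i (c *\<^sub>C x) = c *\<^sub>C C i x"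
    and bound: "\<And>i x. norm (C i x) \<le> norm x"
  obtains N :: "'i \<Rightarrow> 'h \<Rightarrow> ('i, 'h) ell2"
  where "\<And>i x y. N i (x + y) = N i x + N i y" "\<And>i c x. N i (c *\<^sub>C x) = c *\<^sub>C N i x"
    "\<And>i j x y. cinner (N i x) (N j y) = cinner (C i x) (C j y)"
proof -
  have scaleR: "C i (r *\<^sub>R x) = r *\<^sub>R C i x" for i r x
    using scale[of i "of_real r" x] by (simp add: scaleC_of_real)
  have zero: "C i 0 = 0" for i using add[of i 0 0] by simp
  \<comment> \<open>Summable weights with total at most 1 make the synthesis operator a contraction,
    although the \<open>C i\<close> are only bounded one by one. They cancel in the end, since
    \<open>N i\<close> divides by \<open>w i\<close>.\<close>
  define w where "w i = (1 / 2 :: real) ^ Suc (to_nat i)" for i :: 'i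
  have w: "0 < w i" for i by (simp add: w_def)
  have hs: "((\<lambda>n. (1 / 2 :: real) ^ Suc n) has_sum 1) UNIV"
    by (rule sums_nonneg_imp_has_sum) (use power_half_series in auto)
  have "(\<lambda>n. (1 / 2 :: real) ^ Suc n) summable_on range (to_nat :: 'i \<Rightarrow> nat)"
    by (rule summable_on_subset_banach[OF has_sum_imp_summable[OF hs]]) simp
  then obtain W where W: "((\<lambda>n. (1 / 2 :: real) ^ Suc n) has_sum W) (range (to_nat :: 'i \<Rightarrow> nat))"
    by (auto simp: summable_on_def)
  have W1: "W \<le> 1" by (rule has_sum_mono2[OF W hs]) auto
  have w_sum: "(w has_sum W) UNIV"
    using W unfolding has_sum_reindex[OF inj_to_nat] by (simp add: o_def w_def[abs_def])
  define f where "f \<phi> i = w i *\<^sub>R C i (ell2_nth \<phi> i)" for \<phi> i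
  have f_le: "norm (f \<phi> i) \<le> w i * norm \<phi>" for \<phi> i
    using order_trans[OF bound norm_ell2_nth_le] w[of i] by (simp add: f_def)
  have dom: "((\<lambda>i. w i * norm \<phi>) has_sum W * norm \<phi>) UNIV" for \<phi> :: "('i, 'h) ell2"
    by (rule has_sum_cmult_left[OF w_sum])
  have abs: "(\<lambda>i. norm (f \<phi> i)) summable_on UNIV" for \<phi>
    by (rule Infinite_Sum.abs_summable_on_comparison_test'[OF has_sum_imp_summable[OF dom[of \<phi>]]]) (rule f_le)
  define l where "l \<phi> = infsum (f \<phi>) UNIV" for \<phi>
  have l: "(f \<phi> has_sum l \<phi>) UNIV" for \<phi>
    unfolding l_def by (rule has_sum_infsum[OF Infinite_Sum.abs_summable_summable[OF abs]])
  have l_eq: "l \<phi> = s" if "(f \<phi> has_sum s) UNIV" for \<phi> s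
    using has_sum_unique[OF l that] .
  have l_add: "l (\<phi> + \<psi>) = l \<phi> + l \<psi>" for \<phi> \<psi>
    by (rule l_eq) (use has_sum_add[OF l[of \<phi>] l[of \<psi>]] in
      \<open>simp add: f_def[abs_def] plus_ell2.rep_eq add scaleR_add_right\<close>)
  have l_scaleC: "l (c *\<^sub>C \<phi>) = c *\<^sub>C l \<phi>" for c \<phi>
  proof (rule l_eq)
    have "((\<lambda>i. blinfun_apply (scalar_op c) (f \<phi> i)) has_sum blinfun_apply (scalar_op c) (l \<phi>)) UNIV"
      by (rule has_sum_bounded_linear[OF blinfun.bounded_linear_right l])
    then show "(f (c *\<^sub>C \<phi>) has_sum c *\<^sub>C l \<phi>) UNIV"
      by (simp add: f_def[abs_def] scaleC_ell2.rep_eq scale scaleC_scaleR_commute)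
  qed
  have l_norm: "norm (l \<phi>) \<le> norm \<phi>" for \<phi>
  proof -
    have "norm (l \<phi>) \<le> (\<Sum>\<^sub>\<infinity>i. norm (f \<phi> i))"
      unfolding l_def by (rule norm_infsum_bound[OF abs])
    also have "\<dots> \<le> W * norm \<phi>"
      by (rule has_sum_mono[OF has_sum_infsum[OF abs] dom]) (rule f_le)
    also have "\<dots> \<le> 1 * norm \<phi>" by (rule mult_right_mono[OF W1]) simp
    finally show ?thesis by simp
  qed
  have "bounded_linear l"
    by (rule bounded_linear_intro[where K = 1])
      (simp_all add: l_add l_norm l_scaleC scaleC_of_real[symmetric])
  then obtain L where L: "\<And>\<phi>. blinfun_apply L \<phi> = l \<phi>"
    using bounded_linear_Blinfun_apply by metis
  have clinL: "clin L" by (simp add: clin_def L l_scaleC)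
  \<comment> \<open>With this \<open>B\<close>, \<open>blinfun_sqrt\<close> returns the modulus of
    \<open>L\<close>; the required \<open>norm B \<le> 1\<close> holds because \<open>L\<close> is a
    contraction.\<close>
  define B where "B = id_blinfun - (adj L o\<^sub>L L)"
  have B: "blinfun_apply B \<phi> = \<phi> - blinfun_apply (adj L) (l \<phi>)" for \<phi>
    by (simp add: B_def blinfun.diff_left L)
  have "norm L \<le> 1" by (rule norm_blinfun_bound) (simp_all add: L l_norm)
  then have adjL: "norm (blinfun_apply (adj L) y) \<le> norm y" for y
    by (rule order_trans[OF norm_adj_le[OF clinL] mult_left_le_one_le, rotated -1]) auto
  have "norm (blinfun_apply B \<phi>) \<le> 1 * norm \<phi>" for \<phi>
  proof -
    have "(norm (blinfun_apply B \<phi>))\<^sup>2 = (norm \<phi>)\<^sup>2 - 2 * (norm (l \<phi>))\<^sup>2 + (norm (blinfun_apply (adj L) (l \<phi>)))\<^sup>2"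
      unfolding B norm_diff_sq cinner_adj_right[OF clinL] L by simp
    also have "\<dots> \<le> (norm \<phi>)\<^sup>2"
      using power_mono[OF adjL norm_ge_zero, of "l \<phi>" 2] zero_le_power2[of "norm (l \<phi>)"] by linarith
    finally show ?thesis by (simp add: power2_le_iff_abs_le)
  qed
  then have nB: "norm B \<le> 1" by (intro norm_blinfun_bound) auto
  have clinB: "clin B" unfolding B_def by (intro clin_diff clin_id clin_compose clin_adj clinL)
  have saB: "cinner (blinfun_apply B \<phi>) \<psi> = cinner \<phi> (blinfun_apply B \<psi>)" for \<phi> \<psi>
    by (simp add: B cinner_diff_left cinner_diff_right cinner_adj_right[OF clinL] cinner_adj_left[OF clinL] L)
  obtain R where R: "clin R" "\<And>\<phi> \<psi>. cinner (blinfun_apply R \<phi>) \<psi> = cinner \<phi> (blinfun_apply R \<psi>)"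
    "R o\<^sub>L R = id_blinfun - B"
    using blinfun_sqrt[OF clinB nB saB] by metis
  have RR: "blinfun_apply R (blinfun_apply R \<psi>) = blinfun_apply (adj L) (l \<psi>)" for \<psi>
    using arg_cong[OF R(3), of "\<lambda>A. blinfun_apply A \<psi>"] by (simp add: blinfun.diff_left B)
  have RL: "cinner (blinfun_apply R \<phi>) (blinfun_apply R \<psi>) = cinner (l \<phi>) (l \<psi>)" for \<phi> \<psi>
    unfolding R(2) RR cinner_adj_right[OF clinL] L ..
  have l_single: "l (single i x) = w i *\<^sub>R C i x" for i x
  proof (rule l_eq)
    have "f (single i x) j = (if j = i then w i *\<^sub>R C i x else 0)" for j
      by (simp add: f_def single.rep_eq zero)
    then show "(f (single i x) has_sum w i *\<^sub>R C i x) UNIV"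
      using has_sum_delta[of i "w i *\<^sub>R C i x"] by presburger
  qed
  define N where "N i x = (1 / w i) *\<^sub>R blinfun_apply R (single i x)" for i x
  show thesis
  proof (rule that[of N])
    show "N i (x + y) = N i x + N i y" for i x y
      by (simp add: N_def single_add blinfun.add_right scaleR_add_right)
    show "N i (c *\<^sub>C x) = c *\<^sub>C N i x" for i c x
      by (simp add: N_def single_scaleC clin_scaleC[OF R(1)] scaleC_scaleR_commute)
    show "cinner (N i x) (N j y) = cinner (C i x) (C j y)" for i j x y
      using w[of i] w[of j] by (simp add: N_def RL l_single)
  qed
qed

text \<open>Let \<open>J h\<close> be the sum of \<open>e \<alpha> \<otimes> C \<alpha> h\<close>
  and let creation operators act on the first factor: pairing \<open>J h\<close> with the
  \<open>\<gamma>\<close>-translate of \<open>J k\<close> gives the sum in the hypothesis. Only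
  inner products of the vectors \<open>C \<alpha> h\<close> enter, so \<open>gram_embedding\<close>
  may exchange \<open>'e\<close> for a space built from \<open>'h\<close>.\<close>

lemma class_C_from_coefficients:
  fixes C :: "'m::finite list \<Rightarrow> 'h::complex_hilbert \<Rightarrow> 'e::complex_hilbert"
    and X :: "'m \<Rightarrow> 'h \<Rightarrow>\<^sub>L 'h"
  assumes add: "\<And>\<alpha> x y. C \<alpha> (x + y) = C \<alpha> x + C \<alpha> y"
    and scale: "\<And>\<alpha> c x. C \<alpha> (c *\<^sub>C x) = c *\<^sub>C C \<alpha> x"
    and sum: "\<And>x. ((\<lambda>\<alpha>. (norm (C \<alpha> x))\<^sup>2) has_sum (norm x)\<^sup>2) UNIV"
    and ker: "\<And>\<gamma> h k. \<gamma> \<noteq> [] \<Longrightarrow>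
      ((\<lambda>\<alpha>. of_real \<rho> * cinner (C (\<gamma> @ \<alpha>) h) (C \<alpha> k)) has_sum cinner h (blinfun_apply (word X \<gamma>) k)) UNIV"
  shows "class_C TYPE(('m list, 'h) ell2) \<rho> X"
proof -
  have bound: "norm (C \<alpha> x) \<le> norm x" for \<alpha> x
    using finite_sum_le_has_sum[OF sum[of x], of "{\<alpha>}"] by (simp add: power2_le_iff_abs_le)
  obtain N :: "'m list \<Rightarrow> 'h \<Rightarrow> ('m list, 'h) ell2"
    where N: "\<And>i x y. N i (x + y) = N i x + N i y" "\<And>i c x. N i (c *\<^sub>C x) = c *\<^sub>C N i x"
    and gram: "\<And>i j x y. cinner (N i x) (N j y) = cinner (C i x) (C j y)"
    by (rule gram_embedding[OF add scale bound], rule that)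
  have norm_N: "(norm (N \<alpha> x))\<^sup>2 = (norm (C \<alpha> x))\<^sup>2" for \<alpha> x
    unfolding Re_cinner_self[symmetric] gram ..
  \<comment> \<open>After the exchange the vector \<open>J h\<close> is indexed by pairs of words.
    Both index sets are countably infinite, and a bijection folds the pairs back into the prescribed
    index type \<open>'m list\<close>.\<close>
  have "infinite (UNIV :: 'm list set)" "infinite (UNIV :: ('m list \<times> 'm list) set)"
    by (simp_all add: infinite_UNIV_listI finite_prod)
  then have "bij_betw (to_nat_on (UNIV :: 'm list set)) UNIV UNIV"
    "bij_betw (to_nat_on (UNIV :: ('m list \<times> 'm list) set)) UNIV UNIV"
    by (auto intro!: to_nat_on_infinite)
  then obtain \<pi> :: "'m list \<Rightarrow> 'm list \<times> 'm list" where \<pi>: "bij \<pi>"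
    using bij_betw_trans bij_betw_inv_into by blast
  have inv_\<pi>: "inv \<pi> (\<pi> \<omega>) = \<omega>" "\<pi> (inv \<pi> p) = p" for \<omega> p
    using \<pi> by (auto simp: bij_def surj_f_inv_f)
  define F where "F \<omega> h = ell2_nth (N (fst (\<pi> \<omega>)) h) (snd (\<pi> \<omega>))" for \<omega> h
  have F_sum: "((\<lambda>\<omega>. (norm (F \<omega> h))\<^sup>2) has_sum (norm h)\<^sup>2) UNIV" for h
  proof -
    let ?g = "\<lambda>p. (norm (ell2_nth (N (fst p) h) (snd p)))\<^sup>2"
    have inner: "((\<lambda>\<delta>. ?g (\<alpha>, \<delta>)) has_sum (norm (C \<alpha> h))\<^sup>2) UNIV" for \<alpha>
      using ell2_norm_has_sum[of "N \<alpha> h"] by (simp add: norm_N)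
    have "?g summable_on (UNIV \<times> UNIV)"
      by (rule summable_on_SigmaI[OF inner has_sum_imp_summable[OF sum[of h]]]) simp
    then have "(?g has_sum (norm h)\<^sup>2) (UNIV \<times> UNIV)"
      by (rule has_sum_SigmaI[OF inner sum[of h]])
    then show ?thesis
      using has_sum_reindex_bij_betw[OF \<pi>, of ?g] by (simp add: F_def)
  qed
  have F_lin: "F \<omega> (x + y) = F \<omega> x + F \<omega> y" "F \<omega> (c *\<^sub>C x) = c *\<^sub>C F \<omega> x" for \<omega> x y c
    by (simp_all add: F_def N plus_ell2.rep_eq scaleC_ell2.rep_eq)
  obtain J :: "'h \<Rightarrow>\<^sub>L ('m list, 'h) ell2" where J: "clin J" "isometric J"
    and nthJ: "\<And>x i. ell2_nth (blinfun_apply J x) i = F i x"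
    by (rule isometric_into_ell2[OF F_lin F_sum], rule that)
  define \<sigma> where "\<sigma> \<gamma> \<omega> = inv \<pi> (\<gamma> @ fst (\<pi> \<omega>), snd (\<pi> \<omega>))" for \<gamma> \<omega>
  have \<pi>\<sigma>: "\<pi> (\<sigma> \<gamma> \<omega>) = (\<gamma> @ fst (\<pi> \<omega>), snd (\<pi> \<omega>))" for \<gamma> \<omega>
    by (simp add: \<sigma>_def inv_\<pi>)
  have inj: "inj (\<sigma> \<gamma>)" for \<gamma>
  proof (rule injI)
    fix x y assume "\<sigma> \<gamma> x = \<sigma> \<gamma> y"
    then have "\<pi> (\<sigma> \<gamma> x) = \<pi> (\<sigma> \<gamma> y)" by simp
    then have "\<pi> x = \<pi> y" by (simp add: \<pi>\<sigma> prod_eq_iff)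
    then show "x = y" using \<pi> by (auto simp: bij_def dest: injD)
  qed
  have "\<exists>P. clin P \<and> isometric P \<and> pushes (\<sigma> [i]) (id_blinfun :: 'h \<Rightarrow>\<^sub>L 'h) P" for i
    by (rule pushes_exists[OF inj[of "[i]"] clin_id]) (auto simp: isometric_def)
  then obtain V where V: "\<And>i. clin (V i)" "\<And>i. isometric (V i)" "\<And>i. pushes (\<sigma> [i]) (id_blinfun :: 'h \<Rightarrow>\<^sub>L 'h) (V i)"
    by metis
  have "cinner (blinfun_apply (V i) \<phi>) (blinfun_apply (V j) \<psi>) = 0" if "i \<noteq> j" for i j \<phi> \<psi>
  proof -
    have "\<sigma> [j] \<omega> \<notin> range (\<sigma> [i])" for \<omega>
    proof
      assume "\<sigma> [j] \<omega> \<in> range (\<sigma> [i])"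
      then obtain \<omega>' where "\<pi> (\<sigma> [j] \<omega>) = \<pi> (\<sigma> [i] \<omega>')" by auto
      then show False using that by (simp add: \<pi>\<sigma>)
    qed
    then have "((\<lambda>_. 0) has_sum cinner (blinfun_apply (V i) \<phi>) (blinfun_apply (V j) \<psi>)) (UNIV :: 'm list set)"
      using pushes_cinner[OF V(3)[of j], of "blinfun_apply (V i) \<phi>" \<psi>] V(3)[of i]
      by (simp add: pushes_def)
    then show ?thesis using has_sum_unique has_sum_0_simp by blast
  qed
  then have tuple: "isometric_tuple V" using V by (auto simp: isometric_tuple_def)
  have word: "pushes (\<sigma> \<gamma>) id_blinfun (word V \<gamma>)" for \<gamma>
  proof (induction \<gamma>)
    case Nil
    have "\<sigma> [] = id" by (simp add: \<sigma>_def inv_\<pi> fun_eq_iff)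
    then show ?case using pushes_id by (simp only: word.simps)
  next
    case (Cons i \<gamma>)
    have "\<sigma> [i] \<circ> \<sigma> \<gamma> = \<sigma> (i # \<gamma>)"
      by (rule ext) (simp add: \<sigma>_def inv_\<pi>)
    moreover have "id_blinfun o\<^sub>L id_blinfun = (id_blinfun :: 'h \<Rightarrow>\<^sub>L 'h)"
      by (rule blinfun_eqI) simp
    ultimately show ?case using pushes_compose[OF V(3)[of i] Cons] by simp
  qed
  have "cinner h (blinfun_apply (word X \<gamma>) k)
      = of_real \<rho> * cinner (blinfun_apply J h) (blinfun_apply (word V \<gamma>) (blinfun_apply J k))"
    if \<gamma>: "\<gamma> \<noteq> []" for \<gamma> h k
  proof -
    let ?z = "cinner (blinfun_apply J h) (blinfun_apply (word V \<gamma>) (blinfun_apply J k))"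
    let ?g = "\<lambda>p. cinner (ell2_nth (N (\<gamma> @ fst p) h) (snd p)) (ell2_nth (N (fst p) k) (snd p))"
    have "((\<lambda>\<omega>. ?g (\<pi> \<omega>)) has_sum ?z) UNIV"
      using pushes_cinner[OF word[of \<gamma>], of "blinfun_apply J h" "blinfun_apply J k"]
      by (simp add: nthJ F_def \<pi>\<sigma>)
    then have "(?g has_sum ?z) (UNIV \<times> UNIV)"
      using has_sum_reindex_bij_betw[OF \<pi>, of ?g] by simp
    moreover have "((\<lambda>\<delta>. ?g (\<alpha>, \<delta>)) has_sum cinner (C (\<gamma> @ \<alpha>) h) (C \<alpha> k)) UNIV" for \<alpha>
      using ell2_cinner_has_sum[of "N (\<gamma> @ \<alpha>) h" "N \<alpha> k"] by (simp add: gram)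
    ultimately have "((\<lambda>\<alpha>. cinner (C (\<gamma> @ \<alpha>) h) (C \<alpha> k)) has_sum ?z) UNIV"
      by (rule has_sum_SigmaD)
    then have "((\<lambda>\<alpha>. of_real \<rho> * cinner (C (\<gamma> @ \<alpha>) h) (C \<alpha> k)) has_sum of_real \<rho> * ?z) UNIV"
      by (rule has_sum_cmult_right)
    with ker[OF \<gamma>] show ?thesis by (rule has_sum_unique)
  qed
  then have "dilation J V \<rho> X"
    using J tuple by (simp add: dilation_def)
  then show ?thesis unfolding class_C_iff_dilation by blast
qed

section \<open>The functional calculus\<close>

instantiation prod :: (complex_hilbert, complex_hilbert) complex_hilbert
begin

definition scaleC_prod :: "complex \<Rightarrow> 'a \<times> 'b \<Rightarrow> 'a \<times> 'b" where
  "scaleC_prod c x = (c *\<^sub>C fst x, c *\<^sub>C snd x)"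

definition cinner_prod :: "'a \<times> 'b \<Rightarrow> 'a \<times> 'b \<Rightarrow> complex" where
  "cinner_prod x y = cinner (fst x) (fst y) + cinner (snd x) (snd y)"

instance
proof
  fix x y z :: "'a \<times> 'b" and c d :: complex and r :: real
  show "c *\<^sub>C (x + y) = c *\<^sub>C x + c *\<^sub>C y" by (simp add: scaleC_prod_def scaleC_add_right)
  show "(c + d) *\<^sub>C x = c *\<^sub>C x + d *\<^sub>C x" by (simp add: scaleC_prod_def scaleC_add_left)
  show "c *\<^sub>C d *\<^sub>C x = (c * d) *\<^sub>C x" by (simp add: scaleC_prod_def scaleC_scaleC)
  show "complex_of_real r *\<^sub>C x = r *\<^sub>R x" by (simp add: scaleC_prod_def scaleC_of_real prod_eq_iff)
  show "cinner x y = cnj (cinner y x)" by (simp add: cinner_prod_def cinner_commute[symmetric])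
  show "cinner (x + y) z = cinner x z + cinner y z" by (simp add: cinner_prod_def cinner_add_left)
  show "cinner (c *\<^sub>C x) y = cnj c * cinner x y"
    by (simp add: cinner_prod_def scaleC_prod_def cinner_scaleC_left distrib_left)
  show "cinner x x = complex_of_real ((norm x)\<^sup>2)"
    by (simp add: cinner_prod_def norm_sq_cinner norm_prod_def)
qed

end

lemma cinner_sqrt_scaleR:
  assumes "0 \<le> d"
  shows "cinner (sqrt d *\<^sub>R x) (sqrt d *\<^sub>R y) = of_real d * cinner x (y::'a::complex_hilbert)"
proof -
  have "complex_of_real (sqrt d) * complex_of_real (sqrt d) = of_real d"
    using assms by (simp add: of_real_mult[symmetric] del: of_real_mult)
  then show ?thesis by (simp add: mult.assoc[symmetric])
qed

lemma bounded_linear_cinner_apply: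
  "bounded_linear (\<lambda>B. cinner p (blinfun_apply Q (blinfun_apply B q)))"
  by (intro bounded_linear_compose[OF bounded_bilinear.bounded_linear_right[OF bounded_bilinear_cinner]]
      bounded_linear_compose[OF blinfun.bounded_linear_right] blinfun.bounded_linear_left)

text \<open>The kernel with diagonal \<open>\<rho>'\<close> and entries
  \<open>word X \<gamma>\<close> splits into \<open>\<rho>\<close> times the Poisson kernel of
  \<open>Z\<close>, \<open>\<mu>\<close> times the scalar kernel of
  \<open>scalar_dilation_vector\<close>, and a multiple \<open>\<nu>\<close> of the identity. The
  sign \<open>\<sigma>\<close> absorbs that of \<open>1 - \<rho>\<close>, so that
  \<open>\<mu>\<close> is nonnegative; the condition on \<open>\<rho>'\<close> states that the
  diagonal mass left for \<open>\<nu>\<close> is nonnegative.\<close>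

lemma class_C_of_row_contraction:
  fixes J :: "'h::complex_hilbert \<Rightarrow>\<^sub>L 'g::complex_hilbert"
    and Z :: "'m::finite \<Rightarrow> 'g \<Rightarrow>\<^sub>L 'g" and X :: "'m \<Rightarrow> 'h \<Rightarrow>\<^sub>L 'h" and b :: "'m \<Rightarrow> complex"
  assumes J: "clin J" "isometric J" and Z: "\<And>j. clin (Z j)" and c: "0 \<le> c" "c < 1"
    and row: "\<And>h. (\<Sum>j\<in>UNIV. (norm (blinfun_apply (adj (Z j)) h))\<^sup>2) \<le> c * (norm h)\<^sup>2"
    and \<beta>: "0 \<le> \<beta>" "\<beta> < 1" "\<beta>\<^sup>2 = (\<Sum>j\<in>UNIV. (cmod (b j))\<^sup>2)"
    and \<sigma>: "\<sigma> = 1 \<or> \<sigma> = -1" and \<mu>: "0 \<le> \<mu>" "\<mu> * \<sigma> = 1 - \<rho>"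
    and \<rho>: "0 < \<rho>" "\<rho> + \<mu> * (2 * \<beta> / (1 + \<sigma> * \<beta>)) \<le> \<rho>'"
    and X: "\<And>\<gamma> h k. \<gamma> \<noteq> [] \<Longrightarrow> cinner h (blinfun_apply (word X \<gamma>) k)
      = of_real \<rho> * cinner (blinfun_apply J h) (blinfun_apply (word Z \<gamma>) (blinfun_apply J k))
        + of_real (1 - \<rho>) * prod_list (map b \<gamma>) * cinner h k"
  shows "class_C TYPE(('m list, 'h) ell2) \<rho>' X"
proof -
  obtain D :: "'g \<Rightarrow>\<^sub>L 'g" where D: "clin D"
    and hsD: "\<And>h. ((\<lambda>\<alpha>. (norm (blinfun_apply D (blinfun_apply (adj (word Z \<alpha>)) h)))\<^sup>2) has_sum (norm h)\<^sup>2) UNIV"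
    by (rule poisson_defect[OF Z c row], rule that)
  obtain u :: "'m list \<Rightarrow> complex" where
    u1: "((\<lambda>\<alpha>. (cmod (u \<alpha>))\<^sup>2) has_sum (2 * \<beta> / (1 + \<sigma> * \<beta>))) UNIV" and
    u2: "\<And>\<gamma>. \<gamma> \<noteq> [] \<Longrightarrow> ((\<lambda>\<alpha>. cnj (u (\<gamma> @ \<alpha>)) * u \<alpha>) has_sum of_real \<sigma> * prod_list (map b \<gamma>)) UNIV"
    by (rule scalar_dilation_vector[OF \<beta> \<sigma>], rule that)
  define v where "v = 2 * \<beta> / (1 + \<sigma> * \<beta>)"
  define \<nu> where "\<nu> = \<rho>' - \<rho> - \<mu> * v"
  have v: "0 \<le> v" using \<beta> \<sigma> by (auto simp: v_def)
  have \<nu>: "0 \<le> \<nu>" using \<rho>(2) by (simp add: \<nu>_def v_def)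
  have \<rho>': "0 < \<rho>'" using \<rho> mult_nonneg_nonneg[OF \<mu>(1) v] by (simp add: v_def)
  define G where "G \<alpha> h = blinfun_apply D (blinfun_apply (adj (word Z \<alpha>)) (blinfun_apply J h))" for \<alpha> h
  \<comment> \<open>Orthogonal components add their kernels. The third one lives at the empty word
    only and thus touches nothing but the diagonal; division by \<open>\<rho>'\<close> normalises
    the total mass to 1.\<close>
  define C where "C \<alpha> h = (sqrt (\<rho> / \<rho>') *\<^sub>R G \<alpha> h, sqrt (\<mu> / \<rho>') *\<^sub>R (u \<alpha> *\<^sub>C h),
      sqrt (\<nu> / \<rho>') *\<^sub>R (if \<alpha> = [] then h else 0))" for \<alpha> and h :: 'h
  have G_add: "G \<alpha> (x + y) = G \<alpha> x + G \<alpha> y" for \<alpha> x y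
    by (simp add: G_def blinfun.add_right)
  have G_scale: "G \<alpha> (d *\<^sub>C x) = d *\<^sub>C G \<alpha> x" for \<alpha> d x
    by (simp add: G_def clin_scaleC[OF J(1)] clin_scaleC[OF D] clin_scaleC[OF clin_adj[OF clin_word[OF Z]]])
  have C_add: "C \<alpha> (x + y) = C \<alpha> x + C \<alpha> y" for \<alpha> x y
    by (simp add: C_def G_add scaleR_add_right scaleC_add_right)
  have C_scale: "C \<alpha> (d *\<^sub>C x) = d *\<^sub>C C \<alpha> x" for \<alpha> d x
    by (simp add: C_def G_scale scaleC_prod_def scaleC_scaleR_commute scaleC_scaleC mult.commute)
  have C_cinner: "cinner (C \<alpha> x) (C \<alpha>' y) = of_real (\<rho> / \<rho>') * cinner (G \<alpha> x) (G \<alpha>' y)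
      + of_real (\<mu> / \<rho>') * (cnj (u \<alpha>) * u \<alpha>' * cinner x y)
      + of_real (\<nu> / \<rho>') * (if \<alpha> = [] \<and> \<alpha>' = [] then cinner x y else 0)" for \<alpha> \<alpha>' x y
  proof -
    show ?thesis
      unfolding C_def cinner_prod_def fst_conv snd_conv using \<rho>(1) \<rho>' \<mu>(1) \<nu>
      by (simp add: cinner_sqrt_scaleR cinner_scaleC_left cinner_scaleC_right mult_ac
          del: cinner_scaleR_left cinner_scaleR_right)
  qed
  have nJ: "norm (blinfun_apply J h) = norm h" for h
    using J(2) by (simp add: isometric_def)
  have "((\<lambda>\<alpha>. (norm (C \<alpha> x))\<^sup>2) has_sum (norm x)\<^sup>2) UNIV" for x
  proof -
    have "(norm (C \<alpha> x))\<^sup>2 = (\<rho> / \<rho>') * (norm (G \<alpha> x))\<^sup>2 + (\<mu> / \<rho>') * ((cmod (u \<alpha>))\<^sup>2 * (norm x)\<^sup>2)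
      + (\<nu> / \<rho>') * (if \<alpha> = [] then (norm x)\<^sup>2 else 0)" for \<alpha>
    proof -
      have "complex_of_real ((norm (C \<alpha> x))\<^sup>2) = of_real ((\<rho> / \<rho>') * (norm (G \<alpha> x))\<^sup>2 + (\<mu> / \<rho>') * ((cmod (u \<alpha>))\<^sup>2 * (norm x)\<^sup>2)
        + (\<nu> / \<rho>') * (if \<alpha> = [] then (norm x)\<^sup>2 else 0))"
        unfolding norm_sq_cinner[symmetric] C_cinner
        by (simp add: norm_sq_cinner complex_norm_square[unfolded of_real_power] mult.commute)
      then show ?thesis using of_real_eq_iff by blast
    qed
    moreover have "((\<lambda>\<alpha>. (\<rho> / \<rho>') * (norm (G \<alpha> x))\<^sup>2 + (\<mu> / \<rho>') * ((cmod (u \<alpha>))\<^sup>2 * (norm x)\<^sup>2)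
      + (\<nu> / \<rho>') * (if \<alpha> = [] then (norm x)\<^sup>2 else 0)) has_sum
      (\<rho> / \<rho>') * (norm (blinfun_apply J x))\<^sup>2 + (\<mu> / \<rho>') * (v * (norm x)\<^sup>2) + (\<nu> / \<rho>') * (norm x)\<^sup>2) UNIV"
      unfolding G_def v_def
      by (rule has_sum_add has_sum_cmult_right has_sum_cmult_left hsD u1 has_sum_delta)+
    moreover have "(\<rho> / \<rho>') * (norm (blinfun_apply J x))\<^sup>2 + (\<mu> / \<rho>') * (v * (norm x)\<^sup>2) + (\<nu> / \<rho>') * (norm x)\<^sup>2
        = (norm x)\<^sup>2"
      using \<rho>' by (simp add: nJ \<nu>_def field_simps)
    ultimately show ?thesis by simp
  qed
  moreover have "((\<lambda>\<alpha>. of_real \<rho>' * cinner (C (\<gamma> @ \<alpha>) h) (C \<alpha> k)) has_sum cinner h (blinfun_apply (word X \<gamma>) k)) UNIV"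
    if \<gamma>: "\<gamma> \<noteq> []" for \<gamma> h k
  proof -
    have "((\<lambda>\<alpha>. cinner (blinfun_apply D (blinfun_apply (adj (word Z \<alpha>)) x)) (blinfun_apply D (blinfun_apply (adj (word Z \<alpha>)) y)))
        has_sum cinner x y) UNIV" for x y
      by (rule has_sum_cinner_polarize[OF _ _ hsD])
        (simp_all add: blinfun.add_right clin_scaleC[OF D] clin_scaleC[OF clin_adj[OF clin_word[OF Z]]])
    from this[of "blinfun_apply (adj (word Z \<gamma>)) (blinfun_apply J h)" "blinfun_apply J k"]
    have G_ker: "((\<lambda>\<alpha>. cinner (G (\<gamma> @ \<alpha>) h) (G \<alpha> k))
        has_sum cinner (blinfun_apply J h) (blinfun_apply (word Z \<gamma>) (blinfun_apply J k))) UNIV"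
      by (simp add: G_def adj_word_append[OF Z] cinner_adj_left[OF clin_word[OF Z]])
    have "((\<lambda>\<alpha>. of_real \<rho> * cinner (G (\<gamma> @ \<alpha>) h) (G \<alpha> k) + of_real \<mu> * (cnj (u (\<gamma> @ \<alpha>)) * u \<alpha> * cinner h k))
      has_sum of_real \<rho> * cinner (blinfun_apply J h) (blinfun_apply (word Z \<gamma>) (blinfun_apply J k))
        + of_real \<mu> * (of_real \<sigma> * prod_list (map b \<gamma>) * cinner h k)) UNIV"
      by (intro has_sum_add has_sum_cmult_right has_sum_cmult_left G_ker u2 \<gamma>)
    moreover have "of_real \<mu> * (of_real \<sigma> * prod_list (map b \<gamma>) * cinner h k)
        = of_real (1 - \<rho>) * prod_list (map b \<gamma>) * cinner h k"
      by (simp only: \<mu>(2)[symmetric] of_real_mult mult.assoc)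
    moreover have "of_real \<rho> * cinner (G (\<gamma> @ \<alpha>) h) (G \<alpha> k) + of_real \<mu> * (cnj (u (\<gamma> @ \<alpha>)) * u \<alpha> * cinner h k)
        = of_real \<rho>' * cinner (C (\<gamma> @ \<alpha>) h) (C \<alpha> k)" for \<alpha>
      unfolding C_cinner using \<gamma> \<rho>' by (simp add: distrib_left)
    ultimately show ?thesis
      using X[OF \<gamma>] by simp
  qed
  ultimately show ?thesis
    by (intro class_C_from_coefficients[where C = C] C_add C_scale)
qed

text \<open>The relation between \<open>T\<close> and the dilation fails at the empty word, where
  the identity equals \<open>\<rho>\<close> times the compressed identity plus a remainder
  \<open>1 - \<rho>\<close>. The scalar term with the products of \<open>f j []\<close> is what this
  remainder becomes under substitution into \<open>f\<close>.\<close>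

lemma functional_calculus_dilation:
  fixes J :: "'h::complex_hilbert \<Rightarrow>\<^sub>L 'g::complex_hilbert" and V :: "'n::finite \<Rightarrow> 'g \<Rightarrow>\<^sub>L 'g"
    and f :: "'m \<Rightarrow> 'n list \<Rightarrow> complex" and T :: "'n \<Rightarrow> 'h \<Rightarrow>\<^sub>L 'h" and \<rho> t :: real
  assumes J: "clin J" "isometric J" and V: "isometric_tuple V" and t: "0 < t" "t < 1" and \<rho>: "0 < \<rho>"
    and f: "\<And>j. free_holomorphic (f j)" and T_clin: "\<And>i. clin (T i)"
    and T: "\<And>\<alpha> h k. \<alpha> \<noteq> [] \<Longrightarrow> cinner h (blinfun_apply (word T \<alpha>) k)
      = of_real \<rho> * cinner (blinfun_apply J h) (blinfun_apply (word (\<lambda>i. t *\<^sub>R V i) \<alpha>) (blinfun_apply J k))"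
  obtains Y :: "'m \<Rightarrow> 'g \<Rightarrow>\<^sub>L 'g"
  where "\<And>j. (\<lambda>k. homogeneous_part (f j) k (\<lambda>i. t *\<^sub>R V i)) sums Y j"
    and "\<And>\<gamma> h k. cinner h (blinfun_apply (word (\<lambda>j. free_eval_lim (f j) T) \<gamma>) k)
      = of_real \<rho> * cinner (blinfun_apply J h) (blinfun_apply (word Y \<gamma>) (blinfun_apply J k))
        + of_real (1 - \<rho>) * prod_list (map (\<lambda>j. f j []) \<gamma>) * cinner h k"
proof -
  define W where "W i = t *\<^sub>R V i" for i
  have clinV: "clin (V i)" for i using V by (simp add: isometric_tuple_def)
  have clinW: "clin (W i)" for i unfolding W_def by (rule clin_scaleR[OF clinV])
  have nJ: "norm (blinfun_apply J h) = norm h" for h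
    using J(2) by (simp add: isometric_def)
  have T': "cinner h (blinfun_apply (word T \<alpha>) k)
      = of_real \<rho> * cinner (blinfun_apply J h) (blinfun_apply (word W \<alpha>) (blinfun_apply J k))
        + of_real (1 - \<rho>) * (if \<alpha> = [] then cinner h k else 0)" for \<alpha> h k
  proof (cases "\<alpha> = []")
    case True
    then show ?thesis by (simp add: isometric_cinner[OF J] algebra_simps)
  next
    case False
    then show ?thesis using T[OF False, of h k] by (simp add: W_def[abs_def])
  qed
  have W_bound: "norm (blinfun_apply (homogeneous_part a k W) x) \<le> t ^ k * coeff_norm a k * norm x" for a k x
    unfolding W_def[abs_def] homogeneous_part_scaleR
    using t by (simp add: blinfun.scaleR_left norm_homogeneous_part_isometric[OF V])
  have W_norm: "norm (homogeneous_part a k W) \<le> t ^ k * coeff_norm a k" for a k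
    using t by (intro norm_blinfun_bound W_bound mult_nonneg_nonneg coeff_norm_nonneg) simp
  \<comment> \<open>Degree 0 is excluded because of the remainder at the empty word; for the
    comparison of series a single term is immaterial.\<close>
  have T_norm: "norm (homogeneous_part a k T) \<le> \<rho> * (t ^ k * coeff_norm a k)" if k: "k \<noteq> 0" for a k
  proof (rule norm_blinfun_bound)
    show "0 \<le> \<rho> * (t ^ k * coeff_norm a k)" using \<rho> t coeff_norm_nonneg[of a k] by simp
    fix x
    let ?z = "blinfun_apply (homogeneous_part a k T) x"
    have "cinner h ?z = of_real \<rho> * cinner (blinfun_apply J h) (blinfun_apply (homogeneous_part a k W) (blinfun_apply J x))" for h
    proof -
      have "cinner h ?z = (\<Sum>\<alpha> | length \<alpha> = k. a \<alpha> * cinner h (blinfun_apply (word T \<alpha>) x))"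
        by (simp add: homogeneous_part_apply cinner_sum_right cinner_scaleC_right)
      also have "\<dots> = (\<Sum>\<alpha> | length \<alpha> = k. of_real \<rho> * (a \<alpha> *
          cinner (blinfun_apply J h) (blinfun_apply (word W \<alpha>) (blinfun_apply J x))))"
        unfolding T' by (rule sum.cong) (use k in auto)
      also have "\<dots> = of_real \<rho> * cinner (blinfun_apply J h) (blinfun_apply (homogeneous_part a k W) (blinfun_apply J x))"
        by (simp add: homogeneous_part_apply cinner_sum_right cinner_scaleC_right sum_distrib_left)
      finally show ?thesis .
    qed
    from this[of ?z]
    have "(norm ?z)\<^sup>2 = \<rho> * Re (cinner (blinfun_apply J ?z) (blinfun_apply (homogeneous_part a k W) (blinfun_apply J x)))"
      by (simp add: Re_cinner_self[symmetric] del: Re_cinner_self)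
    also have "\<dots> \<le> \<rho> * (norm ?z * (t ^ k * coeff_norm a k * norm x))"
      using \<rho> W_bound[of a k "blinfun_apply J x"]
      by (intro mult_left_mono order_trans[OF Re_cinner_le]) (auto simp: nJ intro: mult_left_mono)
    finally have "norm ?z * norm ?z \<le> norm ?z * (\<rho> * (t ^ k * coeff_norm a k) * norm x)"
      by (simp add: power2_eq_square mult_ac)
    then show "norm ?z \<le> \<rho> * (t ^ k * coeff_norm a k) * norm x"
    proof (cases "norm ?z = 0")
      case False
      then have "0 < norm ?z" using norm_ge_zero[of ?z] by linarith
      then show ?thesis using mult_left_le_imp_le[OF \<open>norm ?z * norm ?z \<le> _\<close>] by blast
    qed (use \<rho> t coeff_norm_nonneg[of a k] in simp)
  qed
  have sum_W: "summable (\<lambda>k. homogeneous_part (f j) k W)" for j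
    by (rule summable_comparison_test'[OF summable_coeff_norm[OF f t], of 0 _ j]) (rule W_norm)
  have sum_T: "summable (\<lambda>k. norm (homogeneous_part (f j) k T))" for j
    by (rule summable_comparison_test'[OF summable_mult[OF summable_coeff_norm[OF f t]], of 1 _ \<rho> j])
      (use T_norm in auto)
  define Y where "Y j = (\<Sum>k. homogeneous_part (f j) k W)" for j
  define A where "A j = free_eval_lim (f j) T" for j
  have Y: "(\<lambda>k. homogeneous_part (f j) k W) sums Y j" for j
    unfolding Y_def by (rule summable_sums[OF sum_W])
  have A: "(\<lambda>k. homogeneous_part (f j) k T) sums A j" for j
    unfolding A_def free_eval_lim_eq[OF sum_T] by (rule summable_sums[OF summable_norm_cancel[OF sum_T]])
  have clinY: "clin (Y j)" for j
    by (rule clin_tendsto[OF Y[unfolded sums_def]]) (auto intro: clin_sum clin_homogeneous_part clinW)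
  have clinA: "clin (A j)" for j
    by (rule clin_tendsto[OF A[unfolded sums_def]]) (auto intro: clin_sum clin_homogeneous_part T_clin)
  \<comment> \<open>Compression is not multiplicative, so the factors \<open>A j\<close> are
    expanded one at a time from the right into series of words in \<open>T\<close>. These words
    collect in \<open>\<gamma>\<close>, over which the induction is generalised; the scalar term
    survives only as long as no letter of \<open>T\<close> has appeared.\<close>
  have main: "cinner h (blinfun_apply (word A \<delta>) (blinfun_apply (word T \<gamma>) x))
      = of_real \<rho> * cinner (blinfun_apply J h) (blinfun_apply (word Y \<delta>) (blinfun_apply (word W \<gamma>) (blinfun_apply J x)))
        + of_real (1 - \<rho>) * prod_list (map (\<lambda>j. f j []) \<delta>) * (if \<gamma> = [] then cinner h x else 0)" for \<delta> \<gamma> h x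
  proof (induction \<delta> arbitrary: \<gamma> h x rule: rev_induct)
    case Nil
    show ?case using T'[of h \<gamma> x] by simp
  next
    case (snoc j \<delta>)
    let ?c = "of_real (1 - \<rho>) * prod_list (map (\<lambda>j. f j []) \<delta>) * (if \<gamma> = [] then cinner h x else 0)"
    let ?y = "blinfun_apply (word T \<gamma>) x" and ?z = "blinfun_apply (word W \<gamma>) (blinfun_apply J x)"
    have clinWA: "clin (word A \<delta>)" and clinWY: "clin (word Y \<delta>)"
      by (auto intro: clinA clinY)
    have eq: "cinner h (blinfun_apply (word A \<delta>) (blinfun_apply (homogeneous_part (f j) k T) ?y))
        = of_real \<rho> * cinner (blinfun_apply J h) (blinfun_apply (word Y \<delta>) (blinfun_apply (homogeneous_part (f j) k W) ?z))
          + (if k = 0 then ?c * f j [] else 0)" for k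
    proof -
      have "cinner h (blinfun_apply (word A \<delta>) (blinfun_apply (homogeneous_part (f j) k T) ?y))
          = (\<Sum>\<beta> | length \<beta> = k. f j \<beta> * cinner h (blinfun_apply (word A \<delta>) (blinfun_apply (word T (\<beta> @ \<gamma>)) x)))"
        by (simp add: homogeneous_part_apply blinfun.sum_right clin_scaleC[OF clinWA] cinner_sum_right
            cinner_scaleC_right word_append)
      also have "\<dots> = (\<Sum>\<beta> | length \<beta> = k. of_real \<rho> * (f j \<beta> * cinner (blinfun_apply J h) (blinfun_apply (word Y \<delta>) (blinfun_apply (word W \<beta>) ?z)))
          + (if \<beta> = [] then ?c * f j [] else 0))"
        unfolding snoc.IH by (rule sum.cong) (auto simp: word_append algebra_simps)
      also have "\<dots> = of_real \<rho> * cinner (blinfun_apply J h) (blinfun_apply (word Y \<delta>) (blinfun_apply (homogeneous_part (f j) k W) ?z))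
          + (\<Sum>\<beta> :: 'n list | length \<beta> = k. if \<beta> = [] then ?c * f j [] else 0)"
        by (simp add: sum.distrib homogeneous_part_apply blinfun.sum_right clin_scaleC[OF clinWY]
            cinner_sum_right cinner_scaleC_right sum_distrib_left)
      also have "(\<Sum>\<beta> :: 'n list | length \<beta> = k. if \<beta> = [] then ?c * f j [] else 0) = (if k = 0 then ?c * f j [] else 0)"
        by (auto simp del: length_0_conv)
      finally show ?thesis .
    qed
    have "(\<lambda>k. cinner h (blinfun_apply (word A \<delta>) (blinfun_apply (homogeneous_part (f j) k T) ?y)))
        sums cinner h (blinfun_apply (word A \<delta>) (blinfun_apply (A j) ?y))"
      by (rule bounded_linear.sums[OF bounded_linear_cinner_apply A])
    moreover have "(\<lambda>k. of_real \<rho> * cinner (blinfun_apply J h) (blinfun_apply (word Y \<delta>) (blinfun_apply (homogeneous_part (f j) k W) ?z))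
          + (if k = 0 then ?c * f j [] else 0))
        sums (of_real \<rho> * cinner (blinfun_apply J h) (blinfun_apply (word Y \<delta>) (blinfun_apply (Y j) ?z)) + ?c * f j [])"
      using sums_single[of 0 "\<lambda>_. ?c * f j []"]
      by (intro sums_add sums_mult bounded_linear.sums[OF bounded_linear_cinner_apply Y]) simp
    ultimately have "cinner h (blinfun_apply (word A \<delta>) (blinfun_apply (A j) ?y))
        = of_real \<rho> * cinner (blinfun_apply J h) (blinfun_apply (word Y \<delta>) (blinfun_apply (Y j) ?z)) + ?c * f j []"
      unfolding eq by (rule sums_unique2)
    then show ?case by (simp add: word_append mult_ac)
  qed
  show thesis
  proof (rule that)
    show "(\<lambda>k. homogeneous_part (f j) k (\<lambda>i. t *\<^sub>R V i)) sums Y j" for j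
      using Y[of j] by (simp add: W_def[abs_def])
    show "cinner h (blinfun_apply (word (\<lambda>j. free_eval_lim (f j) T) \<gamma>) k)
      = of_real \<rho> * cinner (blinfun_apply J h) (blinfun_apply (word Y \<gamma>) (blinfun_apply J k))
        + of_real (1 - \<rho>) * prod_list (map (\<lambda>j. f j []) \<gamma>) * cinner h k" for \<gamma> h k
      using main[of h \<gamma> "[]" k] by (simp add: A_def[abs_def])
  qed
qed

section \<open>Origin of \<open>\<rho>\<^sub>f\<close> and the conclusion\<close>

lemma rho_f_slack:
  fixes f :: "'m::finite \<Rightarrow> 'n list \<Rightarrow> complex"
  assumes a: "norm (value_at_0 f) < 1" and \<sigma>: "\<sigma> = (if 1 < \<rho> then -1 else 1)"
    and \<rho>1: "\<rho>1 < \<rho>" "1 < \<rho> \<Longrightarrow> 1 \<le> \<rho>1"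
  defines "a \<equiv> norm (value_at_0 f)"
  shows "\<rho>1 + \<bar>1 - \<rho>1\<bar> * (2 * a / (1 + \<sigma> * a)) < rho_f \<rho> f"
proof -
  have a01: "0 \<le> a" "a < 1" using a by (simp_all add: a_def)
  show ?thesis
  proof (cases "1 < \<rho>")
    case True
    \<comment> \<open>Because of \<open>1 + 2 * a / (1 - a) = (1 + a) / (1 - a)\<close>, both
      expressions would agree if \<open>\<rho>1\<close> were \<open>\<rho>\<close>; the gap is
      \<open>\<rho> - \<rho>1\<close> times the upper Harnack constant. The other case is the same
      with the lower one.\<close>
    have eq: "1 + (\<rho> - 1) * ((1 + a) / (1 - a)) - (\<rho>1 + (\<rho>1 - 1) * (2 * a / (1 - a)))
        = (\<rho> - \<rho>1) * ((1 + a) / (1 - a))"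
    proof -
      have "(1 + a) / (1 - a) = 1 + 2 * a / (1 - a)" using a01 by (simp add: field_simps)
      then show ?thesis by (simp only:) (simp only: algebra_simps)
    qed
    have "0 < (\<rho> - \<rho>1) * ((1 + a) / (1 - a))"
      using a01 \<rho>1 by (intro mult_pos_pos divide_pos_pos) auto
    with eq show ?thesis
      using True \<rho>1 by (simp add: rho_f_def \<sigma> a_def[symmetric])
  next
    case False
    have eq: "1 + (\<rho> - 1) * ((1 - a) / (1 + a)) - (\<rho>1 + (1 - \<rho>1) * (2 * a / (1 + a)))
        = (\<rho> - \<rho>1) * ((1 - a) / (1 + a))"
    proof -
      have "(1 - a) / (1 + a) = 1 - 2 * a / (1 + a)" using a01 by (simp add: field_simps)
      then show ?thesis by (simp only:) (simp only: algebra_simps)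
    qed
    have "0 < (\<rho> - \<rho>1) * ((1 - a) / (1 + a))"
      using a01 \<rho>1 by (intro mult_pos_pos divide_pos_pos) auto
    \<comment> \<open>At \<open>\<rho> = 1\<close> the definition takes its other branch, but the
      factor \<open>\<rho> - 1\<close> vanishes and both branches give 1.\<close>
    moreover have "rho_f \<rho> f = 1 + (\<rho> - 1) * ((1 - a) / (1 + a))"
      using False by (cases "\<rho> = 1") (auto simp: rho_f_def a_def[symmetric])
    ultimately show ?thesis
      using eq False \<rho>1 by (simp add: \<sigma>)
  qed
qed

lemma adj_scaleR:
  assumes "clin A"
  shows "adj (r *\<^sub>R A) = r *\<^sub>R adj A"
  by (rule cinner_unique_adj) (simp add: blinfun.scaleR_left cinner_adj_right[OF assms])

theorem theorem4p11:
  fixes f :: "'m::finite \<Rightarrow> 'n::finite list \<Rightarrow> complex"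
    and T :: "'n \<Rightarrow> 'h::complex_hilbert \<Rightarrow>\<^sub>L 'h"
    and \<rho> :: real
  assumes K_separable: "\<exists>D :: 'k::complex_hilbert set. countable D \<and> closure D = UNIV"
    and K_infinite_dim: "\<nexists>D :: 'k set. finite D \<and> span D = UNIV"
    and rho_pos: "\<rho> > 0"
    and holomorphic: "\<And>j. free_holomorphic (f j)"
    and contractive: "contractive TYPE('k) f"
    and norm_f0: "norm (value_at_0 f) < 1"
    and boundary: "\<And>j. boundary_in_disc_algebra (f j)"
    and T_clin: "\<And>i. clin (T i)"
    and radius: "joint_radius TYPE('g::complex_hilbert) \<rho> T < 1"
  shows "joint_radius TYPE(('m list, 'h) ell2) (rho_f \<rho> f) (\<lambda>j. free_eval_lim (f j) T) < 1
    \<and> (value_at_0 f = 0 \<longrightarrow>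
        joint_radius TYPE(('m list, 'h) ell2) \<rho> (\<lambda>j. free_eval_lim (f j) T) < 1)"
proof -
  obtain t0 where t0: "0 < t0" "t0 < 1" and "class_C TYPE('g) \<rho> (\<lambda>i. (1 / t0) *\<^sub>R T i)"
    using radius unfolding joint_radius_def Inf_less_iff by auto
  then obtain J0 :: "'h \<Rightarrow>\<^sub>L 'g" and V0 where dil0: "dilation J0 V0 \<rho> (\<lambda>i. (1 / t0) *\<^sub>R T i)"
    unfolding class_C_iff_dilation by blast
  \<comment> \<open>At \<open>r = 1 / (2 * \<rho> - 1)\<close> the parameter
    \<open>\<rho> * (2 * r / (1 + r))\<close> equals 1. For \<open>\<rho> > 1\<close>, staying above
    this value keeps \<open>\<rho>1\<close> at least 1, so that \<open>C - P\<close> remains the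
    summand to use; for \<open>\<rho> \<le> 1\<close> the new parameter is below 1 anyway.\<close>
  define b where "b = (if 1 < \<rho> then 1 / (2 * \<rho> - 1) else 0)"
  have "max t0 b < 1"
    using t0 by (auto simp: b_def)
  from dense[OF this] obtain r where r': "max t0 b < r" "r < 1" by blast
  then have r: "t0 < r" "r < 1" "1 < \<rho> \<Longrightarrow> 1 / (2 * \<rho> - 1) < r"
    by (simp_all add: b_def)
  have r0: "0 < r" using t0 r by simp
  define \<rho>1 where "\<rho>1 = \<rho> * (2 * r / (1 + r))"
  have \<rho>1: "0 < \<rho>1" "\<rho>1 < \<rho>" using rho_pos r0 r by (simp_all add: \<rho>1_def field_simps)
  have \<rho>1_ge: "1 \<le> \<rho>1" if "1 < \<rho>"
    using r(3)[OF that] that r0 by (simp add: \<rho>1_def field_simps)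
  obtain J :: "'h \<Rightarrow>\<^sub>L (unit list, 'g) ell2" and V where
    dil: "dilation J V \<rho>1 (\<lambda>i. r *\<^sub>R (1 / t0) *\<^sub>R T i)"
    unfolding \<rho>1_def by (rule dilation_slack[OF dil0 r0 r(2)])
  then have J: "clin J" "isometric J" and V: "isometric_tuple V" by (auto simp: dilation_def)
  \<comment> \<open>The slack is factored as \<open>t0 = t * r\<close>: the factor \<open>r\<close>
    has been spent on lowering \<open>\<rho>\<close>, and \<open>t < 1\<close> remains for the
    strictness of the row \<open>Y\<close>.\<close>
  define t where "t = t0 / r"
  have t: "0 < t" "t < 1" using t0 r r0 by (simp_all add: t_def)
  have T_eq: "T = (\<lambda>i. t *\<^sub>R (r *\<^sub>R (1 / t0) *\<^sub>R T i))"
    using t0 r0 by (simp add: t_def)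
  have T: "cinner h (blinfun_apply (word T \<alpha>) k)
      = of_real \<rho>1 * cinner (blinfun_apply J h) (blinfun_apply (word (\<lambda>i. t *\<^sub>R V i) \<alpha>) (blinfun_apply J k))"
    if "\<alpha> \<noteq> []" for \<alpha> h k
  proof -
    have "cinner h (blinfun_apply (word (\<lambda>i. t *\<^sub>R (r *\<^sub>R (1 / t0) *\<^sub>R T i)) \<alpha>) k)
        = of_real \<rho>1 * cinner (blinfun_apply J h) (blinfun_apply (word (\<lambda>i. t *\<^sub>R V i) \<alpha>) (blinfun_apply J k))"
      unfolding word_scaleR[of t] using dil that by (simp add: dilation_def blinfun.scaleR_left)
    then show ?thesis by (simp only: T_eq[symmetric])
  qed
  let ?A = "\<lambda>j. free_eval_lim (f j) T"
  obtain Y where Y: "\<And>j. (\<lambda>k. homogeneous_part (f j) k (\<lambda>i. t *\<^sub>R V i)) sums Y j"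
    and A: "\<And>\<gamma> h k. cinner h (blinfun_apply (word ?A \<gamma>) k)
      = of_real \<rho>1 * cinner (blinfun_apply J h) (blinfun_apply (word Y \<gamma>) (blinfun_apply J k))
        + of_real (1 - \<rho>1) * prod_list (map (\<lambda>j. f j []) \<gamma>) * cinner h k"
    by (rule functional_calculus_dilation[OF J V t \<rho>1(1) holomorphic T_clin T], assumption, rule that)
  have clinV: "clin (V i)" for i using V by (simp add: isometric_tuple_def)
  have clinW: "clin (t *\<^sub>R V i)" for i by (rule clin_scaleR[OF clinV])
  have clinY: "clin (Y j)" for j
    by (rule clin_tendsto[OF Y[unfolded sums_def]]) (auto intro: clin_sum clin_homogeneous_part clinW)
  define a where "a = norm (value_at_0 f)"
  have a: "0 \<le> a" "a < 1" using norm_f0 by (simp_all add: a_def)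
  have a2: "a\<^sup>2 = (\<Sum>j\<in>UNIV. (cmod (f j []))\<^sup>2)"
    by (simp add: a_def norm_vec_def value_at_0_def L2_set_def sum_nonneg)
  \<comment> \<open>The Schwarz-Pick constant for the row \<open>t *\<^sub>R V i\<close>, whose own
    squared row bound is \<open>t\<^sup>2\<close>.\<close>
  define c where "c = 1 - (1 - t\<^sup>2) * (1 - a)\<^sup>2"
  have t2: "0 < 1 - t\<^sup>2" "1 - t\<^sup>2 \<le> 1" using t by (simp_all add: power_less_one_iff)
  have "0 < (1 - t\<^sup>2) * (1 - a)\<^sup>2" using t2 a by simp
  moreover have "(1 - t\<^sup>2) * (1 - a)\<^sup>2 \<le> 1 * 1"
    using t2 a by (intro mult_mono) (auto simp: power_le_one)
  ultimately have c: "0 \<le> c" "c < 1" by (simp_all add: c_def)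
  have rowY: "(\<Sum>j\<in>UNIV. (norm (blinfun_apply (adj (Y j)) h))\<^sup>2) \<le> c * (norm h)\<^sup>2" for h
    unfolding c_def a_def
  proof (rule free_eval_strict_row_contraction[OF K_infinite_dim contractive _ clinW _ _ _ Y])
    show "(\<Sum>i\<in>UNIV. (norm (blinfun_apply (adj (t *\<^sub>R V i)) h))\<^sup>2) \<le> t\<^sup>2 * (norm h)\<^sup>2" for h
      using mult_left_mono[OF isometric_tuple_adj_sum[OF V, of h], of "t\<^sup>2"]
      by (simp add: adj_scaleR[OF clinV] blinfun.scaleR_left power_mult_distrib sum_distrib_left)
  qed (use norm_f0 t2 in auto)
  \<comment> \<open>The choice between \<open>P - c\<close> and \<open>C - P\<close>; since
    \<open>\<rho>1\<close> has not crossed 1, it agrees with the sign of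
    \<open>1 - \<rho>1\<close>.\<close>
  define \<sigma> :: real where "\<sigma> = (if 1 < \<rho> then -1 else 1)"
  define \<mu> where "\<mu> = \<bar>1 - \<rho>1\<bar>"
  have \<mu>: "0 \<le> \<mu>" "\<mu> * \<sigma> = 1 - \<rho>1"
    using \<rho>1 \<rho>1_ge by (auto simp: \<mu>_def \<sigma>_def)
  \<comment> \<open>Three conditions hold strictly at \<open>s = 1\<close> and persist for
    \<open>s\<close> slightly smaller: the total mass is below \<open>rho_f\<close>, the row
    \<open>Y/s\<close> is strict, and the point \<open>f(0)/s\<close> lies in the open ball.\<close>
  have "\<rho>1 + \<mu> * (2 * a / (1 + \<sigma> * a)) < rho_f \<rho> f"
    unfolding \<mu>_def a_def by (rule rho_f_slack[OF norm_f0 \<sigma>_def \<rho>1(2) \<rho>1_ge])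
  moreover have "((\<lambda>s. \<rho>1 + \<mu> * (2 * (a / s) / (1 + \<sigma> * (a / s)))) \<longlongrightarrow> \<rho>1 + \<mu> * (2 * (a / 1) / (1 + \<sigma> * (a / 1)))) (at_left 1)"
    by (intro tendsto_intros) (use a in \<open>auto simp: \<sigma>_def\<close>)
  ultimately have "\<forall>\<^sub>F s in at_left 1. \<rho>1 + \<mu> * (2 * (a / s) / (1 + \<sigma> * (a / s))) < rho_f \<rho> f"
    by (intro order_tendstoD(2)) simp_all
  moreover have "((\<lambda>s::real. s\<^sup>2) \<longlongrightarrow> 1\<^sup>2) (at_left 1)" by (intro tendsto_intros)
  then have "\<forall>\<^sub>F s in at_left 1. c < s\<^sup>2" by (rule order_tendstoD(1)) (simp add: c)
  moreover have "\<forall>\<^sub>F s in at_left 1. s \<in> {a<..<1}" by (rule eventually_at_left_real) (rule a)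
  ultimately have "\<forall>\<^sub>F s in at_left 1. \<rho>1 + \<mu> * (2 * (a / s) / (1 + \<sigma> * (a / s))) < rho_f \<rho> f \<and> c < s\<^sup>2 \<and> s \<in> {a<..<1}"
    by eventually_elim simp
  then obtain s where s: "\<rho>1 + \<mu> * (2 * (a / s) / (1 + \<sigma> * (a / s))) < rho_f \<rho> f" "c < s\<^sup>2" "a < s" "s < 1"
    using eventually_happens'[OF trivial_limit_at_left_real] by auto
  have s0: "0 < s" using a s by simp
  have "class_C TYPE(('m list, 'h) ell2) (rho_f \<rho> f) (\<lambda>j. (1 / s) *\<^sub>R ?A j)"
  proof (rule class_C_of_row_contraction[OF J])
    show "clin ((1 / s) *\<^sub>R Y j)" for j by (rule clin_scaleR[OF clinY])
    show "0 \<le> c / s\<^sup>2" "c / s\<^sup>2 < 1" using c s s0 by (simp_all add: field_simps)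
    show "(\<Sum>j\<in>UNIV. (norm (blinfun_apply (adj ((1 / s) *\<^sub>R Y j)) h))\<^sup>2) \<le> c / s\<^sup>2 * (norm h)\<^sup>2" for h
      using divide_right_mono[OF rowY[of h], of "s\<^sup>2"]
      by (simp add: adj_scaleR[OF clinY] blinfun.scaleR_left power_divide sum_divide_distrib)
    show "0 \<le> a / s" "a / s < 1" using a s s0 by simp_all
    show "(a / s)\<^sup>2 = (\<Sum>j\<in>UNIV. (cmod (f j [] / of_real s))\<^sup>2)"
      by (simp add: power_divide norm_divide a2 sum_divide_distrib)
    show "\<sigma> = 1 \<or> \<sigma> = -1" by (simp add: \<sigma>_def)
    show "0 \<le> \<mu>" "\<mu> * \<sigma> = 1 - \<rho>1" by (rule \<mu>)+
    show "0 < \<rho>1" by (rule \<rho>1)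
    show "\<rho>1 + \<mu> * (2 * (a / s) / (1 + \<sigma> * (a / s))) \<le> rho_f \<rho> f" using s by simp
    show "cinner h (blinfun_apply (word (\<lambda>j. (1 / s) *\<^sub>R ?A j) \<gamma>) k)
      = of_real \<rho>1 * cinner (blinfun_apply J h) (blinfun_apply (word (\<lambda>j. (1 / s) *\<^sub>R Y j) \<gamma>) (blinfun_apply J k))
        + of_real (1 - \<rho>1) * prod_list (map (\<lambda>j. f j [] / of_real s) \<gamma>) * cinner h k" for \<gamma> h k
    proof -
      have p: "prod_list (map (\<lambda>j. f j [] / of_real s) \<gamma>) = of_real ((1 / s) ^ length \<gamma>) * prod_list (map (\<lambda>j. f j []) \<gamma>)"
        by (induction \<gamma>) simp_all
      show ?thesis
        unfolding word_scaleR[of "1 / s"] p blinfun.scaleR_left cinner_scaleR_right A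
        by (simp only: distrib_left mult_ac)
    qed
  qed
  then have "joint_radius TYPE(('m list, 'h) ell2) (rho_f \<rho> f) ?A \<le> ereal s"
    unfolding joint_radius_def using s0 by (intro Inf_lower) blast
  also have "\<dots> < 1" using s by simp
  finally have radius_f: "joint_radius TYPE(('m list, 'h) ell2) (rho_f \<rho> f) ?A < 1" .
  show ?thesis
  proof (intro conjI impI)
    show "joint_radius TYPE(('m list, 'h) ell2) (rho_f \<rho> f) ?A < 1" by (rule radius_f)
    assume "value_at_0 f = 0"
    then have "rho_f \<rho> f = \<rho>" by (simp add: rho_f_def)
    with radius_f show "joint_radius TYPE(('m list, 'h) ell2) \<rho> ?A < 1" by (simp only:)
  qed
qed

end
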